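(* Let $L$ and $M$ be completely regular frames. The following are equivalent: (1) $\mathfrak{B}(L)$ and $\mathfrak{B}(M)$ are isomorphic. (2) $\mathrm{H}_{nf}(L)$ and $\mathrm{H}_{nf}(M)$ are Riesz isomorphic. (3) $\mathrm{C}(L)$ and $\mathrm{C}(M)$ have Riesz isomorphic universal completions.
   Context: Frames: $a^\ast=\bigvee\{b\mid a\wedge b=0\}$ is the pseudocomplement in a frame $L$. Write $b\prec a$ if $b^\ast\vee a=1$, and $b\prec\!\!\prec a$ if there are $c_r\in L$ ($r\in\mathbb{Q}\cap[0,1]$) with $b\le c_0$, $c_1\le a$, $c_r\prec c_s$ for $r<s$. $L$ is completely regular if $a=\bigvee\{b\mid b\prec\!\!\prec a\}$ for all $a$. $\mathfrak{B}(L)=\{a\in L\mid a=a^{\ast\ast}\}$ is the Booleanization (a complete Boolean algebra with meets as in $L$ and joins $(\bigvee^L A)^{\ast\ast}$), and $\beta\colon L\to\mathfrak{B}(L)$, $\beta(a)=a^{\ast\ast}$, is a frame homomorphism. Consider generators $(p,-)$ and $(-,p)$, $p\in\mathbb{Q}$, and relations (r1) $(p,-)\wedge(-,q)=0$ if $p\ge q$; (r2) $(p,-)\vee(-,q)=1$ if $p<q$; (r3) $(p,-)=\bigvee_{q>p}(q,-)$; (r4) $(-,p)=\bigvee_{q<p}(-,q)$; (r5) $\bigvee_p(p,-)=1$; (r6) $\bigvee_p(-,p)=1$. $\mathfrak{L}(\mathbb{R})$ is the frame presented by (r1)–(r6); $\mathfrak{L}(\overline{\mathbb{IR}})$ is the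 frame presented by (r1), (r3), (r4) only. $\mathrm{C}(L)$ is the set of frame homomorphisms $\mathfrak{L}(\mathbb{R})\to L$, and $\overline{\mathrm{IC}}(L)$ the set of frame homomorphisms $\mathfrak{L}(\overline{\mathbb{IR}})\to L$. Order on $\overline{\mathrm{IC}}(L)$: $f\le g$ iff $f(p,-)\le g(p,-)$ and $f(-,q)\ge g(-,q)$ for all $p,q\in\mathbb{Q}$ (on $\mathrm{C}(L)$ either condition suffices). $\mathrm{C}(L)$ is an Archimedean Riesz space with $(f\vee g)(p,-)=f(p,-)\vee g(p,-)$, $(f\wedge g)(p,-)=f(p,-)\wedge g(p,-)$, $(f+g)(p,-)=\bigvee_{r\in\mathbb{Q}}f(r,-)\wedge g(p-r,-)$, $(f+g)(-,q)=\bigvee_{s\in\mathbb{Q}}f(-,s)\wedge g(-,q-s)$, $(-f)(p,-)=f(-,-p)$, $(-f)(-,q)=f(-q,-)$, and for $\lambda>0$ $(\lambda f)(p,-)=\bigvee\{f(r,-)\mid r\in\mathbb{Q},\lambda r>p\}$, $(\lambda f)(-,q)=\bigvee\{f(-,s)\mid s\in\mathbb{Q},\lambda s<q\}$. $f\in\overline{\mathrm{IC}}(L)$ is Hausdorff continuous if $f(p,-)^\ast\le f(-,q)$ and $f(-,q)^\ast\le f(p,-)$ for all $p<q$ in $\mathbb{Q}$; it is nearly finite if moreover $(\bigvee_p f(p,-))^{\ast\ast}=1=(\bigvee_q f(-,q))^{\ast\ast}$. $\mathrm{H}_{nf}(L)$ is the set of nearly finite Hausdorff continuous functions with the order of $\overline{\mathrm{IC}}(L)$.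 The maps $\Gamma\colon\mathrm{H}_{nf}(L)\to\mathrm{C}(\mathfrak{B}(L))$, $\Gamma(f)=\beta\circ f$, and $\Delta\colon\mathrm{C}(\mathfrak{B}(L))\to\mathrm{H}_{nf}(L)$, $\Delta(g)(p,-)=\bigvee^L_{r>p}g(r,-)$, $\Delta(g)(-,q)=\bigvee^L_{s<q}g(-,s)$, are mutually inverse order isomorphisms (known), and $\mathrm{H}_{nf}(L)$ carries the Riesz space structure transported along them: $\lambda\odot f=\Delta(\lambda\cdot\Gamma(f))$, $f\oplus g=\Delta(\Gamma(f)+\Gamma(g))$. A Riesz space is universally complete if it is Dedekind complete (nonempty subsets bounded above have suprema) and laterally complete (every nonempty set of pairwise disjoint positive elements has a supremum). A universal completion of $R$ is a universally complete Riesz space $\mathcal{U}(R)$ with a Riesz space embedding $\mu\colon R\to\mathcal{U}(R)$ such that $f=\bigvee\{\mu(g)\mid g\in R,\ 0\le\mu(g)\le f\}$ for all $f\in\mathcal{U}(R)^+$; for Archimedean $R$ it exists and is unique up to isomorphism. *)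

theory Defs
  imports Complex_Main "HOL-Library.FSet"
begin

unbundle lattice_syntax

section \<open>Frames\<close>

class frame = complete_lattice +
  assumes inf_Sup_frame: "a \<sqinter> \<Squnion>B = (\<Squnion>b\<in>B. a \<sqinter> b)"

definition frame_hom :: "('a::frame \<Rightarrow> 'b::frame) \<Rightarrow> bool" where
  "frame_hom h \<longleftrightarrow> h \<top> = \<top> \<and> (\<forall>a b. h (a \<sqinter> b) = h a \<sqinter> h b) \<and> (\<forall>A. h (\<Squnion>A) = \<Squnion>(h ` A))"

definition frame_isomorphic :: "'a::frame itself \<Rightarrow> 'b::frame itself \<Rightarrow> bool" where
  "frame_isomorphic _ _ \<longleftrightarrow> (\<exists>h :: 'a \<Rightarrow> 'b. frame_hom h \<and> bij h)"

definition pcompl :: "'a::frame \<Rightarrow> 'a" where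
  "pcompl a = \<Squnion>{b. a \<sqinter> b = \<bottom>}"

definition rather_below :: "'a::frame \<Rightarrow> 'a \<Rightarrow> bool" where
  "rather_below b a \<longleftrightarrow> pcompl b \<squnion> a = \<top>"

definition completely_below :: "'a::frame \<Rightarrow> 'a \<Rightarrow> bool" where
  "completely_below b a \<longleftrightarrow>
     (\<exists>c :: rat \<Rightarrow> 'a. b \<le> c 0 \<and> c 1 \<le> a \<and>
        (\<forall>r s. 0 \<le> r \<and> r < s \<and> s \<le> 1 \<longrightarrow> rather_below (c r) (c s)))"

definition completely_regular :: "'a::frame itself \<Rightarrow> bool" where
  "completely_regular _ \<longleftrightarrow> (\<forall>a :: 'a. a = \<Squnion>{b. completely_below b a})"

lemma frame_homI:
  assumes "h \<top> = \<top>" "\<And>a b. h (a \<sqinter> b) = h a \<sqinter> h b" "\<And>A. h (\<Squnion>A) = \<Squnion>(h ` A)"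
  shows "frame_hom h"
  using assms by (simp add: frame_hom_def)

lemma frame_hom_top: "frame_hom h \<Longrightarrow> h \<top> = \<top>"
  by (simp add: frame_hom_def)

lemma frame_hom_inf: "frame_hom h \<Longrightarrow> h (a \<sqinter> b) = h a \<sqinter> h b"
  by (simp add: frame_hom_def)

lemma frame_hom_Sup: "frame_hom h \<Longrightarrow> h (\<Squnion>A) = \<Squnion>(h ` A)"
  by (simp add: frame_hom_def)

lemma frame_hom_bot: "frame_hom h \<Longrightarrow> h \<bottom> = \<bottom>"
  using frame_hom_Sup[of h "{}"] by simp

lemma frame_hom_sup: "frame_hom h \<Longrightarrow> h (a \<squnion> b) = h a \<squnion> h b"
  using frame_hom_Sup[of h "{a, b}"] by simp

lemma frame_hom_mono: "frame_hom h \<Longrightarrow> a \<le> b \<Longrightarrow> h a \<le> h b"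
  by (metis frame_hom_inf inf.absorb_iff1)

lemma Sup_inf_frame: "\<Squnion>B \<sqinter> a = (\<Squnion>b\<in>B. b \<sqinter> (a::'a::frame))"
  by (simp add: inf_Sup_frame inf.commute)

lemma inf_pcompl: "a \<sqinter> pcompl a = (\<bottom>::'a::frame)"
  unfolding pcompl_def inf_Sup_frame by (auto intro!: antisym SUP_least)

lemma le_pcompl_iff: "b \<le> pcompl a \<longleftrightarrow> a \<sqinter> b = (\<bottom>::'a::frame)"
proof
  assume "b \<le> pcompl a"
  then have "a \<sqinter> b \<le> a \<sqinter> pcompl a" by (rule inf_mono[OF order_refl])
  then show "a \<sqinter> b = \<bottom>" by (simp add: inf_pcompl bot_unique)
qed (auto simp: pcompl_def intro: Sup_upper)

lemma pcompl_antimono: "a \<le> b \<Longrightarrow> pcompl b \<le> pcompl (a::'a::frame)"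
  by (metis bot_unique inf_mono inf_pcompl le_pcompl_iff order_refl)

lemma le_pcompl_pcompl: "a \<le> pcompl (pcompl (a::'a::frame))"
  by (simp add: le_pcompl_iff inf.commute inf_pcompl)

lemma pcompl3 [simp]: "pcompl (pcompl (pcompl a)) = pcompl (a::'a::frame)"
  by (simp add: antisym le_pcompl_pcompl pcompl_antimono)

lemma pcompl_bot [simp]: "pcompl (\<bottom>::'a::frame) = \<top>"
  by (simp add: top_unique[symmetric] le_pcompl_iff)

lemma pcompl_top [simp]: "pcompl (\<top>::'a::frame) = \<bottom>"
  using inf_pcompl[of \<top>] by simp

lemma pcompl_pcompl_inf:
  "pcompl (pcompl (a \<sqinter> b)) = pcompl (pcompl a) \<sqinter> pcompl (pcompl (b::'a::frame))"
proof (rule antisym)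
  show "pcompl (pcompl (a \<sqinter> b)) \<le> pcompl (pcompl a) \<sqinter> pcompl (pcompl b)"
    by (simp add: pcompl_antimono)
  have 1: "pcompl (a \<sqinter> b) \<sqinter> (a \<sqinter> b) = \<bottom>"
    by (simp add: inf.commute inf_pcompl)
  then have "pcompl (a \<sqinter> b) \<sqinter> a \<le> pcompl b"
    by (simp add: le_pcompl_iff inf_assoc inf_left_commute inf_commute)
  then have "(pcompl (a \<sqinter> b) \<sqinter> a) \<sqinter> pcompl (pcompl b) = \<bottom>"
    by (metis inf.commute le_pcompl_iff pcompl3)
  then have "pcompl (a \<sqinter> b) \<sqinter> pcompl (pcompl b) \<le> pcompl a"
    by (simp add: le_pcompl_iff inf_assoc inf_left_commute inf_commute)
  then have "(pcompl (a \<sqinter> b) \<sqinter> pcompl (pcompl b)) \<sqinter> pcompl (pcompl a) = \<bottom>"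
    by (metis inf.commute le_pcompl_iff pcompl3)
  then show "pcompl (pcompl a) \<sqinter> pcompl (pcompl b) \<le> pcompl (pcompl (a \<sqinter> b))"
    by (simp add: le_pcompl_iff inf_assoc inf_left_commute inf_commute)
qed

section \<open>The Booleanization\<close>

typedef (overloaded) 'a booleanization = "{a :: 'a::frame. a = pcompl (pcompl a)}"
  morphisms of_bool_frame Abs_booleanization
  by (rule exI[of _ "pcompl \<bottom>"]) (simp del: pcompl_bot)

setup_lifting type_definition_booleanization

lift_definition booleanize :: "'a::frame \<Rightarrow> 'a booleanization" is "\<lambda>a. pcompl (pcompl a)"
  by simp

instantiation booleanization :: (frame) frame
begin

lift_definition less_eq_booleanization :: "'a booleanization \<Rightarrow> 'a booleanization \<Rightarrow> bool" is "(\<le>)" .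
lift_definition less_booleanization :: "'a booleanization \<Rightarrow> 'a booleanization \<Rightarrow> bool" is "(<)" .
lift_definition inf_booleanization :: "'a booleanization \<Rightarrow> 'a booleanization \<Rightarrow> 'a booleanization"
  is "(\<sqinter>)" by (simp add: pcompl_pcompl_inf)
lift_definition sup_booleanization :: "'a booleanization \<Rightarrow> 'a booleanization \<Rightarrow> 'a booleanization"
  is "\<lambda>a b. pcompl (pcompl (a \<squnion> b))" by simp
lift_definition bot_booleanization :: "'a booleanization" is \<bottom> by simp
lift_definition top_booleanization :: "'a booleanization" is \<top> by simp
lift_definition Sup_booleanization :: "'a booleanization set \<Rightarrow> 'a booleanization"
  is "\<lambda>A. pcompl (pcompl (\<Squnion>A))" by simp
lift_definition Inf_booleanization :: "'a booleanization set \<Rightarrow> 'a booleanization"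
  is "\<lambda>A. \<Sqinter>A"
proof -
  fix A :: "'a set" assume A: "\<And>x. x \<in> A \<Longrightarrow> x = pcompl (pcompl x)"
  have "pcompl (pcompl (\<Sqinter>A)) \<le> x" if "x \<in> A" for x
    using A[OF that] by (metis Inf_lower pcompl_antimono that)
  then show "\<Sqinter>A = pcompl (pcompl (\<Sqinter>A))"
    by (intro antisym le_pcompl_pcompl Inf_greatest)
qed

instance
proof
  have least: "pcompl (pcompl a) \<le> z" if "a \<le> z" "z = pcompl (pcompl z)" for a z :: 'a
    using that by (metis pcompl_antimono)
  fix x y z :: "'a booleanization" and A :: "'a booleanization set"
  show "(x < y) = (x \<le> y \<and> \<not> y \<le> x)" by transfer auto
  show "x \<le> x" by transfer simp
  show "x \<le> y \<Longrightarrow> y \<le> z \<Longrightarrow> x \<le> z" by transfer simp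
  show "x \<le> y \<Longrightarrow> y \<le> x \<Longrightarrow> x = y" by transfer simp
  show "x \<sqinter> y \<le> x" "x \<sqinter> y \<le> y" by (transfer, simp)+
  show "x \<le> y \<Longrightarrow> x \<le> z \<Longrightarrow> x \<le> y \<sqinter> z" by transfer simp
  show "x \<le> x \<squnion> y" by transfer (meson le_pcompl_pcompl order_trans sup_ge1)
  show "y \<le> x \<squnion> y" by transfer (meson le_pcompl_pcompl order_trans sup_ge2)
  show "y \<le> x \<Longrightarrow> z \<le> x \<Longrightarrow> y \<squnion> z \<le> x" by transfer (rule least, simp_all)
  show "x \<in> A \<Longrightarrow> \<Sqinter>A \<le> x" by transfer (simp add: Inf_lower)
  show "(\<And>x. x \<in> A \<Longrightarrow> z \<le> x) \<Longrightarrow> z \<le> \<Sqinter>A" by transfer (auto intro: Inf_greatest)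
  show "x \<in> A \<Longrightarrow> x \<le> \<Squnion>A" by transfer (meson Sup_upper le_pcompl_pcompl order_trans)
  show "(\<And>x. x \<in> A \<Longrightarrow> x \<le> z) \<Longrightarrow> \<Squnion>A \<le> z" by transfer (auto intro!: least Sup_least)
  show "\<Sqinter>{} = (\<top> :: 'a booleanization)" by transfer simp
  show "\<Squnion>{} = (\<bottom> :: 'a booleanization)" by transfer simp
  show "x \<sqinter> \<Squnion>A = (\<Squnion>b\<in>A. x \<sqinter> b)"
    by transfer (metis inf_Sup_frame pcompl_pcompl_inf)
qed

end

lemma frame_hom_booleanize: "frame_hom (booleanize :: 'a::frame \<Rightarrow> 'a booleanization)"
proof (rule frame_homI)
  fix A :: "'a set"
  show "booleanize (\<Squnion>A) = \<Squnion>(booleanize ` A)"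
  proof (transfer, rule antisym)
    fix A :: "'a set"
    show "pcompl (pcompl (\<Squnion>A)) \<le> pcompl (pcompl (\<Squnion>a\<in>A. pcompl (pcompl a)))"
      by (intro pcompl_antimono Sup_mono) (use le_pcompl_pcompl in blast)
    have "(\<Squnion>a\<in>A. pcompl (pcompl a)) \<le> pcompl (pcompl (\<Squnion>A))"
      by (intro SUP_least pcompl_antimono Sup_upper)
    then show "pcompl (pcompl (\<Squnion>a\<in>A. pcompl (pcompl a))) \<le> pcompl (pcompl (\<Squnion>A))"
      by (metis pcompl3 pcompl_antimono)
  qed
qed (transfer; simp add: pcompl_pcompl_inf)+

lemma booleanize_top_iff: "booleanize a = \<top> \<longleftrightarrow> pcompl (pcompl a) = \<top>"
  by (simp add: of_bool_frame_inject[symmetric] booleanize.rep_eq top_booleanization.rep_eq)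

section \<open>Frames presented by generators and relations\<close>

text \<open>A finite set of generators stands for its formal meet, so the free meet-semilattice on
  \<open>'g\<close> is \<open>'g fset\<close> under reverse inclusion, and the free frame consists of its down-sets.\<close>

typedef 'g free_frame = "{D :: 'g fset set. \<forall>S\<in>D. \<forall>T. S |\<subseteq>| T \<longrightarrow> T \<in> D}"
  by blast

setup_lifting type_definition_free_frame

instantiation free_frame :: (type) frame
begin

lift_definition less_eq_free_frame :: "'a free_frame \<Rightarrow> 'a free_frame \<Rightarrow> bool" is "(\<subseteq>)" .
lift_definition less_free_frame :: "'a free_frame \<Rightarrow> 'a free_frame \<Rightarrow> bool" is "(\<subset>)" .
lift_definition inf_free_frame :: "'a free_frame \<Rightarrow> 'a free_frame \<Rightarrow> 'a free_frame" is "(\<inter>)" by blast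
lift_definition sup_free_frame :: "'a free_frame \<Rightarrow> 'a free_frame \<Rightarrow> 'a free_frame" is "(\<union>)" by blast
lift_definition bot_free_frame :: "'a free_frame" is "{}" by blast
lift_definition top_free_frame :: "'a free_frame" is UNIV by blast
lift_definition Sup_free_frame :: "'a free_frame set \<Rightarrow> 'a free_frame" is Union by blast
lift_definition Inf_free_frame :: "'a free_frame set \<Rightarrow> 'a free_frame" is Inter by blast

instance
proof
  note defs = less_eq_free_frame.rep_eq less_free_frame.rep_eq inf_free_frame.rep_eq
    sup_free_frame.rep_eq bot_free_frame.rep_eq top_free_frame.rep_eq Sup_free_frame.rep_eq
    Inf_free_frame.rep_eq
  fix x y z :: "'a free_frame" and A :: "'a free_frame set"
  show "(x < y) = (x \<le> y \<and> \<not> y \<le> x)" unfolding defs by blast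
  show "x \<le> x" unfolding defs by blast
  show "x \<le> y \<Longrightarrow> y \<le> z \<Longrightarrow> x \<le> z" unfolding defs by blast
  show "x \<le> y \<Longrightarrow> y \<le> x \<Longrightarrow> x = y" unfolding defs Rep_free_frame_inject[symmetric] by blast
  show "x \<sqinter> y \<le> x" "x \<sqinter> y \<le> y" unfolding defs by blast+
  show "x \<le> y \<Longrightarrow> x \<le> z \<Longrightarrow> x \<le> y \<sqinter> z" unfolding defs by blast
  show "x \<le> x \<squnion> y" "y \<le> x \<squnion> y" unfolding defs by blast+
  show "y \<le> x \<Longrightarrow> z \<le> x \<Longrightarrow> y \<squnion> z \<le> x" unfolding defs by blast
  show "x \<in> A \<Longrightarrow> \<Sqinter>A \<le> x" unfolding defs by blast
  show "(\<And>x. x \<in> A \<Longrightarrow> z \<le> x) \<Longrightarrow> z \<le> \<Sqinter>A" unfolding defs by blast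
  show "x \<in> A \<Longrightarrow> x \<le> \<Squnion>A" unfolding defs by blast
  show "(\<And>x. x \<in> A \<Longrightarrow> x \<le> z) \<Longrightarrow> \<Squnion>A \<le> z" unfolding defs by blast
  show "\<Sqinter>{} = (\<top> :: 'a free_frame)" unfolding Rep_free_frame_inject[symmetric] defs by blast
  show "\<Squnion>{} = (\<bottom> :: 'a free_frame)" unfolding Rep_free_frame_inject[symmetric] defs by blast
  show "x \<sqinter> \<Squnion>A = (\<Squnion>b\<in>A. x \<sqinter> b)"
    unfolding Rep_free_frame_inject[symmetric] defs by (auto simp: defs)
qed

end

lift_definition free_gen :: "'g \<Rightarrow> 'g free_frame" is "\<lambda>g. {S. g |\<in>| S}"
  by blast

definition free_lift :: "('g \<Rightarrow> 'a::frame) \<Rightarrow> 'g free_frame \<Rightarrow> 'a" where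
  "free_lift \<phi> x = (\<Squnion>S\<in>Rep_free_frame x. \<Sqinter>(\<phi> ` fset S))"

lemma frame_hom_free_lift: "frame_hom (free_lift \<phi>)"
proof (rule frame_homI)
  show "free_lift \<phi> \<top> = \<top>"
    unfolding free_lift_def top_free_frame.rep_eq
    by (rule top_le, rule SUP_upper2[of "{||}"]) auto
next
  fix x y
  have up: "T \<in> Rep_free_frame z" if "S \<in> Rep_free_frame z" "S |\<subseteq>| T"
    for S T :: "'a fset" and z
    using Rep_free_frame[of z] that by blast
  show "free_lift \<phi> (x \<sqinter> y) = free_lift \<phi> x \<sqinter> free_lift \<phi> y"
  proof (rule antisym)
    show "free_lift \<phi> (x \<sqinter> y) \<le> free_lift \<phi> x \<sqinter> free_lift \<phi> y"
      unfolding free_lift_def inf_free_frame.rep_eq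
      by (intro le_infI SUP_subset_mono) auto
    have "\<Sqinter>(\<phi> ` fset S) \<sqinter> \<Sqinter>(\<phi> ` fset T) \<le> free_lift \<phi> (x \<sqinter> y)"
      if "S \<in> Rep_free_frame x" "T \<in> Rep_free_frame y" for S T
    proof -
      have "S |\<union>| T \<in> Rep_free_frame (x \<sqinter> y)"
        using that by (auto simp: inf_free_frame.rep_eq intro: up)
      moreover have "\<Sqinter>(\<phi> ` fset S) \<sqinter> \<Sqinter>(\<phi> ` fset T) = \<Sqinter>(\<phi> ` fset (S |\<union>| T))"
        by (simp add: image_Un Inf_union_distrib)
      ultimately show ?thesis
        unfolding free_lift_def by (metis (no_types, lifting) SUP_upper)
    qed
    then show "free_lift \<phi> x \<sqinter> free_lift \<phi> y \<le> free_lift \<phi> (x \<sqinter> y)"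
      unfolding free_lift_def[of \<phi> x] free_lift_def[of \<phi> y]
      by (auto simp: inf_Sup_frame Sup_inf_frame image_image intro!: SUP_least)
  qed
next
  fix A
  show "free_lift \<phi> (\<Squnion>A) = \<Squnion>(free_lift \<phi> ` A)"
    unfolding free_lift_def Sup_free_frame.rep_eq
    by (simp add: SUP_UNION image_image)
qed

lemma free_lift_gen: "free_lift \<phi> (free_gen g) = \<phi> g"
proof (rule antisym)
  show "free_lift \<phi> (free_gen g) \<le> \<phi> g"
    unfolding free_lift_def free_gen.rep_eq by (auto intro!: SUP_least Inf_lower)
  show "\<phi> g \<le> free_lift \<phi> (free_gen g)"
    unfolding free_lift_def free_gen.rep_eq by (rule SUP_upper2[of "{|g|}"]) auto
qed

lemma free_frame_hom_eq:
  fixes h :: "'g free_frame \<Rightarrow> 'a::frame"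
  assumes h: "frame_hom h" and g: "\<And>i. h (free_gen i) = \<phi> i"
  shows "h x = free_lift \<phi> x"
proof -
  let ?m = "\<lambda>S :: 'g fset. Abs_free_frame {T. S |\<subseteq>| T}"
  have rep: "Rep_free_frame (?m S) = {T. S |\<subseteq>| T}" for S :: "'g fset"
    by (rule Abs_free_frame_inverse) auto
  have x: "x = \<Squnion>(?m ` Rep_free_frame x)"
    unfolding Rep_free_frame_inject[symmetric] Sup_free_frame.rep_eq
    using Rep_free_frame[of x] by (auto simp: rep)
  have m: "h (?m S) = \<Sqinter>(\<phi> ` fset S)" for S
  proof (induction S)
    case empty
    have "?m {||} = \<top>"
      by (subst Rep_free_frame_inject[symmetric]) (simp only: rep top_free_frame.rep_eq, simp)
    then show ?case by (simp add: frame_hom_top[OF h])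
  next
    case (insert i S)
    have "?m (finsert i S) = free_gen i \<sqinter> ?m S"
      by (subst Rep_free_frame_inject[symmetric])
         (simp only: rep inf_free_frame.rep_eq free_gen.rep_eq, auto)
    then show ?case by (simp add: frame_hom_inf[OF h] g insert)
  qed
  show ?thesis
    by (subst x) (simp add: frame_hom_Sup[OF h] image_image m free_lift_def)
qed

text \<open>The generator type determines the relations, so that the presented frame is a type. A pair
  \<open>(u, v)\<close> in \<open>relations\<close> stands for \<open>u = v\<close>. The quotient is realised by its set of saturated
  elements, with \<open>saturate\<close> as the corresponding nucleus.\<close>

class frame_presentation =
  fixes relations :: "('a free_frame \<times> 'a free_frame) set"

definition saturated :: "'g::frame_presentation free_frame \<Rightarrow> bool" where
  "saturated x \<longleftrightarrow> (\<forall>(u, v)\<in>relations. \<forall>c. u \<sqinter> c \<le> x \<longleftrightarrow> v \<sqinter> c \<le> x)"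

definition saturate :: "'g::frame_presentation free_frame \<Rightarrow> 'g free_frame" where
  "saturate x = \<Sqinter>{y. saturated y \<and> x \<le> y}"

lemma saturated_Inf: "(\<And>x. x \<in> A \<Longrightarrow> saturated x) \<Longrightarrow> saturated (\<Sqinter>A)"
  unfolding saturated_def le_Inf_iff by fast

lemma saturated_inf: "saturated x \<Longrightarrow> saturated y \<Longrightarrow> saturated (x \<sqinter> y)"
  using saturated_Inf[of "{x, y}"] by auto

lemma saturated_top: "saturated \<top>"
  by (simp add: saturated_def split_beta)

lemma saturated_saturate [simp]: "saturated (saturate x)"
  by (auto simp: saturate_def intro: saturated_Inf)

lemma le_saturate: "x \<le> saturate x"
  by (auto simp: saturate_def intro: Inf_greatest)

lemma saturate_least: "x \<le> y \<Longrightarrow> saturated y \<Longrightarrow> saturate x \<le> y"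
  by (auto simp: saturate_def intro: Inf_lower)

lemma saturate_eq: "saturated x \<Longrightarrow> saturate x = x"
  by (simp add: antisym le_saturate saturate_least)

lemma saturate_mono: "x \<le> y \<Longrightarrow> saturate x \<le> saturate y"
  by (meson le_saturate order_trans saturate_least saturated_saturate)

lemma saturate_inf_le:
  assumes x: "saturated x" and le: "a \<sqinter> b \<le> x" shows "a \<sqinter> saturate b \<le> x"
proof -
  define i where "i = \<Squnion>{c. a \<sqinter> c \<le> x}"
  have i: "c \<le> i \<longleftrightarrow> a \<sqinter> c \<le> x" for c
  proof
    have "a \<sqinter> i \<le> x" unfolding i_def inf_Sup_frame by (auto intro: SUP_least)
    then show "a \<sqinter> c \<le> x" if "c \<le> i" using that by (meson inf_mono order_refl order_trans)
  qed (auto simp: i_def intro: Sup_upper)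
  have "saturated i"
    using x unfolding saturated_def i inf_left_commute[of a] by fast
  then have "saturate b \<le> i" using le by (intro saturate_least) (simp_all add: i)
  then show ?thesis by (simp add: i)
qed

lemma saturate_inf: "saturate (a \<sqinter> b) = saturate a \<sqinter> saturate b"
proof (rule antisym)
  show "saturate (a \<sqinter> b) \<le> saturate a \<sqinter> saturate b"
    by (simp add: saturate_mono)
  have "a \<sqinter> saturate b \<le> saturate (a \<sqinter> b)"
    by (simp add: saturate_inf_le le_saturate)
  then have "saturate b \<sqinter> saturate a \<le> saturate (a \<sqinter> b)"
    by (intro saturate_inf_le) (simp_all add: inf.commute)
  then show "saturate a \<sqinter> saturate b \<le> saturate (a \<sqinter> b)"
    by (simp add: inf.commute)
qed

typedef (overloaded) 'g presented = "{x :: 'g::frame_presentation free_frame. saturated x}"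
  using saturated_top by blast

setup_lifting type_definition_presented

lift_definition present :: "'g::frame_presentation free_frame \<Rightarrow> 'g presented" is saturate
  by simp

instantiation presented :: (frame_presentation) frame
begin

lift_definition less_eq_presented :: "'a presented \<Rightarrow> 'a presented \<Rightarrow> bool" is "(\<le>)" .
lift_definition less_presented :: "'a presented \<Rightarrow> 'a presented \<Rightarrow> bool" is "(<)" .
lift_definition inf_presented :: "'a presented \<Rightarrow> 'a presented \<Rightarrow> 'a presented" is "(\<sqinter>)"
  by (rule saturated_inf)
lift_definition sup_presented :: "'a presented \<Rightarrow> 'a presented \<Rightarrow> 'a presented"
  is "\<lambda>x y. saturate (x \<squnion> y)" by simp
lift_definition bot_presented :: "'a presented" is "saturate \<bottom>" by simp
lift_definition top_presented :: "'a presented" is \<top> by (rule saturated_top)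
lift_definition Sup_presented :: "'a presented set \<Rightarrow> 'a presented"
  is "\<lambda>A. saturate (\<Squnion>A)" by simp
lift_definition Inf_presented :: "'a presented set \<Rightarrow> 'a presented" is Inf
  by (rule saturated_Inf)

instance
proof
  fix x y z :: "'a presented" and A :: "'a presented set"
  show "(x < y) = (x \<le> y \<and> \<not> y \<le> x)" by transfer auto
  show "x \<le> x" by transfer simp
  show "x \<le> y \<Longrightarrow> y \<le> z \<Longrightarrow> x \<le> z" by transfer simp
  show "x \<le> y \<Longrightarrow> y \<le> x \<Longrightarrow> x = y" by transfer simp
  show "x \<sqinter> y \<le> x" "x \<sqinter> y \<le> y" by (transfer, simp)+
  show "x \<le> y \<Longrightarrow> x \<le> z \<Longrightarrow> x \<le> y \<sqinter> z" by transfer simp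
  show "x \<le> x \<squnion> y" by transfer (meson le_saturate order_trans sup_ge1)
  show "y \<le> x \<squnion> y" by transfer (meson le_saturate order_trans sup_ge2)
  show "y \<le> x \<Longrightarrow> z \<le> x \<Longrightarrow> y \<squnion> z \<le> x" by transfer (rule saturate_least, simp_all)
  show "x \<in> A \<Longrightarrow> \<Sqinter>A \<le> x" by transfer (simp add: Inf_lower)
  show "(\<And>x. x \<in> A \<Longrightarrow> z \<le> x) \<Longrightarrow> z \<le> \<Sqinter>A" by transfer (auto intro: Inf_greatest)
  show "x \<in> A \<Longrightarrow> x \<le> \<Squnion>A" by transfer (meson Sup_upper le_saturate order_trans)
  show "(\<And>x. x \<in> A \<Longrightarrow> x \<le> z) \<Longrightarrow> \<Squnion>A \<le> z"
    by transfer (auto intro!: saturate_least Sup_least)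
  show "\<Sqinter>{} = (\<top> :: 'a presented)" by transfer simp
  show "\<Squnion>{} = (\<bottom> :: 'a presented)" by transfer simp
  show "x \<sqinter> \<Squnion>A = (\<Squnion>b\<in>A. x \<sqinter> b)"
    by transfer (metis inf_Sup_frame saturate_eq saturate_inf)
qed

end

definition gen :: "'g::frame_presentation \<Rightarrow> 'g presented" where
  "gen g = present (free_gen g)"

text \<open>The frame homomorphism induced by an assignment \<open>\<phi>\<close> of the generators; meaningful
  when \<open>\<phi>\<close> respects the relations.\<close>

definition presented_lift :: "('g::frame_presentation \<Rightarrow> 'a::frame) \<Rightarrow> 'g presented \<Rightarrow> 'a" where
  "presented_lift \<phi> x = free_lift \<phi> (Rep_presented x)"

lemma frame_hom_present: "frame_hom present"
proof (rule frame_homI)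
  show "present \<top> = (\<top>::'a presented)" by transfer (simp add: saturate_eq saturated_top)
  show "present (a \<sqinter> b) = present a \<sqinter> present b" for a b :: "'a free_frame"
    by transfer (rule saturate_inf)
  show "present (\<Squnion>A) = \<Squnion>(present ` A)" for A :: "'a free_frame set"
  proof (transfer, rule antisym)
    fix A :: "'a free_frame set"
    show "saturate (\<Squnion>A) \<le> saturate (\<Squnion>(saturate ` A))"
      by (intro saturate_mono Sup_mono) (use le_saturate in blast)
    show "saturate (\<Squnion>(saturate ` A)) \<le> saturate (\<Squnion>A)"
      by (intro saturate_least SUP_least saturate_mono Sup_upper) auto
  qed
qed

lemma present_relation: "(u, v) \<in> relations \<Longrightarrow> present u = present v"
proof transfer
  fix u v :: "'a free_frame" assume uv: "(u, v) \<in> relations"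
  then have "u \<le> x \<longleftrightarrow> v \<le> x" if "saturated x" for x
    using that unfolding saturated_def by (auto dest!: bspec[OF _ uv] spec[of _ \<top>])
  then have "{y. saturated y \<and> u \<le> y} = {y. saturated y \<and> v \<le> y}" by auto
  then show "saturate u = saturate v" by (simp add: saturate_def)
qed

lemma present_Rep: "present (Rep_presented x) = x"
  by transfer (rule saturate_eq)

context
  fixes \<phi> :: "'g::frame_presentation \<Rightarrow> 'a::frame"
  assumes resp: "\<And>u v. (u, v) \<in> relations \<Longrightarrow> free_lift \<phi> u = free_lift \<phi> v"
begin

lemma free_lift_saturate: "free_lift \<phi> (saturate x) = free_lift \<phi> x"
proof (rule antisym)
  note hom = frame_hom_free_lift[of \<phi>]
  define y where "y = \<Squnion>{c. free_lift \<phi> c \<le> free_lift \<phi> x}"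
  have y_le: "free_lift \<phi> y \<le> free_lift \<phi> x"
    unfolding y_def frame_hom_Sup[OF hom] by (auto intro: SUP_least)
  have y: "c \<le> y \<longleftrightarrow> free_lift \<phi> c \<le> free_lift \<phi> x" for c
    using y_le by (auto simp: y_def intro: Sup_upper dest: frame_hom_mono[OF hom])
  have "saturated y"
    unfolding saturated_def y frame_hom_inf[OF hom] using resp by fastforce
  then have "saturate x \<le> y" by (intro saturate_least) (simp_all add: y)
  then show "free_lift \<phi> (saturate x) \<le> free_lift \<phi> x" by (simp add: y)
  show "free_lift \<phi> x \<le> free_lift \<phi> (saturate x)"
    by (rule frame_hom_mono[OF hom le_saturate])
qed

lemma frame_hom_presented_lift: "frame_hom (presented_lift \<phi>)"
proof (rule frame_homI)
  note hom = frame_hom_free_lift[of \<phi>]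
  show "presented_lift \<phi> \<top> = \<top>"
    by (simp add: presented_lift_def top_presented.rep_eq frame_hom_top[OF hom])
  show "presented_lift \<phi> (a \<sqinter> b) = presented_lift \<phi> a \<sqinter> presented_lift \<phi> b" for a b
    by (simp add: presented_lift_def inf_presented.rep_eq frame_hom_inf[OF hom])
  show "presented_lift \<phi> (\<Squnion>A) = \<Squnion>(presented_lift \<phi> ` A)" for A
    by (simp add: presented_lift_def Sup_presented.rep_eq free_lift_saturate
        frame_hom_Sup[OF hom] image_image)
qed

lemma presented_lift_gen: "presented_lift \<phi> (gen g) = \<phi> g"
  by (simp add: presented_lift_def gen_def present.rep_eq free_lift_saturate free_lift_gen)

end

lemma frame_hom_comp: "frame_hom h \<Longrightarrow> frame_hom k \<Longrightarrow> frame_hom (\<lambda>x. h (k x))"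
  by (simp add: frame_hom_def image_image)

lemma presented_hom_eq:
  assumes h: "frame_hom h"
  shows "h = presented_lift (\<lambda>g. h (gen g))"
proof
  fix x
  have "h (present y) = free_lift (\<lambda>g. h (gen g)) y" for y
    by (rule free_frame_hom_eq[OF frame_hom_comp[OF h frame_hom_present]]) (simp add: gen_def)
  then show "h x = presented_lift (\<lambda>g. h (gen g)) x"
    by (metis present_Rep presented_lift_def)
qed

lemma presented_hom_eqI:
  assumes "frame_hom h" "frame_hom k" "\<And>g. h (gen g) = k (gen g)"
  shows "h = k"
  using assms by (metis (no_types, lifting) ext presented_hom_eq)

lemma presented_hom_resp:
  assumes h: "frame_hom h" and uv: "(u, v) \<in> relations"
  shows "free_lift (\<lambda>g. h (gen g)) u = free_lift (\<lambda>g. h (gen g)) v"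
proof -
  have "free_lift (\<lambda>g. h (gen g)) y = h (present y)" for y
    by (rule free_frame_hom_eq[OF frame_hom_comp[OF h frame_hom_present], symmetric])
       (simp add: gen_def)
  then show ?thesis by (simp add: present_relation[OF uv])
qed

section \<open>The frames of reals and of extended partial reals\<close>

text \<open>\<open>RGt p\<close> and \<open>RLt q\<close> are the formal symbols \<open>(p,-)\<close> and \<open>(-,q)\<close>; the two generator types
  differ only in the relations attached to them.\<close>

datatype real_gen = RGt rat | RLt rat
datatype ireal_gen = IGt rat | ILt rat

instantiation real_gen :: frame_presentation
begin

definition relations_real_gen :: "(real_gen free_frame \<times> real_gen free_frame) set" where
  "relations_real_gen =
     {(free_gen (RGt p) \<sqinter> free_gen (RLt q), \<bottom>) |p q. p \<ge> q} \<union>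
     {(free_gen (RGt p) \<squnion> free_gen (RLt q), \<top>) |p q. p < q} \<union>
     {(free_gen (RGt p), \<Squnion>q\<in>{q. q > p}. free_gen (RGt q)) |p. True} \<union>
     {(free_gen (RLt p), \<Squnion>q\<in>{q. q < p}. free_gen (RLt q)) |p. True} \<union>
     {(\<Squnion>p. free_gen (RGt p), \<top>)} \<union>
     {(\<Squnion>p. free_gen (RLt p), \<top>)}"

instance ..

end

instantiation ireal_gen :: frame_presentation
begin

definition relations_ireal_gen :: "(ireal_gen free_frame \<times> ireal_gen free_frame) set" where
  "relations_ireal_gen =
     {(free_gen (IGt p) \<sqinter> free_gen (ILt q), \<bottom>) |p q. p \<ge> q} \<union>
     {(free_gen (IGt p), \<Squnion>q\<in>{q. q > p}. free_gen (IGt q)) |p. True} \<union>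
     {(free_gen (ILt p), \<Squnion>q\<in>{q. q < p}. free_gen (ILt q)) |p. True}"

instance ..

end

type_synonym frame_of_reals = "real_gen presented"
type_synonym frame_of_ereals = "ireal_gen presented"

abbreviation rgt :: "rat \<Rightarrow> frame_of_reals" where "rgt p \<equiv> gen (RGt p)"
abbreviation rlt :: "rat \<Rightarrow> frame_of_reals" where "rlt q \<equiv> gen (RLt q)"
abbreviation igt :: "rat \<Rightarrow> frame_of_ereals" where "igt p \<equiv> gen (IGt p)"
abbreviation ilt :: "rat \<Rightarrow> frame_of_ereals" where "ilt q \<equiv> gen (ILt q)"

text \<open>The homomorphism with \<open>(p,-) \<mapsto> u p\<close> and \<open>(-,q) \<mapsto> v q\<close>.\<close>

definition real_hom :: "(rat \<Rightarrow> 'a::frame) \<Rightarrow> (rat \<Rightarrow> 'a) \<Rightarrow> frame_of_reals \<Rightarrow> 'a" where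
  "real_hom u v = presented_lift (case_real_gen u v)"

definition ireal_hom :: "(rat \<Rightarrow> 'a::frame) \<Rightarrow> (rat \<Rightarrow> 'a) \<Rightarrow> frame_of_ereals \<Rightarrow> 'a" where
  "ireal_hom u v = presented_lift (case_ireal_gen u v)"

definition real_relations :: "(rat \<Rightarrow> 'a::frame) \<Rightarrow> (rat \<Rightarrow> 'a) \<Rightarrow> bool" where
  "real_relations u v \<longleftrightarrow>
     (\<forall>p q. p \<ge> q \<longrightarrow> u p \<sqinter> v q = \<bottom>) \<and> (\<forall>p q. p < q \<longrightarrow> u p \<squnion> v q = \<top>) \<and>
     (\<forall>p. u p = (\<Squnion>q\<in>{q. q > p}. u q)) \<and> (\<forall>p. v p = (\<Squnion>q\<in>{q. q < p}. v q)) \<and>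
     (\<Squnion>p. u p) = \<top> \<and> (\<Squnion>p. v p) = \<top>"

definition ireal_relations :: "(rat \<Rightarrow> 'a::frame) \<Rightarrow> (rat \<Rightarrow> 'a) \<Rightarrow> bool" where
  "ireal_relations u v \<longleftrightarrow>
     (\<forall>p q. p \<ge> q \<longrightarrow> u p \<sqinter> v q = \<bottom>) \<and>
     (\<forall>p. u p = (\<Squnion>q\<in>{q. q > p}. u q)) \<and> (\<forall>p. v p = (\<Squnion>q\<in>{q. q < p}. v q))"

lemma ball_pairs_simps:
  "(\<forall>(a, b)\<in>A \<union> B. P a b) \<longleftrightarrow> (\<forall>(a, b)\<in>A. P a b) \<and> (\<forall>(a, b)\<in>B. P a b)"
  "(\<forall>(a, b)\<in>{(f p q, g p q) |p q. R p q}. P a b) \<longleftrightarrow> (\<forall>p q. R p q \<longrightarrow> P (f p q) (g p q))"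
  "(\<forall>(a, b)\<in>{(k p, l p) |p. True}. P a b) \<longleftrightarrow> (\<forall>p. P (k p) (l p))"
  "(\<forall>(a, b)\<in>{(c, d)}. P a b) \<longleftrightarrow> P c d"
  by blast+

lemma free_lift_simps:
  "free_lift \<phi> \<top> = \<top>" "free_lift \<phi> \<bottom> = \<bottom>"
  "free_lift \<phi> (a \<sqinter> b) = free_lift \<phi> a \<sqinter> free_lift \<phi> b"
  "free_lift \<phi> (a \<squnion> b) = free_lift \<phi> a \<squnion> free_lift \<phi> b"
  "free_lift \<phi> (\<Squnion>i\<in>I. F i) = (\<Squnion>i\<in>I. free_lift \<phi> (F i))"
  using frame_hom_free_lift[of \<phi>]
  by (simp_all add: frame_hom_top frame_hom_bot frame_hom_inf frame_hom_sup frame_hom_Sup image_image)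

lemma free_lift_real_gen_resp:
  "(\<forall>(a, b)\<in>relations. free_lift \<phi> a = free_lift \<phi> b) \<longleftrightarrow>
     real_relations (\<lambda>p. \<phi> (RGt p)) (\<lambda>q. \<phi> (RLt q))"
  unfolding relations_real_gen_def real_relations_def
  by (simp only: ball_pairs_simps free_lift_simps free_lift_gen conj_assoc)

lemma free_lift_ireal_gen_resp:
  "(\<forall>(a, b)\<in>relations. free_lift \<phi> a = free_lift \<phi> b) \<longleftrightarrow>
     ireal_relations (\<lambda>p. \<phi> (IGt p)) (\<lambda>q. \<phi> (ILt q))"
  unfolding relations_ireal_gen_def ireal_relations_def
  by (simp only: ball_pairs_simps free_lift_simps free_lift_gen conj_assoc)

lemma real_hom:
  assumes "real_relations u v"
  shows "frame_hom (real_hom u v)" "real_hom u v (rgt p) = u p" "real_hom u v (rlt q) = v q"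
proof -
  have r: "free_lift (case_real_gen u v) a = free_lift (case_real_gen u v) b"
    if "(a, b) \<in> relations" for a b
    using that assms free_lift_real_gen_resp[of "case_real_gen u v"] by auto
  show "frame_hom (real_hom u v)" "real_hom u v (rgt p) = u p" "real_hom u v (rlt q) = v q"
    unfolding real_hom_def
    by (simp_all add: frame_hom_presented_lift[OF r] presented_lift_gen[OF r])
qed

lemma ireal_hom:
  assumes "ireal_relations u v"
  shows "frame_hom (ireal_hom u v)" "ireal_hom u v (igt p) = u p" "ireal_hom u v (ilt q) = v q"
proof -
  have r: "free_lift (case_ireal_gen u v) a = free_lift (case_ireal_gen u v) b"
    if "(a, b) \<in> relations" for a b
    using that assms free_lift_ireal_gen_resp[of "case_ireal_gen u v"] by auto
  show "frame_hom (ireal_hom u v)" "ireal_hom u v (igt p) = u p" "ireal_hom u v (ilt q) = v q"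
    unfolding ireal_hom_def
    by (simp_all add: frame_hom_presented_lift[OF r] presented_lift_gen[OF r])
qed

lemma frame_hom_real_relations:
  assumes "frame_hom f"
  shows "real_relations (\<lambda>p. f (rgt p)) (\<lambda>q. f (rlt q))"
  using presented_hom_resp[OF assms] by (subst free_lift_real_gen_resp[symmetric]) auto

lemma frame_hom_ireal_relations:
  assumes "frame_hom f"
  shows "ireal_relations (\<lambda>p. f (igt p)) (\<lambda>q. f (ilt q))"
  using presented_hom_resp[OF assms] by (subst free_lift_ireal_gen_resp[symmetric]) auto

lemma frame_hom_real_eqI:
  assumes "frame_hom f" "frame_hom g" "\<And>p. f (rgt p) = g (rgt p)" "\<And>q. f (rlt q) = g (rlt q)"
  shows "f = g"
proof (rule presented_hom_eqI[OF assms(1,2)])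
  show "f (gen x) = g (gen x)" for x using assms(3,4) by (cases x) auto
qed

lemma frame_hom_ireal_eqI:
  assumes "frame_hom f" "frame_hom g" "\<And>p. f (igt p) = g (igt p)" "\<And>q. f (ilt q) = g (ilt q)"
  shows "f = g"
proof (rule presented_hom_eqI[OF assms(1,2)])
  show "f (gen x) = g (gen x)" for x using assms(3,4) by (cases x) auto
qed

section \<open>Riesz spaces\<close>

text \<open>Lattice operations are those determined by the order, so suprema and infima are relations
  (relative to the carrier).\<close>

record 'v riesz =
  carrier :: "'v set"
  rzero :: 'v
  radd :: "'v \<Rightarrow> 'v \<Rightarrow> 'v"
  rscale :: "real \<Rightarrow> 'v \<Rightarrow> 'v"
  rle :: "'v \<Rightarrow> 'v \<Rightarrow> bool"

definition riesz_lub :: "'v riesz \<Rightarrow> 'v set \<Rightarrow> 'v \<Rightarrow> bool" where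
  "riesz_lub V A s \<longleftrightarrow> s \<in> carrier V \<and> (\<forall>a\<in>A. rle V a s) \<and>
     (\<forall>u\<in>carrier V. (\<forall>a\<in>A. rle V a u) \<longrightarrow> rle V s u)"

definition riesz_glb :: "'v riesz \<Rightarrow> 'v set \<Rightarrow> 'v \<Rightarrow> bool" where
  "riesz_glb V A s \<longleftrightarrow> s \<in> carrier V \<and> (\<forall>a\<in>A. rle V s a) \<and>
     (\<forall>u\<in>carrier V. (\<forall>a\<in>A. rle V u a) \<longrightarrow> rle V u s)"

locale riesz_space =
  fixes V :: "'v riesz"
  assumes zero_closed: "rzero V \<in> carrier V"
    and add_closed: "x \<in> carrier V \<Longrightarrow> y \<in> carrier V \<Longrightarrow> radd V x y \<in> carrier V"
    and scale_closed: "x \<in> carrier V \<Longrightarrow> rscale V r x \<in> carrier V"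
    and add_assoc: "x \<in> carrier V \<Longrightarrow> y \<in> carrier V \<Longrightarrow> z \<in> carrier V \<Longrightarrow>
      radd V (radd V x y) z = radd V x (radd V y z)"
    and add_commute: "x \<in> carrier V \<Longrightarrow> y \<in> carrier V \<Longrightarrow> radd V x y = radd V y x"
    and add_zero: "x \<in> carrier V \<Longrightarrow> radd V x (rzero V) = x"
    and add_inverse: "x \<in> carrier V \<Longrightarrow> \<exists>y\<in>carrier V. radd V x y = rzero V"
    and scale_add: "x \<in> carrier V \<Longrightarrow> y \<in> carrier V \<Longrightarrow>
      rscale V r (radd V x y) = radd V (rscale V r x) (rscale V r y)"
    and add_scale: "x \<in> carrier V \<Longrightarrow> rscale V (r + s) x = radd V (rscale V r x) (rscale V s x)"
    and scale_scale: "x \<in> carrier V \<Longrightarrow> rscale V r (rscale V s x) = rscale V (r * s) x"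
    and scale_one: "x \<in> carrier V \<Longrightarrow> rscale V 1 x = x"
    and le_refl: "x \<in> carrier V \<Longrightarrow> rle V x x"
    and le_trans: "x \<in> carrier V \<Longrightarrow> y \<in> carrier V \<Longrightarrow> z \<in> carrier V \<Longrightarrow>
      rle V x y \<Longrightarrow> rle V y z \<Longrightarrow> rle V x z"
    and le_antisym: "x \<in> carrier V \<Longrightarrow> y \<in> carrier V \<Longrightarrow> rle V x y \<Longrightarrow> rle V y x \<Longrightarrow> x = y"
    and add_mono: "x \<in> carrier V \<Longrightarrow> y \<in> carrier V \<Longrightarrow> z \<in> carrier V \<Longrightarrow>
      rle V x y \<Longrightarrow> rle V (radd V x z) (radd V y z)"
    and scale_nonneg: "x \<in> carrier V \<Longrightarrow> 0 \<le> r \<Longrightarrow> rle V (rzero V) x \<Longrightarrow>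
      rle V (rzero V) (rscale V r x)"
    and ex_lub: "x \<in> carrier V \<Longrightarrow> y \<in> carrier V \<Longrightarrow> \<exists>s. riesz_lub V {x, y} s"
    and ex_glb: "x \<in> carrier V \<Longrightarrow> y \<in> carrier V \<Longrightarrow> \<exists>s. riesz_glb V {x, y} s"

definition riesz_hom :: "'v riesz \<Rightarrow> 'w riesz \<Rightarrow> ('v \<Rightarrow> 'w) \<Rightarrow> bool" where
  "riesz_hom V W f \<longleftrightarrow>
     (\<forall>x\<in>carrier V. f x \<in> carrier W) \<and>
     (\<forall>x\<in>carrier V. \<forall>y\<in>carrier V. f (radd V x y) = radd W (f x) (f y)) \<and>
     (\<forall>r. \<forall>x\<in>carrier V. f (rscale V r x) = rscale W r (f x)) \<and>
     (\<forall>x\<in>carrier V. \<forall>y\<in>carrier V. \<forall>s. riesz_lub V {x, y} s \<longrightarrow> riesz_lub W {f x, f y} (f s)) \<and>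
     (\<forall>x\<in>carrier V. \<forall>y\<in>carrier V. \<forall>s. riesz_glb V {x, y} s \<longrightarrow> riesz_glb W {f x, f y} (f s))"

definition riesz_embedding :: "'v riesz \<Rightarrow> 'w riesz \<Rightarrow> ('v \<Rightarrow> 'w) \<Rightarrow> bool" where
  "riesz_embedding V W f \<longleftrightarrow> riesz_hom V W f \<and> inj_on f (carrier V)"

definition riesz_isomorphic :: "'v riesz \<Rightarrow> 'w riesz \<Rightarrow> bool" where
  "riesz_isomorphic V W \<longleftrightarrow> (\<exists>f. riesz_hom V W f \<and> bij_betw f (carrier V) (carrier W))"

definition dedekind_complete :: "'v riesz \<Rightarrow> bool" where
  "dedekind_complete V \<longleftrightarrow>
     (\<forall>A\<subseteq>carrier V. A \<noteq> {} \<and> (\<exists>b\<in>carrier V. \<forall>a\<in>A. rle V a b) \<longrightarrow> (\<exists>s. riesz_lub V A s))"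

definition laterally_complete :: "'v riesz \<Rightarrow> bool" where
  "laterally_complete V \<longleftrightarrow>
     (\<forall>A\<subseteq>carrier V. A \<noteq> {} \<and> (\<forall>a\<in>A. rle V (rzero V) a) \<and>
        (\<forall>a\<in>A. \<forall>b\<in>A. a \<noteq> b \<longrightarrow> riesz_glb V {a, b} (rzero V)) \<longrightarrow> (\<exists>s. riesz_lub V A s))"

definition universally_complete :: "'v riesz \<Rightarrow> bool" where
  "universally_complete V \<longleftrightarrow> riesz_space V \<and> dedekind_complete V \<and> laterally_complete V"

definition universal_completion :: "'r riesz \<Rightarrow> 'u riesz \<Rightarrow> ('r \<Rightarrow> 'u) \<Rightarrow> bool" where
  "universal_completion R U \<mu> \<longleftrightarrow>
     universally_complete U \<and> riesz_embedding R U \<mu> \<and>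
     (\<forall>f\<in>carrier U. rle U (rzero U) f \<longrightarrow>
        riesz_lub U {\<mu> g |g. g \<in> carrier R \<and> rle U (rzero U) (\<mu> g) \<and> rle U (\<mu> g) f} f)"

text \<open>HOL cannot quantify over the types carrying the completions. The type
  \<open>'r set \<times> 'r set\<close> is large enough for any universal completion of a Riesz space on \<open>'r\<close>:
  every element is a difference of two positive ones, and a positive \<open>f\<close> is determined by
  \<open>{g. 0 \<le> \<mu> g \<le> f}\<close>. Hence nothing is lost below; see \<open>isomorphic_universal_completionsI\<close>.\<close>

definition isomorphic_universal_completions :: "'r riesz \<Rightarrow> 's riesz \<Rightarrow> bool" where
  "isomorphic_universal_completions R S \<longleftrightarrow>
     (\<exists>(U :: ('r set \<times> 'r set) riesz) \<mu> (V :: ('s set \<times> 's set) riesz) \<nu>.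
        universal_completion R U \<mu> \<and> universal_completion S V \<nu> \<and> riesz_isomorphic U V)"

lemma (in riesz_space) lub_unique: "riesz_lub V A s \<Longrightarrow> riesz_lub V A t \<Longrightarrow> s = t"
  unfolding riesz_lub_def by (meson le_antisym)

lemma (in riesz_space) glb_unique: "riesz_glb V A s \<Longrightarrow> riesz_glb V A t \<Longrightarrow> s = t"
  unfolding riesz_glb_def by (meson le_antisym)

lemma (in riesz_space) add_right_cancel:
  assumes "x \<in> carrier V" "y \<in> carrier V" "z \<in> carrier V" "radd V x z = radd V y z"
  shows "x = y"
proof -
  obtain w where "w \<in> carrier V" "radd V z w = rzero V" using add_inverse assms(3) by blast
  then show ?thesis using assms by (metis add_assoc add_zero)
qed

lemma (in riesz_space) ex_positive_difference:
  assumes x: "x \<in> carrier V"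
  shows "\<exists>y\<in>carrier V. \<exists>z\<in>carrier V. rle V (rzero V) y \<and> rle V (rzero V) z \<and> radd V x z = y"
proof -
  obtain y where y: "riesz_lub V {x, rzero V} y" using ex_lub x zero_closed by blast
  then have yc: "y \<in> carrier V" "rle V x y" "rle V (rzero V) y" by (auto simp: riesz_lub_def)
  obtain w where w: "w \<in> carrier V" "radd V x w = rzero V" using add_inverse x by blast
  have "rle V (rzero V) (radd V y w)" using add_mono[OF x yc(1) w(1) yc(2)] w by simp
  moreover have "radd V x (radd V y w) = y"
    by (metis add_assoc add_commute add_zero w x yc(1))
  ultimately show ?thesis using yc w add_closed by blast
qed

lemma riesz_hom_comp:
  "riesz_hom U V f \<Longrightarrow> riesz_hom V W g \<Longrightarrow> riesz_hom U W (\<lambda>x. g (f x))"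
  unfolding riesz_hom_def by simp

text \<open>Transport of structure along an injection of the carrier.\<close>

definition riesz_transport :: "('u \<Rightarrow> 'w) \<Rightarrow> 'u riesz \<Rightarrow> 'w riesz" where
  "riesz_transport e U = (let d = inv_into (carrier U) e in
     \<lparr>carrier = e ` carrier U, rzero = e (rzero U), radd = \<lambda>a b. e (radd U (d a) (d b)),
      rscale = \<lambda>r a. e (rscale U r (d a)), rle = \<lambda>a b. rle U (d a) (d b)\<rparr>)"

context
  fixes U :: "'u riesz" and e :: "'u \<Rightarrow> 'w"
  assumes inj: "inj_on e (carrier U)"
begin

lemma transport_simps:
  "carrier (riesz_transport e U) = e ` carrier U"
  "rzero (riesz_transport e U) = e (rzero U)"
  "x \<in> carrier U \<Longrightarrow> y \<in> carrier U \<Longrightarrow> radd (riesz_transport e U) (e x) (e y) = e (radd U x y)"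
  "x \<in> carrier U \<Longrightarrow> rscale (riesz_transport e U) r (e x) = e (rscale U r x)"
  "x \<in> carrier U \<Longrightarrow> y \<in> carrier U \<Longrightarrow> rle (riesz_transport e U) (e x) (e y) \<longleftrightarrow> rle U x y"
  by (simp_all add: riesz_transport_def Let_def inv_into_f_f[OF inj])

lemma transport_lub:
  "A \<subseteq> carrier U \<Longrightarrow> s \<in> carrier U \<Longrightarrow> riesz_lub (riesz_transport e U) (e ` A) (e s) \<longleftrightarrow> riesz_lub U A s"
  unfolding riesz_lub_def transport_simps(1) ball_simps
  by (simp add: transport_simps(5) subset_eq imageI cong: ball_cong)

lemma transport_glb:
  "A \<subseteq> carrier U \<Longrightarrow> s \<in> carrier U \<Longrightarrow> riesz_glb (riesz_transport e U) (e ` A) (e s) \<longleftrightarrow> riesz_glb U A s"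
  unfolding riesz_glb_def transport_simps(1) ball_simps
  by (simp add: transport_simps(5) subset_eq imageI cong: ball_cong)

lemma transport_lub2:
  "x \<in> carrier U \<Longrightarrow> y \<in> carrier U \<Longrightarrow> s \<in> carrier U \<Longrightarrow>
     riesz_lub (riesz_transport e U) {e x, e y} (e s) \<longleftrightarrow> riesz_lub U {x, y} s"
  using transport_lub[of "{x, y}" s] by simp

lemma transport_glb2:
  "x \<in> carrier U \<Longrightarrow> y \<in> carrier U \<Longrightarrow> s \<in> carrier U \<Longrightarrow>
     riesz_glb (riesz_transport e U) {e x, e y} (e s) \<longleftrightarrow> riesz_glb U {x, y} s"
  using transport_glb[of "{x, y}" s] by simp

lemma riesz_hom_transport: "riesz_hom U (riesz_transport e U) e"
  unfolding riesz_hom_def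
  by (auto simp: transport_simps transport_lub2 transport_glb2 riesz_lub_def[of U] riesz_glb_def[of U])

lemma riesz_space_transport:
  assumes "riesz_space U" shows "riesz_space (riesz_transport e U)"
proof -
  interpret riesz_space U by fact
  show ?thesis
  proof (unfold_locales, goal_cases)
    case (7 x)
    then obtain x' where x': "x' \<in> carrier U" "x = e x'" by (auto simp: transport_simps)
    then obtain y' where "y' \<in> carrier U" "radd U x' y' = rzero U" using add_inverse by blast
    then show ?case using x' by (auto simp: transport_simps intro!: bexI[of _ y'])
  next
    case (17 x y)
    then obtain x' y' where xy: "x' \<in> carrier U" "x = e x'" "y' \<in> carrier U" "y = e y'"
      by (auto simp: transport_simps)
    then obtain s where s: "riesz_lub U {x', y'} s" using ex_lub by blast
    then have "s \<in> carrier U" by (simp add: riesz_lub_def)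
    then show ?case using s xy transport_lub2 by blast
  next
    case (18 x y)
    then obtain x' y' where xy: "x' \<in> carrier U" "x = e x'" "y' \<in> carrier U" "y = e y'"
      by (auto simp: transport_simps)
    then obtain s where s: "riesz_glb U {x', y'} s" using ex_glb by blast
    then have "s \<in> carrier U" by (simp add: riesz_glb_def)
    then show ?case using s xy transport_glb2 by blast
  next
    case (13 x y z)
    then show ?case by (auto simp: transport_simps) (metis le_trans)
  next
    case (14 x y)
    then show ?case by (auto simp: transport_simps) (metis le_antisym)
  next
    case (5 x y)
    then show ?case by (auto simp: transport_simps) (metis add_commute)
  qed (auto simp: transport_simps zero_closed add_closed scale_closed add_assoc add_zero
      scale_add add_scale scale_scale scale_one le_refl add_mono scale_nonneg)
qed

lemma universally_complete_transport:
  assumes "universally_complete U" shows "universally_complete (riesz_transport e U)"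
  unfolding universally_complete_def
proof (intro conjI)
  have U: "riesz_space U" "dedekind_complete U" "laterally_complete U"
    using assms by (auto simp: universally_complete_def)
  interpret riesz_space U by (rule U(1))
  show "riesz_space (riesz_transport e U)" by (rule riesz_space_transport[OF U(1)])
  have pre: "\<exists>B\<subseteq>carrier U. A = e ` B" if "A \<subseteq> carrier (riesz_transport e U)" for A
    using that by (auto simp: transport_simps subset_image_iff)
  have lub: "\<exists>s. riesz_lub (riesz_transport e U) (e ` B) s"
    if "\<exists>s. riesz_lub U B s" "B \<subseteq> carrier U" for B
    using that transport_lub by (metis riesz_lub_def)
  show "dedekind_complete (riesz_transport e U)"
    unfolding dedekind_complete_def
  proof (intro allI impI, elim conjE bexE)
    fix A b assume A: "A \<subseteq> carrier (riesz_transport e U)" "A \<noteq> {}"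
      "b \<in> carrier (riesz_transport e U)" "\<forall>a\<in>A. rle (riesz_transport e U) a b"
    from pre[OF A(1)] obtain B where B: "B \<subseteq> carrier U" "A = e ` B" by blast
    obtain c where c: "c \<in> carrier U" "b = e c" using A(3) by (auto simp: transport_simps)
    have "\<forall>a\<in>B. rle U a c" using A(4) B c by (auto simp: transport_simps subset_iff)
    then have "\<exists>s. riesz_lub U B s"
      using U(2) B c A(2) unfolding dedekind_complete_def by blast
    then show "\<exists>s. riesz_lub (riesz_transport e U) A s" using lub B by blast
  qed
  show "laterally_complete (riesz_transport e U)"
    unfolding laterally_complete_def
  proof (intro allI impI, elim conjE)
    fix A assume A: "A \<subseteq> carrier (riesz_transport e U)" "A \<noteq> {}"
      "\<forall>a\<in>A. rle (riesz_transport e U) (rzero (riesz_transport e U)) a"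
      "\<forall>a\<in>A. \<forall>b\<in>A. a \<noteq> b \<longrightarrow>
         riesz_glb (riesz_transport e U) {a, b} (rzero (riesz_transport e U))"
    from pre[OF A(1)] obtain B where B: "B \<subseteq> carrier U" "A = e ` B" by blast
    have 1: "\<forall>a\<in>B. rle U (rzero U) a"
      using A(3) B by (auto simp: transport_simps subset_iff zero_closed)
    have 2: "\<forall>a\<in>B. \<forall>b\<in>B. a \<noteq> b \<longrightarrow> riesz_glb U {a, b} (rzero U)"
    proof (intro ballI impI)
      fix a b assume ab: "a \<in> B" "b \<in> B" "a \<noteq> b"
      then have "e a \<noteq> e b" using inj B(1) by (meson inj_on_def subsetD)
      then have "riesz_glb (riesz_transport e U) {e a, e b} (e (rzero U))"
        using A(4) B(2) ab by (auto simp: transport_simps(2))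
      then show "riesz_glb U {a, b} (rzero U)"
        using transport_glb2 ab B(1) zero_closed by blast
    qed
    have "\<exists>s. riesz_lub U B s"
      using U(3) B A(2) 1 2 unfolding laterally_complete_def by blast
    then show "\<exists>s. riesz_lub (riesz_transport e U) A s" using lub B by blast
  qed
qed

lemma universal_completion_transport:
  assumes uc: "universal_completion R U \<mu>"
  shows "universal_completion R (riesz_transport e U) (\<lambda>g. e (\<mu> g))"
proof -
  have U: "universally_complete U" and emb: "riesz_embedding R U \<mu>"
    and dense: "\<And>f. f \<in> carrier U \<Longrightarrow> rle U (rzero U) f \<Longrightarrow>
      riesz_lub U {\<mu> g |g. g \<in> carrier R \<and> rle U (rzero U) (\<mu> g) \<and> rle U (\<mu> g) f} f"
    using uc by (auto simp: universal_completion_def)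
  interpret riesz_space U using U by (simp add: universally_complete_def)
  have \<mu>: "\<mu> g \<in> carrier U" if "g \<in> carrier R" for g
    using emb that by (simp add: riesz_embedding_def riesz_hom_def)
  show ?thesis
    unfolding universal_completion_def
  proof (intro conjI ballI impI)
    show "universally_complete (riesz_transport e U)" by (rule universally_complete_transport[OF U])
    show "riesz_embedding R (riesz_transport e U) (\<lambda>g. e (\<mu> g))"
      using emb riesz_hom_transport inj \<mu> unfolding riesz_embedding_def
      by (auto intro!: riesz_hom_comp[of R U \<mu>] inj_onI dest!: inj_onD[OF inj] inj_onD)
  next
    fix f assume f: "f \<in> carrier (riesz_transport e U)"
      "rle (riesz_transport e U) (rzero (riesz_transport e U)) f"
    obtain f' where f': "f' \<in> carrier U" "f = e f'" using f(1) by (auto simp: transport_simps)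
    have "rle U (rzero U) f'" using f f' by (simp add: transport_simps zero_closed)
    from dense[OF f'(1) this] have
      "riesz_lub (riesz_transport e U)
        (e ` {\<mu> g |g. g \<in> carrier R \<and> rle U (rzero U) (\<mu> g) \<and> rle U (\<mu> g) f'}) (e f')"
      using \<mu> f' by (subst transport_lub) auto
    also have "e ` {\<mu> g |g. g \<in> carrier R \<and> rle U (rzero U) (\<mu> g) \<and> rle U (\<mu> g) f'} =
      {e (\<mu> g) |g. g \<in> carrier R \<and>
         rle (riesz_transport e U) (rzero (riesz_transport e U)) (e (\<mu> g)) \<and>
         rle (riesz_transport e U) (e (\<mu> g)) f}"
      using \<mu> f' zero_closed by (auto simp: transport_simps intro!: imageI)
    finally show "riesz_lub (riesz_transport e U)
      {e (\<mu> g) |g. g \<in> carrier R \<and>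
         rle (riesz_transport e U) (rzero (riesz_transport e U)) (e (\<mu> g)) \<and>
         rle (riesz_transport e U) (e (\<mu> g)) f} f" using f' by simp
  qed
qed

end

lemma riesz_isomorphic_trans:
  "riesz_isomorphic U V \<Longrightarrow> riesz_isomorphic V W \<Longrightarrow> riesz_isomorphic U W"
  unfolding riesz_isomorphic_def
  using riesz_hom_comp bij_betw_trans[unfolded comp_def] by blast

lemma riesz_isomorphic_sym:
  assumes "riesz_space U" "riesz_space V" "riesz_isomorphic U V"
  shows "riesz_isomorphic V U"
proof -
  interpret U: riesz_space U by fact
  interpret V: riesz_space V by fact
  obtain f where f: "riesz_hom U V f" "bij_betw f (carrier U) (carrier V)"
    using assms(3) by (auto simp: riesz_isomorphic_def)
  define d where "d = inv_into (carrier U) f"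
  have fd: "f (d x) = x" "d x \<in> carrier U" if "x \<in> carrier V" for x
    using that f(2) unfolding d_def
    by (auto simp: bij_betw_def f_inv_into_f inv_into_into)
  have df: "d (f x) = x" if "x \<in> carrier U" for x
    using that f(2) by (simp add: d_def bij_betw_def)
  have add: "f (radd U x y) = radd V (f x) (f y)" if "x \<in> carrier U" "y \<in> carrier U" for x y
    using f(1) that by (simp add: riesz_hom_def)
  have scale: "f (rscale U r x) = rscale V r (f x)" if "x \<in> carrier U" for r x
    using f(1) that by (simp add: riesz_hom_def)
  have lub: "riesz_lub V {f x, f y} (f s)" if "x \<in> carrier U" "y \<in> carrier U" "riesz_lub U {x, y} s" for x y s
    using f(1) that unfolding riesz_hom_def by blast
  have glb: "riesz_glb V {f x, f y} (f s)" if "x \<in> carrier U" "y \<in> carrier U" "riesz_glb U {x, y} s" for x y s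
    using f(1) that unfolding riesz_hom_def by blast
  have "riesz_hom V U d"
    unfolding riesz_hom_def
  proof (intro conjI ballI allI impI)
    fix x y assume x: "x \<in> carrier V"
    show "d x \<in> carrier U" by (rule fd[OF x])
    show "d (rscale V r x) = rscale U r (d x)" for r
      using scale[of "d x" r] df U.scale_closed fd[OF x] by metis
    assume y: "y \<in> carrier V"
    show "d (radd V x y) = radd U (d x) (d y)"
      using add[of "d x" "d y"] df U.add_closed fd[OF x] fd[OF y] by metis
    show "riesz_lub U {d x, d y} (d s)" if s: "riesz_lub V {x, y} s" for s
    proof -
      obtain t where t: "riesz_lub U {d x, d y} t" using U.ex_lub fd x y by blast
      then have "riesz_lub V {x, y} (f t)" using lub[of "d x" "d y" t] fd x y by simp
      then have "s = f t" using s V.lub_unique by blast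
      then show ?thesis using t df by (simp add: riesz_lub_def)
    qed
    show "riesz_glb U {d x, d y} (d s)" if s: "riesz_glb V {x, y} s" for s
    proof -
      obtain t where t: "riesz_glb U {d x, d y} t" using U.ex_glb fd x y by blast
      then have "riesz_glb V {x, y} (f t)" using glb[of "d x" "d y" t] fd x y by simp
      then have "s = f t" using s V.glb_unique by blast
      then show ?thesis using t df by (simp add: riesz_glb_def)
    qed
  qed
  moreover have "bij_betw d (carrier V) (carrier U)"
    unfolding d_def by (rule bij_betw_inv_into[OF f(2)])
  ultimately show ?thesis by (auto simp: riesz_isomorphic_def)
qed

lemma universal_completion_normal_form:
  fixes R :: "'r riesz" and U :: "'u riesz"
  assumes uc: "universal_completion R U \<mu>"
  shows "\<exists>(U' :: ('r set \<times> 'r set) riesz) \<mu>'.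
    universal_completion R U' \<mu>' \<and> riesz_isomorphic U U' \<and> riesz_space U'"
proof -
  have rU: "riesz_space U"
    using uc by (simp add: universal_completion_def universally_complete_def)
  interpret riesz_space U by (rule rU)
  define D where "D f = {g \<in> carrier R. rle U (rzero U) (\<mu> g) \<and> rle U (\<mu> g) f}" for f
  have lubD: "riesz_lub U (\<mu> ` D f) f" if "f \<in> carrier U" "rle U (rzero U) f" for f
  proof -
    have "\<mu> ` D f = {\<mu> g |g. g \<in> carrier R \<and> rle U (rzero U) (\<mu> g) \<and> rle U (\<mu> g) f}"
      by (auto simp: D_def)
    then show ?thesis using uc that by (auto simp: universal_completion_def)
  qed
  have "\<forall>x\<in>carrier U. \<exists>y z. y \<in> carrier U \<and> z \<in> carrier U \<and> rle U (rzero U) y \<and>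
      rle U (rzero U) z \<and> radd U x z = y"
    using ex_positive_difference by blast
  then obtain P N where PN: "\<And>x. x \<in> carrier U \<Longrightarrow> P x \<in> carrier U \<and> N x \<in> carrier U \<and>
      rle U (rzero U) (P x) \<and> rle U (rzero U) (N x) \<and> radd U x (N x) = P x"
    by metis
  define e where "e x = (D (P x), D (N x))" for x
  have inj: "inj_on e (carrier U)"
  proof (rule inj_onI)
    fix x y assume xy: "x \<in> carrier U" "y \<in> carrier U" "e x = e y"
    have D: "D (P x) = D (P y)" "D (N x) = D (N y)" using xy(3) by (simp_all add: e_def)
    note x = PN[OF xy(1)] and y = PN[OF xy(2)]
    have "P x = P y"
      using lub_unique[of "\<mu> ` D (P x)" "P x" "P y"] lubD[of "P x"] lubD[of "P y"] x y D by simp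
    moreover have N: "N x = N y"
      using lub_unique[of "\<mu> ` D (N x)" "N x" "N y"] lubD[of "N x"] lubD[of "N y"] x y D by simp
    ultimately have "radd U x (N x) = radd U y (N x)" using x y by simp
    then show "x = y" using add_right_cancel xy x by blast
  qed
  have "riesz_isomorphic U (riesz_transport e U)"
    unfolding riesz_isomorphic_def
    by (rule exI[of _ e])
       (simp add: riesz_hom_transport[OF inj] bij_betw_def inj transport_simps(1)[OF inj])
  then show ?thesis
    using universal_completion_transport[OF inj uc] riesz_space_transport[OF inj rU] by blast
qed

lemma isomorphic_universal_completionsI:
  fixes R :: "'r riesz" and S :: "'s riesz" and U :: "'u riesz" and V :: "'v riesz"
  assumes "universal_completion R U \<mu>" "universal_completion S V \<nu>" "riesz_isomorphic U V"
  shows "isomorphic_universal_completions R S"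
proof -
  obtain U' :: "('r set \<times> 'r set) riesz" and \<mu>'
    where U': "universal_completion R U' \<mu>'" "riesz_isomorphic U U'" "riesz_space U'"
    using universal_completion_normal_form[OF assms(1)] by blast
  obtain V' :: "('s set \<times> 's set) riesz" and \<nu>'
    where V': "universal_completion S V' \<nu>'" "riesz_isomorphic V V'"
    using universal_completion_normal_form[OF assms(2)] by blast
  have "riesz_space U"
    using assms(1) by (simp add: universal_completion_def universally_complete_def)
  then have "riesz_isomorphic U' V'"
    using riesz_isomorphic_sym riesz_isomorphic_trans U' V'(2) assms(3) by metis
  then show ?thesis
    using U'(1) V'(1) unfolding isomorphic_universal_completions_def by blast
qed

section \<open>The Riesz spaces of continuous and of nearly finite Hausdorff continuous functions\<close>

definition C_le :: "(frame_of_reals \<Rightarrow> 'a::frame) \<Rightarrow> (frame_of_reals \<Rightarrow> 'a) \<Rightarrow> bool" where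
  "C_le f g \<longleftrightarrow> (\<forall>p. f (rgt p) \<le> g (rgt p)) \<and> (\<forall>q. f (rlt q) \<ge> g (rlt q))"

definition C_zero :: "frame_of_reals \<Rightarrow> 'a::frame" where
  "C_zero = real_hom (\<lambda>p. if p < 0 then \<top> else \<bottom>) (\<lambda>q. if q > 0 then \<top> else \<bottom>)"

definition C_add :: "(frame_of_reals \<Rightarrow> 'a::frame) \<Rightarrow> (frame_of_reals \<Rightarrow> 'a) \<Rightarrow> frame_of_reals \<Rightarrow> 'a" where
  "C_add f g = real_hom
     (\<lambda>p. \<Squnion>r. f (rgt r) \<sqinter> g (rgt (p - r)))
     (\<lambda>q. \<Squnion>s. f (rlt s) \<sqinter> g (rlt (q - s)))"

definition C_uminus :: "(frame_of_reals \<Rightarrow> 'a::frame) \<Rightarrow> frame_of_reals \<Rightarrow> 'a" where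
  "C_uminus f = real_hom (\<lambda>p. f (rlt (- p))) (\<lambda>q. f (rgt (- q)))"

definition C_scale_pos :: "real \<Rightarrow> (frame_of_reals \<Rightarrow> 'a::frame) \<Rightarrow> frame_of_reals \<Rightarrow> 'a" where
  "C_scale_pos l f = real_hom
     (\<lambda>p. \<Squnion>{f (rgt r) |r. l * of_rat r > of_rat p})
     (\<lambda>q. \<Squnion>{f (rlt s) |s. l * of_rat s < of_rat q})"

definition C_scale :: "real \<Rightarrow> (frame_of_reals \<Rightarrow> 'a::frame) \<Rightarrow> frame_of_reals \<Rightarrow> 'a" where
  "C_scale l f =
     (if l > 0 then C_scale_pos l f
      else if l = 0 then C_zero
      else C_uminus (C_scale_pos (- l) f))"

definition C_riesz :: "'a::frame itself \<Rightarrow> (frame_of_reals \<Rightarrow> 'a) riesz" where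
  "C_riesz _ = \<lparr>carrier = {f. frame_hom f}, rzero = C_zero, radd = C_add, rscale = C_scale,
     rle = C_le\<rparr>"

definition IC_le :: "(frame_of_ereals \<Rightarrow> 'a::frame) \<Rightarrow> (frame_of_ereals \<Rightarrow> 'a) \<Rightarrow> bool" where
  "IC_le f g \<longleftrightarrow> (\<forall>p. f (igt p) \<le> g (igt p)) \<and> (\<forall>q. f (ilt q) \<ge> g (ilt q))"

definition hausdorff_continuous :: "(frame_of_ereals \<Rightarrow> 'a::frame) \<Rightarrow> bool" where
  "hausdorff_continuous f \<longleftrightarrow> frame_hom f \<and>
     (\<forall>p q. p < q \<longrightarrow> pcompl (f (igt p)) \<le> f (ilt q) \<and> pcompl (f (ilt q)) \<le> f (igt p))"

definition nearly_finite :: "(frame_of_ereals \<Rightarrow> 'a::frame) \<Rightarrow> bool" where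
  "nearly_finite f \<longleftrightarrow>
     pcompl (pcompl (\<Squnion>p. f (igt p))) = \<top> \<and> pcompl (pcompl (\<Squnion>q. f (ilt q))) = \<top>"

text \<open>\<open>\<beta> \<circ> f\<close> is defined on the frame of extended partial reals; \<open>H_Gamma f\<close> is its factorisation
  through the canonical map to the frame of reals, see \<open>H_Gamma\<close> below.\<close>

definition H_Gamma :: "(frame_of_ereals \<Rightarrow> 'a::frame) \<Rightarrow> frame_of_reals \<Rightarrow> 'a booleanization" where
  "H_Gamma f = real_hom (\<lambda>p. booleanize (f (igt p))) (\<lambda>q. booleanize (f (ilt q)))"

definition H_Delta :: "(frame_of_reals \<Rightarrow> 'a::frame booleanization) \<Rightarrow> frame_of_ereals \<Rightarrow> 'a" where
  "H_Delta g = ireal_hom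
     (\<lambda>p. \<Squnion>r\<in>{r. r > p}. of_bool_frame (g (rgt r)))
     (\<lambda>q. \<Squnion>s\<in>{s. s < q}. of_bool_frame (g (rlt s)))"

definition Hnf_riesz :: "'a::frame itself \<Rightarrow> (frame_of_ereals \<Rightarrow> 'a) riesz" where
  "Hnf_riesz _ = \<lparr>carrier = {f. hausdorff_continuous f \<and> nearly_finite f},
     rzero = H_Delta C_zero,
     radd = \<lambda>f g. H_Delta (C_add (H_Gamma f) (H_Gamma g)),
     rscale = \<lambda>l f. H_Delta (C_scale l (H_Gamma f)),
     rle = IC_le\<rparr>"

lemma H_Gamma:
  fixes f :: "frame_of_ereals \<Rightarrow> 'a::frame"
  assumes "hausdorff_continuous f" "nearly_finite f"
  shows "frame_hom (H_Gamma f)"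
    and "H_Gamma f \<circ> ireal_hom rgt rlt = booleanize \<circ> f"
proof -
  have f: "frame_hom f" using assms(1) by (simp add: hausdorff_continuous_def)
  let ?b = "\<lambda>x. booleanize (f x)"
  have b: "frame_hom ?b" by (rule frame_hom_comp[OF frame_hom_booleanize f])
  have ir: "ireal_relations (\<lambda>p. ?b (igt p)) (\<lambda>q. ?b (ilt q))"
    by (rule frame_hom_ireal_relations[OF b])
  have r2: "?b (igt p) \<squnion> ?b (ilt q) = \<top>" if "p < q" for p q
  proof -
    have "pcompl (f (igt p)) \<le> f (ilt q)"
      using assms(1) that by (simp add: hausdorff_continuous_def)
    moreover have "pcompl (f (igt p) \<squnion> f (ilt q)) \<le> pcompl (f (igt p))"
      "pcompl (f (igt p) \<squnion> f (ilt q)) \<le> pcompl (f (ilt q))"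
      by (simp_all add: pcompl_antimono)
    ultimately have "pcompl (f (igt p) \<squnion> f (ilt q)) \<le> f (ilt q) \<sqinter> pcompl (f (ilt q))"
      by (meson le_inf_iff order_trans)
    then have "pcompl (f (igt p) \<squnion> f (ilt q)) = \<bottom>"
      by (simp add: inf_pcompl bot_unique)
    then have "booleanize (f (igt p) \<squnion> f (ilt q)) = \<top>"
      by (simp add: booleanize_top_iff)
    then show ?thesis by (simp add: frame_hom_sup[OF frame_hom_booleanize])
  qed
  have "booleanize (\<Squnion>p. f (igt p)) = \<top>" "booleanize (\<Squnion>q. f (ilt q)) = \<top>"
    using assms(2) by (simp_all only: nearly_finite_def booleanize_top_iff)
  then have r56: "(\<Squnion>p. ?b (igt p)) = \<top>" "(\<Squnion>q. ?b (ilt q)) = \<top>"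
    by (simp_all add: frame_hom_Sup[OF frame_hom_booleanize] image_image)
  have rr: "real_relations (\<lambda>p. ?b (igt p)) (\<lambda>q. ?b (ilt q))"
    using ir r2 r56 unfolding real_relations_def ireal_relations_def by blast
  show hom: "frame_hom (H_Gamma f)"
    unfolding H_Gamma_def by (rule real_hom(1)[OF rr])
  have "ireal_relations rgt rlt"
    using frame_hom_real_relations[OF frame_homI[of "\<lambda>x. x"]]
    unfolding real_relations_def ireal_relations_def image_ident by blast
  note can = ireal_hom[OF this]
  have "(\<lambda>x. H_Gamma f (ireal_hom rgt rlt x)) = ?b"
    by (rule frame_hom_ireal_eqI[OF frame_hom_comp[OF hom can(1)] b])
       (simp_all add: can H_Gamma_def real_hom[OF rr])
  then show "H_Gamma f \<circ> ireal_hom rgt rlt = booleanize \<circ> f"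
    by (simp add: comp_def)
qed

end

theory Submission
  imports Defs
begin

text \<open>
  Over a Boolean frame \<open>B\<close>, pointwise joins of the upper generators show that \<open>C(B)\<close> is universally
  complete, and bump functions supplied by complete regularity make \<open>\<beta> \<circ> _\<close> a universal completion
  \<open>C(L) \<rightarrow> C(B(L))\<close>, whose target is Riesz isomorphic to \<open>H\<^sub>n\<^sub>f(L)\<close>. This gives (1) \<open>\<Longrightarrow>\<close> (2) \<open>\<Longrightarrow>\<close> (3).
  For (3) \<open>\<Longrightarrow>\<close> (1), uniqueness of universal completions is avoided: in any universal completion of
  \<open>C(L)\<close> the image of \<open>C(L)\<close> is order dense, so its polars correspond to regular elements of \<open>L\<close>, by
  sending \<open>b\<close> to the polar of the functions whose cozero element \<open>g(0,-)\<close> is disjoint from \<open>b\<close>.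
  Polars depend only on the order and zero, hence a Riesz isomorphism between the completions
  induces an order isomorphism of the Booleanizations.
\<close>

section \<open>Continuous real functions on a frame\<close>

text \<open>The isomorphism in (3) is not assumed to commute with the embeddings of
  \<open>C(L)\<close> and \<open>C(M)\<close>, and the completions are otherwise arbitrary. Only
  data intrinsic to a Riesz space can therefore be compared, which is why polars are used. They see
  exactly the Booleanization because positive functions are disjoint iff their cozero elements are,
  and over a completely regular frame every element is a join of cozero elements. The obstacle to
  completeness is (r2): for a family of functions, the joins of their upper generators at successive
  levels must be linked by \<open>rather_below\<close>, not merely by the order. In a Boolean frame
  the two relations coincide, so only finiteness of the supremum is left to check; an upper bound or
  pairwise disjointness provides it. In a general frame \<open>rather_below\<close> absorbs double
  pseudocomplements. Hence a gap p < q between rational levels compensates for passing to the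
  Booleanization, which makes composition with \<beta> injective; the gap in the definition of
  Hausdorff continuity plays the same part when \<open>H_Delta\<close> is shown to invert
  \<open>H_Gamma\<close>.\<close>

lemma SUP_inf_le_iff: "(\<Squnion>i\<in>I. F i) \<sqinter> c \<le> z \<longleftrightarrow> (\<forall>i\<in>I. F i \<sqinter> c \<le> (z::'a::frame))"
  by (simp add: Sup_inf_frame image_image SUP_le_iff)

lemma inf_SUP_le_iff: "c \<sqinter> (\<Squnion>i\<in>I. F i) \<le> z \<longleftrightarrow> (\<forall>i\<in>I. c \<sqinter> F i \<le> (z::'a::frame))"
  by (simp add: inf_Sup_frame image_image SUP_le_iff)

lemma SUP_inf_SUP_le:
  assumes "x = (\<Squnion>i\<in>I. F i)" "y = (\<Squnion>j\<in>J. G j)"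
    and "\<And>i j. i \<in> I \<Longrightarrow> j \<in> J \<Longrightarrow> F i \<sqinter> G j \<le> z"
  shows "x \<sqinter> y \<le> (z::'a::frame)"
  using assms by (simp add: SUP_inf_le_iff inf_SUP_le_iff)

lemma sup_inf_le_iff: "(a \<squnion> b) \<sqinter> c \<le> z \<longleftrightarrow> a \<sqinter> c \<le> z \<and> b \<sqinter> c \<le> (z::'a::frame)"
  using SUP_inf_le_iff[of "\<lambda>x. x" "{a, b}"] by simp

lemma inf_sup_le_iff: "c \<sqinter> (a \<squnion> b) \<le> z \<longleftrightarrow> c \<sqinter> a \<le> z \<and> c \<sqinter> b \<le> (z::'a::frame)"
  using inf_SUP_le_iff[of _ "\<lambda>x. x" "{a, b}"] by simp

text \<open>Case analysis over a cover: by distributivity \<open>c\<close> is the join of its part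
  inside \<open>a\<close> and its part inside \<open>b\<close>. The covers come from (r2).\<close>

lemma sup_eq_top_le:
  assumes "a \<squnion> b = \<top>" "c \<sqinter> a \<le> z" "c \<sqinter> b \<le> z" shows "c \<le> (z::'a::frame)"
  using assms inf_sup_le_iff[of c a b z] by simp

lemma SUP_eq_top_le:
  assumes "(\<Squnion>i\<in>I. F i) = \<top>" "\<And>i. i \<in> I \<Longrightarrow> c \<sqinter> F i \<le> z" shows "c \<le> (z::'a::frame)"
  using assms inf_SUP_le_iff[of c F I z] by simp

lemma SUP_top_inf_SUP_top_le:
  assumes "(\<Squnion>i. F i) = \<top>" "(\<Squnion>j. G j) = \<top>" "\<And>i j. F i \<sqinter> G j \<le> z"
  shows "\<top> \<le> (z::'a::frame)"
  using SUP_inf_SUP_le[OF assms(1,2)[symmetric], of z] assms(3) by simp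

text \<open>Testing against upper bounds turns nested joins into nested universal quantifiers, so
  that identities of the function space become equivalences of conditions on rational
  indices.\<close>

lemma eq_by_upper_bounds: "(\<And>z. x \<le> z \<longleftrightarrow> y \<le> z) \<Longrightarrow> x = (y::'a::order)"
  by (simp add: order_eq_iff)

section \<open>Generators of the frame of reals, and comparison of functions by upper
  generators\<close>

lemma real_relations_gen: "real_relations rgt rlt"
  using frame_hom_real_relations[OF frame_homI[of "\<lambda>x. x"]] by simp

lemma rgt_inf_rlt: "q \<le> p \<Longrightarrow> rgt p \<sqinter> rlt q = \<bottom>"
  and rgt_sup_rlt: "p < q \<Longrightarrow> rgt p \<squnion> rlt q = \<top>"
  and rgt_eq: "rgt p = (\<Squnion>q\<in>{q. q > p}. rgt q)"
  and rlt_eq: "rlt p = (\<Squnion>q\<in>{q. q < p}. rlt q)"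
  and SUP_rgt: "(\<Squnion>p. rgt p) = \<top>"
  and SUP_rlt: "(\<Squnion>p. rlt p) = \<top>"
  using real_relations_gen unfolding real_relations_def by blast+

lemma rgt_antimono: "p \<le> q \<Longrightarrow> rgt q \<le> rgt p"
  by (cases "p = q") (auto simp: rgt_eq[of p] intro: SUP_upper)

lemma rlt_mono: "p \<le> q \<Longrightarrow> rlt p \<le> rlt q"
  by (cases "p = q") (auto simp: rlt_eq[of q] intro: SUP_upper)

context
  fixes f :: "frame_of_reals \<Rightarrow> 'a::frame"
  assumes f: "frame_hom f"
begin

lemma hom_rgt_antimono: "p \<le> q \<Longrightarrow> f (rgt q) \<le> f (rgt p)"
  by (rule frame_hom_mono[OF f rgt_antimono])

lemma hom_rlt_mono: "p \<le> q \<Longrightarrow> f (rlt p) \<le> f (rlt q)"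
  by (rule frame_hom_mono[OF f rlt_mono])

lemma hom_rgt_inf_rlt: "q \<le> p \<Longrightarrow> f (rgt p) \<sqinter> f (rlt q) = \<bottom>"
  by (simp add: frame_hom_inf[OF f, symmetric] rgt_inf_rlt frame_hom_bot[OF f])

lemma hom_rgt_sup_rlt: "p < q \<Longrightarrow> f (rgt p) \<squnion> f (rlt q) = \<top>"
  by (simp add: frame_hom_sup[OF f, symmetric] rgt_sup_rlt frame_hom_top[OF f])

lemma hom_rgt_eq: "f (rgt p) = (\<Squnion>q\<in>{q. q > p}. f (rgt q))"
  by (subst rgt_eq) (simp add: frame_hom_Sup[OF f] image_image)

lemma hom_rlt_eq: "f (rlt p) = (\<Squnion>q\<in>{q. q < p}. f (rlt q))"
  by (subst rlt_eq) (simp add: frame_hom_Sup[OF f] image_image)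

lemma SUP_hom_rgt: "(\<Squnion>p. f (rgt p)) = \<top>"
  using frame_hom_Sup[OF f, of "range rgt"] by (simp add: SUP_rgt frame_hom_top[OF f] image_image)

lemma SUP_hom_rlt: "(\<Squnion>p. f (rlt p)) = \<top>"
  using frame_hom_Sup[OF f, of "range rlt"] by (simp add: SUP_rlt frame_hom_top[OF f] image_image)

end

text \<open>For s < q the elements f(s,-) and f(-,q) cover. Since g(-,s) misses g(s,-), it misses
  the smaller f(s,-), so it lies below f(-,q); (r4) for g joins over s.\<close>

lemma C_leI:
  assumes f: "frame_hom f" and g: "frame_hom g" and le: "\<And>p. f (rgt p) \<le> g (rgt p)"
  shows "C_le f g"
  unfolding C_le_def
proof (intro conjI allI le)
  fix q
  show "g (rlt q) \<le> f (rlt q)"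
    unfolding hom_rlt_eq[OF g, of q]
  proof (rule SUP_least)
    fix s assume "s \<in> {s. s < q}"
    then have "f (rgt s) \<squnion> f (rlt q) = \<top>" by (simp add: hom_rgt_sup_rlt[OF f])
    moreover have "g (rlt s) \<sqinter> f (rgt s) \<le> g (rlt s) \<sqinter> g (rgt s)"
      by (rule inf_mono[OF order_refl le])
    then have "g (rlt s) \<sqinter> f (rgt s) \<le> f (rlt q)"
      using hom_rgt_inf_rlt[OF g order_refl, of s] by (simp add: inf.commute bot_unique)
    ultimately show "g (rlt s) \<le> f (rlt q)" by (rule sup_eq_top_le) simp
  qed
qed

lemma C_eqI:
  assumes f: "frame_hom f" and g: "frame_hom g" and eq: "\<And>p. f (rgt p) = g (rgt p)"
  shows "f = g"
  using C_leI[OF f g] C_leI[OF g f] frame_hom_real_eqI[OF f g] eq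
  by (auto simp: C_le_def intro: antisym)

lemma C_le_iff: "frame_hom f \<Longrightarrow> frame_hom g \<Longrightarrow> C_le f g \<longleftrightarrow> (\<forall>p. f (rgt p) \<le> g (rgt p))"
  using C_leI[of f g] by (auto simp: C_le_def)

text \<open>Each relation is left with its nontrivial inequality; for (r3) and (r4) the converse one
  is monotonicity, asked for separately.\<close>

lemma real_relationsI:
  assumes "\<And>p q. q \<le> p \<Longrightarrow> u p \<sqinter> v q \<le> \<bottom>" "\<And>p q. p < q \<Longrightarrow> \<top> \<le> u p \<squnion> v q"
    and "\<And>p q. p < q \<Longrightarrow> u q \<le> u p" "\<And>p. u p \<le> (\<Squnion>q\<in>{q. q > p}. u q)"
    and "\<And>p q. p < q \<Longrightarrow> v p \<le> v q" "\<And>p. v p \<le> (\<Squnion>q\<in>{q. q < p}. v q)"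
    and "\<top> \<le> (\<Squnion>p. u p)" "\<top> \<le> (\<Squnion>p. v p)"
  shows "real_relations u (v :: rat \<Rightarrow> 'a::frame)"
  using assms unfolding real_relations_def
  by (intro conjI allI impI) (auto simp: bot_unique top_unique intro!: antisym SUP_least)

section \<open>The zero function, covers by short intervals, and sums\<close>

lemma C_zero_relations:
  "real_relations (\<lambda>p. if p < 0 then \<top> else \<bottom>) (\<lambda>q. if q > 0 then \<top> else (\<bottom>::'a::frame))"
proof (rule real_relationsI, goal_cases)
  case (4 p)
  show ?case
  proof (cases "p < 0")
    case True
    then obtain r where "p < r" "r < 0" using dense by blast
    then show ?thesis by (intro SUP_upper2[of r]) auto
  qed auto
next
  case (6 p)
  show ?case
  proof (cases "p > 0")
    case True
    then obtain r where "0 < r" "r < p" using dense by blast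
    then show ?thesis by (intro SUP_upper2[of r]) auto
  qed auto
next
  case 7
  show ?case by (rule SUP_upper2[of "-1"]) auto
next
  case 8
  show ?case by (rule SUP_upper2[of 1]) auto
qed auto

lemma frame_hom_C_zero: "frame_hom C_zero"
  and C_zero_rgt: "C_zero (rgt p) = (if p < 0 then \<top> else \<bottom>)"
  unfolding C_zero_def by (rule real_hom[OF C_zero_relations])+

text \<open>Induction on the number of half-steps: the interval is cut by the cover at p + e/2 and p
  + e. The left piece fits into one interval of length e, and the right piece has one half-step
  fewer; for n = 0 the interval is empty.\<close>

lemma rgt_inf_rlt_le_SUP:
  assumes e: "e > 0"
  shows "rgt p \<sqinter> rlt (p + of_nat n * e / 2) \<le> (\<Squnion>r. rgt r \<sqinter> rlt (r + e))"
proof (induction n arbitrary: p)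
  case 0
  then show ?case by (simp add: rgt_inf_rlt)
next
  case (Suc n)
  have "rgt (p + e / 2) \<squnion> rlt (p + e) = \<top>"
    using e by (intro rgt_sup_rlt) simp
  then show ?case
  proof (rule sup_eq_top_le)
    have "(rgt p \<sqinter> rlt (p + of_nat (Suc n) * e / 2)) \<sqinter> rgt (p + e / 2)
        \<le> rgt (p + e / 2) \<sqinter> rlt ((p + e / 2) + of_nat n * e / 2)"
      by (simp add: le_infI1 field_simps)
    then show "(rgt p \<sqinter> rlt (p + of_nat (Suc n) * e / 2)) \<sqinter> rgt (p + e / 2)
        \<le> (\<Squnion>r. rgt r \<sqinter> rlt (r + e))"
      using Suc.IH order_trans by blast
    show "(rgt p \<sqinter> rlt (p + of_nat (Suc n) * e / 2)) \<sqinter> rlt (p + e) \<le> (\<Squnion>r. rgt r \<sqinter> rlt (r + e))"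
      by (rule SUP_upper2[of p]) (auto simp: le_infI1)
  qed
qed

lemma SUP_rgt_inf_rlt:
  assumes e: "e > 0" shows "(\<Squnion>r. rgt r \<sqinter> rlt (r + e)) = \<top>" (is "?S = \<top>")
proof (rule top_le)
  have "rgt p \<sqinter> rlt q \<le> ?S" for p q
  proof -
    \<comment> \<open>Archimedean property: finitely many half-steps of length \<open>e / 2\<close>
      lead from \<open>p\<close> past \<open>q\<close>.\<close>
    obtain n where n: "(q - p) / (e / 2) < of_nat n" using reals_Archimedean2 by blast
    then have "q \<le> p + of_nat n * e / 2" using e by (simp add: field_simps)
    then have "rgt p \<sqinter> rlt q \<le> rgt p \<sqinter> rlt (p + of_nat n * e / 2)"
      by (intro inf_mono rlt_mono) auto
    then show ?thesis using rgt_inf_rlt_le_SUP[OF e] order_trans by blast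
  qed
  then have "(\<Squnion>p. rgt p) \<sqinter> (\<Squnion>q. rlt q) \<le> ?S"
    by (simp add: SUP_inf_le_iff inf_SUP_le_iff)
  then show "\<top> \<le> ?S" by (simp add: SUP_rgt SUP_rlt)
qed

lemma SUP_hom_rgt_inf_rlt:
  assumes f: "frame_hom f" and e: "e > 0"
  shows "(\<Squnion>r. f (rgt r) \<sqinter> f (rlt (r + e))) = \<top>"
  using frame_hom_Sup[OF f, of "range (\<lambda>r. rgt r \<sqinter> rlt (r + e))"]
  by (simp add: SUP_rgt_inf_rlt[OF e] frame_hom_top[OF f] frame_hom_inf[OF f] image_image)

context
  fixes f g :: "frame_of_reals \<Rightarrow> 'a::frame"
  assumes f: "frame_hom f" and g: "frame_hom g"
begin

lemma C_add_relations:
  "real_relations (\<lambda>p. \<Squnion>r. f (rgt r) \<sqinter> g (rgt (p - r))) (\<lambda>q. \<Squnion>s. f (rlt s) \<sqinter> g (rlt (q - s)))"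
  (is "real_relations ?u ?v")
proof (rule real_relationsI, goal_cases)
  case (1 p q)
  \<comment> \<open>The lower bounds add up to \<open>p\<close> and the upper bounds to
    \<open>q\<close>; as q \<le> p, the two bounds on \<open>f\<close> or the two bounds on
    \<open>g\<close> must clash.\<close>
  have "(f (rgt r) \<sqinter> g (rgt (p - r))) \<sqinter> (f (rlt s) \<sqinter> g (rlt (q - s))) \<le> \<bottom>" for r s
  proof (cases "s \<le> r")
    case True
    have "(f (rgt r) \<sqinter> g (rgt (p - r))) \<sqinter> (f (rlt s) \<sqinter> g (rlt (q - s))) \<le> f (rgt r) \<sqinter> f (rlt s)"
      by (simp add: le_infI1 le_infI2)
    then show ?thesis using hom_rgt_inf_rlt[OF f True] by simp
  next
    case False
    have "(f (rgt r) \<sqinter> g (rgt (p - r))) \<sqinter> (f (rlt s) \<sqinter> g (rlt (q - s)))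
        \<le> g (rgt (p - r)) \<sqinter> g (rlt (q - s))"
      by (simp add: le_infI1 le_infI2)
    then show ?thesis using hom_rgt_inf_rlt[OF g, of "q - s" "p - r"] False 1 by simp
  qed
  then show ?case by (simp add: SUP_inf_le_iff inf_SUP_le_iff)
next
  case (2 p q)
  \<comment> \<open>Confining \<open>f\<close> and \<open>g\<close> to intervals of length
    \<open>e\<close> confines the sum to the interval from r + s to r + s + (q - p). This either
    starts at or above \<open>p\<close> or ends below \<open>q\<close>.\<close>
  define e where "e = (q - p) / 2"
  have e: "e > 0" using 2 by (simp add: e_def)
  have "(f (rgt r) \<sqinter> f (rlt (r + e))) \<sqinter> (g (rgt s) \<sqinter> g (rlt (s + e))) \<le> ?u p \<squnion> ?v q" for r s
  proof (cases "p \<le> r + s")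
    case True
    have "(f (rgt r) \<sqinter> f (rlt (r + e))) \<sqinter> (g (rgt s) \<sqinter> g (rlt (s + e))) \<le> f (rgt r) \<sqinter> g (rgt (p - r))"
      using True hom_rgt_antimono[OF g, of "p - r" s] by (simp add: le_infI1 le_infI2)
    also have "\<dots> \<le> ?u p" by (rule SUP_upper) simp
    finally show ?thesis by (simp add: le_supI1)
  next
    case False
    have "(f (rgt r) \<sqinter> f (rlt (r + e))) \<sqinter> (g (rgt s) \<sqinter> g (rlt (s + e)))
        \<le> f (rlt (r + e)) \<sqinter> g (rlt (q - (r + e)))"
      using False hom_rlt_mono[OF g, of "s + e" "q - (r + e)"]
      by (simp add: le_infI1 le_infI2 e_def field_simps)
    also have "\<dots> \<le> ?v q" by (rule SUP_upper) simp
    finally show ?thesis by (simp add: le_supI2)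
  qed
  then show ?case
    by (rule SUP_top_inf_SUP_top_le[OF SUP_hom_rgt_inf_rlt[OF f e] SUP_hom_rgt_inf_rlt[OF g e]])
next
  case (3 p q)
  then show ?case
    by (intro SUP_subset_mono order_refl inf_mono hom_rgt_antimono[OF g]) auto
next
  case (4 p)
  have "f (rgt r) \<sqinter> g (rgt t) \<le> (\<Squnion>q\<in>{q. q > p}. ?u q)" if "t > p - r" for r t
    using that by (intro SUP_upper2[of "r + t"] SUP_upper2[of r]) auto
  then show ?case
    by (intro SUP_least, subst hom_rgt_eq[OF g]) (auto simp: inf_SUP_le_iff)
next
  case (5 p q)
  then show ?case
    by (intro SUP_subset_mono order_refl inf_mono hom_rlt_mono[OF g]) auto
next
  case (6 p)
  have "f (rlt r) \<sqinter> g (rlt t) \<le> (\<Squnion>q\<in>{q. q < p}. ?v q)" if "t < p - r" for r t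
    using that by (intro SUP_upper2[of "r + t"] SUP_upper2[of r]) auto
  then show ?case
    by (intro SUP_least, subst hom_rlt_eq[OF g]) (auto simp: inf_SUP_le_iff)
next
  case 7
  have "f (rgt r) \<sqinter> g (rgt t) \<le> (\<Squnion>p. ?u p)" for r t
    by (intro SUP_upper2[of "r + t"] SUP_upper2[of r]) auto
  then show ?case
    by (rule SUP_top_inf_SUP_top_le[OF SUP_hom_rgt[OF f] SUP_hom_rgt[OF g]])
next
  case 8
  have "f (rlt r) \<sqinter> g (rlt t) \<le> (\<Squnion>p. ?v p)" for r t
    by (intro SUP_upper2[of "r + t"] SUP_upper2[of r]) auto
  then show ?case
    by (rule SUP_top_inf_SUP_top_le[OF SUP_hom_rlt[OF f] SUP_hom_rlt[OF g]])
qed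

lemma frame_hom_C_add: "frame_hom (C_add f g)"
  unfolding C_add_def by (rule real_hom(1)[OF C_add_relations])

lemma C_add_rgt: "C_add f g (rgt p) = (\<Squnion>r. f (rgt r) \<sqinter> g (rgt (p - r)))"
  unfolding C_add_def by (rule real_hom[OF C_add_relations])+

text \<open>Relation (r3) for \<open>g\<close> replaces the exact splitting of p by a strict
  inequality, which treats both summands alike; the extra factor \<open>c\<close> allows the
  criterion to be applied inside another sum.\<close>

lemma C_add_rgt_le_iff:
  "C_add f g (rgt p) \<sqinter> c \<le> z \<longleftrightarrow> (\<forall>r s. p < r + s \<longrightarrow> f (rgt r) \<sqinter> g (rgt s) \<sqinter> c \<le> z)"
proof -
  have "f (rgt r) \<sqinter> g (rgt (p - r)) \<sqinter> c \<le> z \<longleftrightarrow> (\<forall>s. p < r + s \<longrightarrow> f (rgt r) \<sqinter> g (rgt s) \<sqinter> c \<le> z)" for r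
    by (subst hom_rgt_eq[OF g])
       (auto simp: inf_Sup_frame Sup_inf_frame image_image SUP_le_iff algebra_simps)
  then show ?thesis by (simp add: C_add_rgt SUP_inf_le_iff)
qed

section \<open>Binary suprema and infima\<close>

lemma C_sup_relations:
  "real_relations (\<lambda>p. f (rgt p) \<squnion> g (rgt p)) (\<lambda>q. f (rlt q) \<sqinter> g (rlt q))"
proof (rule real_relationsI, goal_cases)
  case (1 p q)
  have "f (rgt p) \<sqinter> (f (rlt q) \<sqinter> g (rlt q)) \<le> f (rgt p) \<sqinter> f (rlt q)"
    "g (rgt p) \<sqinter> (f (rlt q) \<sqinter> g (rlt q)) \<le> g (rgt p) \<sqinter> g (rlt q)" by (simp_all add: le_infI2)
  then show ?case
    using 1 by (simp add: sup_inf_le_iff hom_rgt_inf_rlt[OF f] hom_rgt_inf_rlt[OF g])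
next
  case (2 p q)
  show ?case
    by (rule sup_eq_top_le[OF hom_rgt_sup_rlt[OF f 2]];
        rule sup_eq_top_le[OF hom_rgt_sup_rlt[OF g 2]])
       (simp_all add: le_supI1 le_supI2 le_infI1 le_infI2)
next
  case (3 p q)
  then show ?case using hom_rgt_antimono[OF f] hom_rgt_antimono[OF g] by (intro sup_mono) auto
next
  case (4 p)
  show ?case
    by (subst hom_rgt_eq[OF f], subst hom_rgt_eq[OF g])
       (auto simp: SUP_le_iff intro: SUP_upper2 le_supI1 le_supI2)
next
  case (5 p q)
  then show ?case using hom_rlt_mono[OF f] hom_rlt_mono[OF g] by (intro inf_mono) auto
next
  case (6 p)
  \<comment> \<open>Lower generators increase with the index, so \<open>max r s\<close> serves both
    factors at once.\<close>
  have "f (rlt r) \<sqinter> g (rlt s) \<le> (\<Squnion>q\<in>{q. q < p}. f (rlt q) \<sqinter> g (rlt q))" if "r < p" "s < p" for r s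
    using that hom_rlt_mono[OF f, of r "max r s"] hom_rlt_mono[OF g, of s "max r s"]
    by (intro SUP_upper2[of "max r s"]) (simp_all add: le_infI1 le_infI2)
  then show ?case by - (rule SUP_inf_SUP_le[OF hom_rlt_eq[OF f] hom_rlt_eq[OF g]], simp)
next
  case 7
  have "(\<Squnion>p. f (rgt p)) \<le> (\<Squnion>p. f (rgt p) \<squnion> g (rgt p))" by (intro SUP_subset_mono order_refl sup_ge1)
  then show ?case by (simp add: SUP_hom_rgt[OF f])
next
  case 8
  have "f (rlt r) \<sqinter> g (rlt s) \<le> (\<Squnion>q. f (rlt q) \<sqinter> g (rlt q))" for r s
    using hom_rlt_mono[OF f, of r "max r s"] hom_rlt_mono[OF g, of s "max r s"]
    by (intro SUP_upper2[of "max r s"]) (simp_all add: le_infI1 le_infI2)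
  then show ?case
    by (rule SUP_top_inf_SUP_top_le[OF SUP_hom_rlt[OF f] SUP_hom_rlt[OF g]])
qed

lemma C_inf_relations:
  "real_relations (\<lambda>p. f (rgt p) \<sqinter> g (rgt p)) (\<lambda>q. f (rlt q) \<squnion> g (rlt q))"
proof (rule real_relationsI, goal_cases)
  case (1 p q)
  have "f (rgt p) \<sqinter> g (rgt p) \<sqinter> f (rlt q) \<le> f (rgt p) \<sqinter> f (rlt q)"
    "f (rgt p) \<sqinter> g (rgt p) \<sqinter> g (rlt q) \<le> g (rgt p) \<sqinter> g (rlt q)" by (simp_all add: le_infI1)
  then show ?case
    using 1 by (simp add: inf_sup_le_iff hom_rgt_inf_rlt[OF f] hom_rgt_inf_rlt[OF g])
next
  case (2 p q)
  show ?case
    by (rule sup_eq_top_le[OF hom_rgt_sup_rlt[OF f 2]];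
        rule sup_eq_top_le[OF hom_rgt_sup_rlt[OF g 2]])
       (simp_all add: le_supI1 le_supI2 le_infI1 le_infI2)
next
  case (3 p q)
  then show ?case using hom_rgt_antimono[OF f] hom_rgt_antimono[OF g] by (intro inf_mono) auto
next
  case (4 p)
  have "f (rgt r) \<sqinter> g (rgt s) \<le> (\<Squnion>q\<in>{q. q > p}. f (rgt q) \<sqinter> g (rgt q))" if "r > p" "s > p" for r s
    using that hom_rgt_antimono[OF f, of "min r s" r] hom_rgt_antimono[OF g, of "min r s" s]
    by (intro SUP_upper2[of "min r s"]) (simp_all add: le_infI1 le_infI2)
  then show ?case by - (rule SUP_inf_SUP_le[OF hom_rgt_eq[OF f] hom_rgt_eq[OF g]], simp)
next
  case (5 p q)
  then show ?case using hom_rlt_mono[OF f] hom_rlt_mono[OF g] by (intro sup_mono) auto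
next
  case (6 p)
  show ?case
    by (subst hom_rlt_eq[OF f], subst hom_rlt_eq[OF g])
       (auto simp: SUP_le_iff intro: SUP_upper2 le_supI1 le_supI2)
next
  case 7
  have "f (rgt r) \<sqinter> g (rgt s) \<le> (\<Squnion>q. f (rgt q) \<sqinter> g (rgt q))" for r s
    using hom_rgt_antimono[OF f, of "min r s" r] hom_rgt_antimono[OF g, of "min r s" s]
    by (intro SUP_upper2[of "min r s"]) (simp_all add: le_infI1 le_infI2)
  then show ?case
    by (rule SUP_top_inf_SUP_top_le[OF SUP_hom_rgt[OF f] SUP_hom_rgt[OF g]])
next
  case 8
  have "(\<Squnion>p. f (rlt p)) \<le> (\<Squnion>p. f (rlt p) \<squnion> g (rlt p))" by (intro SUP_subset_mono order_refl sup_ge1)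
  then show ?case by (simp add: SUP_hom_rlt[OF f])
qed

end

section \<open>Negation and positive scalar multiples\<close>

lemma C_uminus_relations:
  assumes f: "frame_hom f"
  shows "real_relations (\<lambda>p. f (rlt (- p))) (\<lambda>q. f (rgt (- q)))"
proof (rule real_relationsI, goal_cases)
  case (1 p q)
  then show ?case using hom_rgt_inf_rlt[OF f, of "- p" "- q"] by (simp add: inf.commute)
next
  case (2 p q)
  then show ?case using hom_rgt_sup_rlt[OF f, of "- q" "- p"] by (simp add: sup.commute)
next
  case (3 p q)
  then show ?case by (simp add: hom_rlt_mono[OF f])
next
  case (4 p)
  have "f (rlt r) \<le> (\<Squnion>q\<in>{q. q > p}. f (rlt (- q)))" if "r < - p" for r
    using that by (intro SUP_upper2[of "- r"]) auto
  then show ?case by (subst hom_rlt_eq[OF f]) (auto simp: SUP_le_iff)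
next
  case (5 p q)
  then show ?case by (simp add: hom_rgt_antimono[OF f])
next
  case (6 p)
  have "f (rgt r) \<le> (\<Squnion>q\<in>{q. q < p}. f (rgt (- q)))" if "r > - p" for r
    using that by (intro SUP_upper2[of "- r"]) auto
  then show ?case by (subst hom_rgt_eq[OF f]) (auto simp: SUP_le_iff)
next
  case 7
  have "f (rlt r) \<le> (\<Squnion>q. f (rlt (- q)))" for r
    by (intro SUP_upper2[of "- r"]) auto
  then show ?case by (subst SUP_hom_rlt[OF f, symmetric]) (auto simp: SUP_le_iff)
next
  case 8
  have "f (rgt r) \<le> (\<Squnion>q. f (rgt (- q)))" for r
    by (intro SUP_upper2[of "- r"]) auto
  then show ?case by (subst SUP_hom_rgt[OF f, symmetric]) (auto simp: SUP_le_iff)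
qed

lemma frame_hom_C_uminus: "frame_hom f \<Longrightarrow> frame_hom (C_uminus f)"
  unfolding C_uminus_def by (rule real_hom(1)[OF C_uminus_relations])

lemma C_uminus_rgt: "frame_hom f \<Longrightarrow> C_uminus f (rgt p) = f (rlt (- p))"
  and C_uminus_rlt: "frame_hom f \<Longrightarrow> C_uminus f (rlt p) = f (rgt (- p))"
  unfolding C_uminus_def by (simp_all add: real_hom[OF C_uminus_relations])

context
  fixes f :: "frame_of_reals \<Rightarrow> 'a::frame" and l :: real
  assumes f: "frame_hom f" and l: "l > 0"
begin

lemma C_scale_pos_relations:
  "real_relations (\<lambda>p. \<Squnion>r\<in>{r. of_rat p < l * of_rat r}. f (rgt r))
     (\<lambda>q. \<Squnion>s\<in>{s. l * of_rat s < of_rat q}. f (rlt s))"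
  (is "real_relations ?u ?v")
proof -
  have up: "f (rgt r) \<le> ?u p" if "of_rat p < l * of_rat r" for p r using that by (intro SUP_upper) auto
  have vp: "f (rlt r) \<le> ?v p" if "of_rat p > l * of_rat r" for p r using that by (intro SUP_upper) auto
  show ?thesis
  proof (rule real_relationsI, goal_cases)
    case (1 p q)
    have "f (rgt r) \<sqinter> f (rlt s) \<le> \<bottom>" if "l * of_rat r > of_rat p" "l * of_rat s < of_rat q" for r s
    proof -
      have "l * of_rat s < l * of_rat r"
        using that 1 of_rat_less_eq[of q p, where ?'a = real] by linarith
      then show ?thesis using l by (simp add: of_rat_less hom_rgt_inf_rlt[OF f])
    qed
    then show ?case by (simp add: SUP_inf_le_iff inf_SUP_le_iff)
  next
    case (2 p q)
    \<comment> \<open>The bounds \<open>p / l\<close> and \<open>q / l\<close> may be irrational,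
      and (r2) for \<open>f\<close> needs a strict gap; hence two rationals r < s are interpolated
      between them.\<close>
    then have "of_rat p / l < of_rat q / l" using l by (simp add: divide_strict_right_mono of_rat_less)
    then obtain r where r: "of_rat p / l < of_rat r" "of_rat r < of_rat q / l"
      using of_rat_dense by blast
    obtain s where s: "of_rat r < (of_rat s :: real)" "of_rat s < of_rat q / l"
      using of_rat_dense[OF r(2)] by blast
    have "f (rgt r) \<squnion> f (rlt s) = \<top>" using s by (intro hom_rgt_sup_rlt[OF f]) (simp add: of_rat_less)
    moreover have "f (rgt r) \<le> ?u p" using r l by (intro up) (simp add: field_simps)
    moreover have "f (rlt s) \<le> ?v q" using s l by (intro vp) (simp add: field_simps)
    ultimately show ?case by (metis sup_mono)
  next
    case (3 p q)
    then have "of_rat p < (of_rat q :: real)" by (simp add: of_rat_less)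
    then show ?case by (intro SUP_subset_mono) auto
  next
    case (4 p)
    have "f (rgt r) \<le> (\<Squnion>q\<in>{q. q > p}. ?u q)" if r: "l * of_rat r > of_rat p" for r
    proof -
      obtain q where "of_rat p < (of_rat q :: real)" "of_rat q < l * of_rat r"
        using of_rat_dense[OF r] by blast
      then show ?thesis by (intro SUP_upper2[of q] up) (auto simp: of_rat_less)
    qed
    then show ?case by (auto intro: SUP_least)
  next
    case (5 p q)
    then have "of_rat p < (of_rat q :: real)" by (simp add: of_rat_less)
    then show ?case by (intro SUP_subset_mono) auto
  next
    case (6 p)
    have "f (rlt r) \<le> (\<Squnion>q\<in>{q. q < p}. ?v q)" if r: "l * of_rat r < of_rat p" for r
    proof -
      obtain q where "of_rat q < (of_rat p :: real)" "of_rat q > l * of_rat r"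
        using of_rat_dense[OF r] by blast
      then show ?thesis by (intro SUP_upper2[of q] vp) (auto simp: of_rat_less)
    qed
    then show ?case by (auto intro: SUP_least)
  next
    case 7
    have "f (rgt r) \<le> (\<Squnion>p. ?u p)" for r
    proof -
      obtain p where "of_rat p < l * of_rat r" using of_rat_dense[of "l * of_rat r - 1" "l * of_rat r"] by auto
      then show ?thesis by (intro SUP_upper2[of p] up) auto
    qed
    then show ?case by (subst SUP_hom_rgt[OF f, symmetric]) (auto simp: SUP_le_iff)
  next
    case 8
    have "f (rlt r) \<le> (\<Squnion>p. ?v p)" for r
    proof -
      obtain p where "of_rat p > l * of_rat r" using of_rat_dense[of "l * of_rat r" "l * of_rat r + 1"] by auto
      then show ?thesis by (intro SUP_upper2[of p] vp) auto
    qed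
    then show ?case by (subst SUP_hom_rlt[OF f, symmetric]) (auto simp: SUP_le_iff)
  qed
qed

lemma frame_hom_C_scale_pos: "frame_hom (C_scale_pos l f)"
  using real_hom(1)[OF C_scale_pos_relations] by (simp add: C_scale_pos_def setcompr_eq_image)

lemma C_scale_pos_rgt: "C_scale_pos l f (rgt p) = (\<Squnion>r\<in>{r. of_rat p < l * of_rat r}. f (rgt r))"
  and C_scale_pos_rlt: "C_scale_pos l f (rlt p) = (\<Squnion>r\<in>{r. l * of_rat r < of_rat p}. f (rlt r))"
  using real_hom(2,3)[OF C_scale_pos_relations, of p] by (simp_all add: C_scale_pos_def setcompr_eq_image)

lemma C_scale_pos_rgt_le_iff:
  "C_scale_pos l f (rgt p) \<sqinter> c \<le> z \<longleftrightarrow> (\<forall>r. of_rat p < l * of_rat r \<longrightarrow> f (rgt r) \<sqinter> c \<le> z)"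
  by (simp add: C_scale_pos_rgt SUP_inf_le_iff)

end

section \<open>Vector space laws\<close>

lemma C_uminus_uminus: "frame_hom f \<Longrightarrow> C_uminus (C_uminus f) = f"
  by (rule C_eqI) (simp_all add: frame_hom_C_uminus C_uminus_rgt C_uminus_rlt)

lemma C_add_commute:
  assumes f: "frame_hom f" and g: "frame_hom g" shows "C_add f g = C_add g f"
proof (rule C_eqI[OF frame_hom_C_add[OF f g] frame_hom_C_add[OF g f]], rule eq_by_upper_bounds)
  fix p z
  show "C_add f g (rgt p) \<le> z \<longleftrightarrow> C_add g f (rgt p) \<le> z"
    using C_add_rgt_le_iff[OF f g, of p \<top> z] C_add_rgt_le_iff[OF g f, of p \<top> z]
    by simp (metis add.commute inf.commute)
qed

text \<open>The index \<open>u\<close> of the inner sum is eliminated by interpolating it between p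
  - t and r + s. The remaining condition is symmetric in the three summands, which is what
  associativity needs.\<close>

lemma C_add_add_rgt_le_iff:
  assumes f: "frame_hom f" and g: "frame_hom g" and h: "frame_hom h"
  shows "C_add (C_add f g) h (rgt p) \<le> z \<longleftrightarrow>
    (\<forall>r s t. p < r + s + t \<longrightarrow> f (rgt r) \<sqinter> g (rgt s) \<sqinter> h (rgt t) \<le> z)"
proof -
  have "C_add (C_add f g) h (rgt p) \<le> z \<longleftrightarrow>
      (\<forall>u t. p < u + t \<longrightarrow> C_add f g (rgt u) \<sqinter> h (rgt t) \<le> z)"
    using C_add_rgt_le_iff[OF frame_hom_C_add[OF f g] h, of p \<top> z] by simp
  also have "\<dots> \<longleftrightarrow> (\<forall>u t. p < u + t \<longrightarrow>
      (\<forall>r s. u < r + s \<longrightarrow> f (rgt r) \<sqinter> g (rgt s) \<sqinter> h (rgt t) \<le> z))"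
    by (simp add: C_add_rgt_le_iff[OF f g])
  also have "\<dots> \<longleftrightarrow> (\<forall>r s t. p < r + s + t \<longrightarrow> f (rgt r) \<sqinter> g (rgt s) \<sqinter> h (rgt t) \<le> z)"
  proof (intro iffI allI impI)
    fix r s t
    assume *: "\<forall>u t. p < u + t \<longrightarrow>
      (\<forall>r s. u < r + s \<longrightarrow> f (rgt r) \<sqinter> g (rgt s) \<sqinter> h (rgt t) \<le> z)" and p: "p < r + s + t"
    obtain u where "p - t < u" "u < r + s" using dense[of "p - t" "r + s"] p by auto
    then show "f (rgt r) \<sqinter> g (rgt s) \<sqinter> h (rgt t) \<le> z" using * by (simp add: algebra_simps)
  qed auto
  finally show ?thesis .
qed

lemma C_add_assoc:
  assumes f: "frame_hom f" and g: "frame_hom g" and h: "frame_hom h"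
  shows "C_add (C_add f g) h = C_add f (C_add g h)"
  unfolding C_add_commute[OF f frame_hom_C_add[OF g h]]
proof (rule C_eqI[OF frame_hom_C_add[OF frame_hom_C_add[OF f g] h]
      frame_hom_C_add[OF frame_hom_C_add[OF g h] f]], rule eq_by_upper_bounds)
  fix p z
  show "C_add (C_add f g) h (rgt p) \<le> z \<longleftrightarrow> C_add (C_add g h) f (rgt p) \<le> z"
    unfolding C_add_add_rgt_le_iff[OF f g h] C_add_add_rgt_le_iff[OF g h f]
    by (auto simp: ac_simps)
qed

lemma C_add_zero:
  assumes f: "frame_hom f" shows "C_add f C_zero = f"
proof (rule C_eqI[OF frame_hom_C_add[OF f frame_hom_C_zero] f], rule eq_by_upper_bounds)
  fix p z
  have "C_add f C_zero (rgt p) \<le> z \<longleftrightarrow> (\<forall>r s. p < r + s \<longrightarrow> f (rgt r) \<sqinter> C_zero (rgt s) \<le> z)"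
    using C_add_rgt_le_iff[OF f frame_hom_C_zero, of p \<top> z] by simp
  also have "\<dots> \<longleftrightarrow> (\<forall>r>p. f (rgt r) \<le> z)"
  proof (intro iffI allI impI)
    fix r assume *: "\<forall>r s. p < r + s \<longrightarrow> f (rgt r) \<sqinter> C_zero (rgt s) \<le> z" and r: "p < r"
    \<comment> \<open>The index (p - r)/2 is negative, so the zero function takes the value \<top>
      there, and it is still large enough that adding r stays above p.\<close>
    then have "p < r + (p - r) / 2" "(p - r) / 2 < 0" by (simp_all add: field_simps)
    with * have "f (rgt r) \<sqinter> C_zero (rgt ((p - r) / 2)) \<le> z" by blast
    then show "f (rgt r) \<le> z" using r by (simp add: C_zero_rgt)
  qed (auto simp: C_zero_rgt)
  also have "\<dots> \<longleftrightarrow> f (rgt p) \<le> z" by (subst (2) hom_rgt_eq[OF f]) (simp add: SUP_le_iff)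
  finally show "C_add f C_zero (rgt p) \<le> z \<longleftrightarrow> f (rgt p) \<le> z" .
qed

text \<open>At p the sum is the join of the meets of f(r,-) and f(-,r - p). For p < 0 these are
  preimages of all intervals of length -p, hence a cover; for p \<ge> 0 each of them is
  empty.\<close>

lemma C_add_uminus:
  assumes f: "frame_hom f" shows "C_add f (C_uminus f) = C_zero"
proof (rule C_eqI[OF frame_hom_C_add[OF f frame_hom_C_uminus[OF f]] frame_hom_C_zero])
  fix p
  have eq: "C_add f (C_uminus f) (rgt p) = (\<Squnion>r. f (rgt r) \<sqinter> f (rlt (r - p)))"
    by (simp add: C_add_rgt[OF f frame_hom_C_uminus[OF f]] C_uminus_rgt[OF f])
  show "C_add f (C_uminus f) (rgt p) = C_zero (rgt p)"
    unfolding eq C_zero_rgt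
    using SUP_hom_rgt_inf_rlt[OF f, of "- p"] hom_rgt_inf_rlt[OF f]
    by (auto simp: bot_unique[symmetric] SUP_le_iff)
qed

lemma C_add_mono:
  assumes f: "frame_hom f" and g: "frame_hom g" and h: "frame_hom h" and le: "C_le f g"
  shows "C_le (C_add f h) (C_add g h)"
proof (rule C_leI[OF frame_hom_C_add[OF f h] frame_hom_C_add[OF g h]])
  show "C_add f h (rgt p) \<le> C_add g h (rgt p)" for p
    using le unfolding C_add_rgt[OF f h] C_add_rgt[OF g h]
    by (intro SUP_subset_mono order_refl inf_mono) (auto simp: C_le_def)
qed

lemmas C_closed = frame_hom_C_zero frame_hom_C_add frame_hom_C_uminus frame_hom_C_scale_pos

lemma C_add_left_cancel:
  assumes "frame_hom f" "frame_hom g" "frame_hom h" "C_add f g = C_add f h" shows "g = h"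
proof -
  have "C_add (C_uminus f) (C_add f x) = x" if "frame_hom x" for x
    using that assms(1) by (metis C_add_assoc C_add_commute C_add_uminus C_add_zero frame_hom_C_uminus frame_hom_C_zero)
  then show ?thesis using assms by metis
qed

lemma C_uminus_unique:
  assumes "frame_hom f" "frame_hom g" "C_add f g = C_zero" shows "C_uminus f = g"
  using assms C_add_left_cancel[of f "C_uminus f" g] by (simp add: C_closed C_add_uminus)

lemma C_uminus_add:
  assumes f: "frame_hom f" and g: "frame_hom g"
  shows "C_uminus (C_add f g) = C_add (C_uminus f) (C_uminus g)"
proof (rule C_uminus_unique)
  have "C_add (C_add f g) (C_add (C_uminus f) (C_uminus g))
      = C_add (C_add f (C_uminus f)) (C_add g (C_uminus g))"
    using f g C_closed by (smt (verit) C_add_assoc C_add_commute)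
  then show "C_add (C_add f g) (C_add (C_uminus f) (C_uminus g)) = C_zero"
    using f g by (simp add: C_add_uminus C_add_zero C_closed)
qed (use f g in \<open>simp_all add: C_closed\<close>)

lemma C_uminus_zero: "C_uminus C_zero = C_zero"
  by (rule C_uminus_unique) (simp_all add: C_closed C_add_zero)

lemma C_add_scale_pos_rgt_le_iff:
  assumes f: "frame_hom f" and l: "l > 0" and g: "frame_hom g" and m: "m > 0"
  shows "C_add (C_scale_pos l f) (C_scale_pos m g) (rgt p) \<le> z \<longleftrightarrow>
    (\<forall>t u. p < t + u \<longrightarrow> (\<forall>a. of_rat t < l * of_rat a \<longrightarrow>
      (\<forall>b. of_rat u < m * of_rat b \<longrightarrow> f (rgt a) \<sqinter> g (rgt b) \<le> z)))"
  using C_add_rgt_le_iff[OF frame_hom_C_scale_pos[OF f l] frame_hom_C_scale_pos[OF g m], of p \<top> z]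
  by (simp add: C_scale_pos_rgt[OF f l] C_scale_pos_rgt[OF g m] SUP_inf_le_iff inf_SUP_le_iff) blast

context
  fixes f :: "frame_of_reals \<Rightarrow> 'a::frame" and l :: real
  assumes f: "frame_hom f" and l: "l > 0"
begin

lemma C_scale_pos_add:
  assumes g: "frame_hom g"
  shows "C_scale_pos l (C_add f g) = C_add (C_scale_pos l f) (C_scale_pos l g)"
proof (rule C_eqI[OF frame_hom_C_scale_pos[OF frame_hom_C_add[OF f g] l]
      frame_hom_C_add[OF frame_hom_C_scale_pos[OF f l] frame_hom_C_scale_pos[OF g l]]],
      rule eq_by_upper_bounds)
  fix p z
  \<comment> \<open>Both sides are reduced to this condition, in which no auxiliary rational index
    occurs; such indices are reinserted by the density of the rationals.\<close>
  let ?P = "\<forall>a b. of_rat p < l * of_rat (a + b) \<longrightarrow> f (rgt a) \<sqinter> g (rgt b) \<le> z"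
  have "C_scale_pos l (C_add f g) (rgt p) \<le> z \<longleftrightarrow>
    (\<forall>r. of_rat p < l * of_rat r \<longrightarrow> (\<forall>a b. r < a + b \<longrightarrow> f (rgt a) \<sqinter> g (rgt b) \<le> z))"
    using C_scale_pos_rgt_le_iff[OF frame_hom_C_add[OF f g] l, of p \<top> z]
      C_add_rgt_le_iff[OF f g, of _ \<top> z] by simp
  also have "\<dots> \<longleftrightarrow> ?P"
  proof (intro iffI allI impI)
    fix a b assume *: "\<forall>r. of_rat p < l * of_rat r \<longrightarrow>
      (\<forall>a b. r < a + b \<longrightarrow> f (rgt a) \<sqinter> g (rgt b) \<le> z)" and ab: "of_rat p < l * of_rat (a + b)"
    then have "of_rat p / l < of_rat (a + b)" using l by (simp add: field_simps)
    then obtain r where "of_rat p / l < of_rat r" "of_rat r < (of_rat (a + b) :: real)"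
      using of_rat_dense by blast
    then show "f (rgt a) \<sqinter> g (rgt b) \<le> z" using * l by (simp add: of_rat_less field_simps)
  next
    fix r a b assume "?P" "of_rat p < l * of_rat r" "r < a + b"
    moreover have "l * of_rat r < l * of_rat (a + b)"
      using \<open>r < a + b\<close> l by (simp add: of_rat_less)
    ultimately show "f (rgt a) \<sqinter> g (rgt b) \<le> z" by (meson less_trans)
  qed
  also have "\<dots> \<longleftrightarrow> (\<forall>t u. p < t + u \<longrightarrow> (\<forall>a. of_rat t < l * of_rat a \<longrightarrow>
      (\<forall>b. of_rat u < l * of_rat b \<longrightarrow> f (rgt a) \<sqinter> g (rgt b) \<le> z)))"
  proof (intro iffI allI impI)
    fix t u a b assume "?P" and *: "p < t + u" "of_rat t < l * of_rat a" "of_rat u < l * of_rat b"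
    have "(of_rat p :: real) < of_rat t + of_rat u" using * by (simp add: of_rat_less flip: of_rat_add)
    then have "of_rat p < l * of_rat (a + b)" using * by (simp add: of_rat_add distrib_left)
    then show "f (rgt a) \<sqinter> g (rgt b) \<le> z" using \<open>?P\<close> by blast
  next
    fix a b assume *: "\<forall>t u. p < t + u \<longrightarrow> (\<forall>a. of_rat t < l * of_rat a \<longrightarrow>
      (\<forall>b. of_rat u < l * of_rat b \<longrightarrow> f (rgt a) \<sqinter> g (rgt b) \<le> z))"
      and ab: "of_rat p < l * of_rat (a + b)"
    then have "of_rat p - l * of_rat b < l * of_rat a" by (simp add: of_rat_add distrib_left)
    then obtain t where t: "of_rat p - l * of_rat b < of_rat t" "of_rat t < l * of_rat a"
      using of_rat_dense by blast
    then have "of_rat p - of_rat t < l * of_rat b" by simp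
    then obtain u where u: "of_rat p - of_rat t < (of_rat u :: real)" "of_rat u < l * of_rat b"
      using of_rat_dense by blast
    then have "(of_rat p :: real) < of_rat (t + u)" by (simp add: of_rat_add)
    then have "p < t + u" by (simp only: of_rat_less)
    then show "f (rgt a) \<sqinter> g (rgt b) \<le> z" using * t u by blast
  qed
  also have "\<dots> \<longleftrightarrow> C_add (C_scale_pos l f) (C_scale_pos l g) (rgt p) \<le> z"
    by (simp add: C_add_scale_pos_rgt_le_iff[OF f l g l])
  finally show "C_scale_pos l (C_add f g) (rgt p) \<le> z \<longleftrightarrow>
    C_add (C_scale_pos l f) (C_scale_pos l g) (rgt p) \<le> z" .
qed

lemma C_scale_pos_plus:
  assumes m: "m > 0"
  shows "C_scale_pos (l + m) f = C_add (C_scale_pos l f) (C_scale_pos m f)"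
proof (rule C_eqI[OF frame_hom_C_scale_pos[OF f add_pos_pos[OF l m]]
      frame_hom_C_add[OF frame_hom_C_scale_pos[OF f l] frame_hom_C_scale_pos[OF f m]]],
      rule eq_by_upper_bounds)
  fix p z
  let ?P = "\<forall>r. of_rat p < (l + m) * of_rat r \<longrightarrow> f (rgt r) \<le> z"
  have "C_scale_pos (l + m) f (rgt p) \<le> z \<longleftrightarrow> ?P"
    using C_scale_pos_rgt_le_iff[OF f add_pos_pos[OF l m], of p \<top> z] by simp
  also have "\<dots> \<longleftrightarrow> (\<forall>t u. p < t + u \<longrightarrow> (\<forall>a. of_rat t < l * of_rat a \<longrightarrow>
      (\<forall>b. of_rat u < m * of_rat b \<longrightarrow> f (rgt a) \<sqinter> f (rgt b) \<le> z)))"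
  proof (intro iffI allI impI)
    fix t u a b assume "?P" and *: "p < t + u" "of_rat t < l * of_rat a" "of_rat u < m * of_rat b"
    \<comment> \<open>Both scalars are positive, so replacing \<open>a\<close> and \<open>b\<close>
      by the larger one only increases the weighted sum, and \<open>f\<close> at the larger index is
      one of the two factors of the meet.\<close>
    let ?c = "max a b"
    have "(of_rat p :: real) < of_rat t + of_rat u" using * by (simp add: of_rat_less flip: of_rat_add)
    moreover have "l * of_rat a \<le> l * of_rat ?c" "m * of_rat b \<le> m * of_rat ?c"
      using l m by (simp_all add: of_rat_less_eq)
    ultimately have "of_rat p < (l + m) * of_rat ?c" using * by (simp add: distrib_right)
    then have "f (rgt ?c) \<le> z" using \<open>?P\<close> by blast
    then show "f (rgt a) \<sqinter> f (rgt b) \<le> z" by (auto simp: max_def le_infI1 le_infI2 split: if_splits)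
  next
    fix a assume *: "\<forall>t u. p < t + u \<longrightarrow> (\<forall>a. of_rat t < l * of_rat a \<longrightarrow>
      (\<forall>b. of_rat u < m * of_rat b \<longrightarrow> f (rgt a) \<sqinter> f (rgt b) \<le> z))"
      and ab: "of_rat p < (l + m) * of_rat a"
    then have "of_rat p - m * of_rat a < l * of_rat a" by (simp add: distrib_right)
    then obtain t where t: "of_rat p - m * of_rat a < of_rat t" "of_rat t < l * of_rat a"
      using of_rat_dense by blast
    then have "of_rat p - of_rat t < m * of_rat a" by simp
    then obtain u where u: "of_rat p - of_rat t < (of_rat u :: real)" "of_rat u < m * of_rat a"
      using of_rat_dense by blast
    then have "(of_rat p :: real) < of_rat (t + u)" by (simp add: of_rat_add)
    then have "p < t + u" by (simp only: of_rat_less)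
    then have "f (rgt a) \<sqinter> f (rgt a) \<le> z" using * t u by blast
    then show "f (rgt a) \<le> z" by simp
  qed
  also have "\<dots> \<longleftrightarrow> C_add (C_scale_pos l f) (C_scale_pos m f) (rgt p) \<le> z"
    by (simp add: C_add_scale_pos_rgt_le_iff[OF f l f m])
  finally show "C_scale_pos (l + m) f (rgt p) \<le> z \<longleftrightarrow>
    C_add (C_scale_pos l f) (C_scale_pos m f) (rgt p) \<le> z" .
qed

lemma C_scale_pos_scale_pos:
  assumes m: "m > 0"
  shows "C_scale_pos m (C_scale_pos l f) = C_scale_pos (m * l) f"
proof (rule C_eqI[OF frame_hom_C_scale_pos[OF frame_hom_C_scale_pos[OF f l] m]
      frame_hom_C_scale_pos[OF f mult_pos_pos[OF m l]]], rule eq_by_upper_bounds)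
  fix p z
  have "C_scale_pos m (C_scale_pos l f) (rgt p) \<le> z \<longleftrightarrow>
    (\<forall>r. of_rat p < m * of_rat r \<longrightarrow> (\<forall>s. of_rat r < l * of_rat s \<longrightarrow> f (rgt s) \<le> z))"
    using C_scale_pos_rgt_le_iff[OF frame_hom_C_scale_pos[OF f l] m, of p \<top> z]
      C_scale_pos_rgt_le_iff[OF f l, of _ \<top> z] by simp
  also have "\<dots> \<longleftrightarrow> (\<forall>s. of_rat p < m * l * of_rat s \<longrightarrow> f (rgt s) \<le> z)"
  proof (intro iffI allI impI)
    fix s assume *: "\<forall>r. of_rat p < m * of_rat r \<longrightarrow> (\<forall>s. of_rat r < l * of_rat s \<longrightarrow> f (rgt s) \<le> z)"
      and s: "of_rat p < m * l * of_rat s"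
    then have "of_rat p / m < l * of_rat s" using m by (simp add: field_simps)
    then obtain r where "of_rat p / m < of_rat r" "of_rat r < l * of_rat s" using of_rat_dense by blast
    then show "f (rgt s) \<le> z" using * m by (simp add: field_simps)
  next
    fix r s assume *: "\<forall>s. of_rat p < m * l * of_rat s \<longrightarrow> f (rgt s) \<le> z"
      "of_rat p < m * of_rat r" "of_rat r < l * of_rat s"
    have "m * of_rat r < m * (l * of_rat s)" using m *(3) by simp
    then show "f (rgt s) \<le> z" using * by (simp add: mult.assoc)
  qed
  also have "\<dots> \<longleftrightarrow> C_scale_pos (m * l) f (rgt p) \<le> z"
    using C_scale_pos_rgt_le_iff[OF f mult_pos_pos[OF m l], of p \<top> z] by simp
  finally show "C_scale_pos m (C_scale_pos l f) (rgt p) \<le> z \<longleftrightarrow> C_scale_pos (m * l) f (rgt p) \<le> z" .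
qed

lemma C_scale_pos_uminus: "C_scale_pos l (C_uminus f) = C_uminus (C_scale_pos l f)"
proof (rule C_eqI)
  fix p
  have "C_scale_pos l (C_uminus f) (rgt p) = (\<Squnion>r\<in>{r. of_rat p < l * of_rat r}. f (rlt (- r)))"
    by (simp add: C_scale_pos_rgt[OF frame_hom_C_uminus[OF f] l] C_uminus_rgt[OF f])
  also have "\<dots> = (\<Squnion>r\<in>{r. l * of_rat r < of_rat (- p)}. f (rlt r))"
  proof (rule SUP_eq)
    show "\<exists>j\<in>{r. l * of_rat r < of_rat (- p)}. f (rlt (- i)) \<le> f (rlt j)"
      if "i \<in> {r. of_rat p < l * of_rat r}" for i
      using that by (intro bexI[of _ "- i"]) (auto simp: of_rat_minus)
    show "\<exists>i\<in>{r. of_rat p < l * of_rat r}. f (rlt j) \<le> f (rlt (- i))"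
      if "j \<in> {r. l * of_rat r < of_rat (- p)}" for j
      using that by (intro bexI[of _ "- j"]) (auto simp: of_rat_minus)
  qed
  also have "\<dots> = C_uminus (C_scale_pos l f) (rgt p)"
    by (simp add: C_uminus_rgt[OF frame_hom_C_scale_pos[OF f l]] C_scale_pos_rlt[OF f l])
  finally show "C_scale_pos l (C_uminus f) (rgt p) = C_uminus (C_scale_pos l f) (rgt p)" .
qed (use f l in \<open>simp_all add: C_closed\<close>)

end

lemma C_scale_pos_one:
  assumes f: "frame_hom f" shows "C_scale_pos 1 f = f"
proof (rule C_eqI)
  show "C_scale_pos 1 f (rgt p) = f (rgt p)" for p
    using hom_rgt_eq[OF f, of p] by (simp add: C_scale_pos_rgt[OF f] of_rat_less)
qed (use f in \<open>simp_all add: C_closed\<close>)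

text \<open>Additivity makes the scaled zero idempotent under \<open>C_add\<close>, and cancellation
  leaves only zero.\<close>

lemma C_scale_pos_zero:
  assumes l: "l > 0" shows "C_scale_pos l C_zero = (C_zero :: frame_of_reals \<Rightarrow> 'a::frame)"
proof (rule C_add_left_cancel)
  let ?x = "C_scale_pos l C_zero :: frame_of_reals \<Rightarrow> 'a"
  show "C_add ?x ?x = C_add ?x C_zero"
    using C_scale_pos_add[of C_zero l C_zero, symmetric] l by (simp add: C_closed C_add_zero)
qed (use l in \<open>simp_all add: C_closed\<close>)

lemma frame_hom_C_scale: "frame_hom f \<Longrightarrow> frame_hom (C_scale l f)"
  by (simp add: C_scale_def C_closed)

lemma C_scale_zero: "C_scale 0 f = C_zero"
  by (simp add: C_scale_def)

lemma C_scale_uminus_left: "frame_hom f \<Longrightarrow> C_scale (- l) f = C_uminus (C_scale l f)"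
  by (simp add: C_scale_def C_uminus_zero C_uminus_uminus C_closed)

lemma C_scale_scale:
  fixes f :: "frame_of_reals \<Rightarrow> 'a::frame"
  assumes f: "frame_hom f" shows "C_scale l (C_scale m f) = C_scale (l * m) f"
proof -
  have *: "C_scale l (C_scale m f) = C_scale (l * m) f" if "l > 0" "m > 0" for l m
    using that by (simp add: C_scale_def C_scale_pos_scale_pos[OF f])
  have right: "C_scale l (C_uminus g) = C_uminus (C_scale l g)" if "frame_hom g" for l and g :: "frame_of_reals \<Rightarrow> 'a"
    using that by (simp add: C_scale_def C_uminus_zero C_scale_pos_uminus)
  have zero: "C_scale l C_zero = (C_zero :: frame_of_reals \<Rightarrow> 'a)" for l
    by (simp add: C_scale_def C_scale_pos_zero C_uminus_zero)
  have pos: "C_scale l (C_scale m f) = C_scale (l * m) f" if "l > 0" for l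
  proof (cases m "0 :: real" rule: linorder_cases)
    case less
    then show ?thesis
      using *[OF that, of "- m"] f
      by (simp add: C_scale_uminus_left right frame_hom_C_scale frame_hom_C_uminus)
         (metis C_uminus_uminus frame_hom_C_scale)
  qed (use that * zero in \<open>auto simp: C_scale_zero\<close>)
  show ?thesis
  proof (cases l "0 :: real" rule: linorder_cases)
    case less
    then show ?thesis
      using pos[of "- l"] f
      by (simp add: C_scale_uminus_left frame_hom_C_scale) (metis C_uminus_uminus frame_hom_C_scale)
  qed (use pos in \<open>auto simp: C_scale_zero\<close>)
qed

text \<open>Scaling is defined by the sign of the scalar, so the positive case has to be extended.
  For opposite signs with m < l, cancel \<open>S m\<close> from the decomposition of
  \<open>S l\<close> into \<open>S (l - m)\<close> and \<open>S m\<close>; the reverse order follows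
  by negation.\<close>

lemma C_scale_plus:
  assumes f: "frame_hom f" shows "C_scale (l + m) f = C_add (C_scale l f) (C_scale m f)"
proof -
  define S where "S l = C_scale l f" for l
  have S: "frame_hom (S l)" for l by (simp add: S_def frame_hom_C_scale[OF f])
  have minus: "S (- l) = C_uminus (S l)" for l by (simp add: S_def C_scale_uminus_left[OF f])
  have zero: "S 0 = C_zero" by (simp add: S_def C_scale_zero)
  have pos: "S (l + m) = C_add (S l) (S m)" if "l > 0" "m > 0" for l m
    using that by (simp add: S_def C_scale_def C_scale_pos_plus[OF f])
  have less: "S (l - m) = C_add (S l) (S (- m))" if "0 < m" "m < l" for l m
  proof -
    have "C_add (S l) (S (- m)) = C_add (C_add (S (l - m)) (S m)) (S (- m))"
      using pos[of "l - m" m] that by simp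
    also have "\<dots> = S (l - m)"
      by (simp add: C_add_assoc C_add_zero C_add_uminus S minus frame_hom_C_uminus)
    finally show ?thesis ..
  qed
  have diff: "S (l - m) = C_add (S l) (S (- m))" if "0 < m" "0 < l" for l m
  proof (cases l m rule: linorder_cases)
    case less
    have "S (l - m) = C_uminus (S (m - l))" using minus[of "m - l"] by simp
    also have "\<dots> = C_add (S (- m)) (S l)"
      using \<open>\<And>m l. \<lbrakk>0 < m; m < l\<rbrakk> \<Longrightarrow> _\<close>[of l m] less that
      by (simp add: C_uminus_add S C_uminus_uminus minus frame_hom_C_uminus)
    finally show ?thesis by (simp add: C_add_commute S)
  qed (use that less in \<open>auto simp: zero minus C_add_uminus S\<close>)
  have neg: "S (l + m) = C_add (S l) (S m)" if "l < 0" "m < 0" for l m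
  proof -
    have "S (l + m) = C_uminus (S (- l + - m))" using minus[of "- l + - m"] by (simp add: add.commute)
    also have "\<dots> = C_add (C_uminus (S (- l))) (C_uminus (S (- m)))"
      using pos[of "- l" "- m"] that by (simp add: C_uminus_add S)
    also have "\<dots> = C_add (S l) (S m)" using minus[of "- l"] minus[of "- m"] by simp
    finally show ?thesis .
  qed
  have "S (l + m) = C_add (S l) (S m)"
  proof (cases l "0 :: real" rule: linorder_cases)
    case l: less
    show ?thesis
    proof (cases m "0 :: real" rule: linorder_cases)
      case greater
      then show ?thesis using diff[of "- l" m] l by (simp add: C_add_commute[OF S S, of l m] add.commute)
    qed (use l neg in \<open>auto simp: zero C_add_zero S\<close>)
  next
    case equal
    then show ?thesis by (simp add: zero C_add_commute[OF frame_hom_C_zero S] C_add_zero[OF S])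
  next
    case l: greater
    show ?thesis
    proof (cases m "0 :: real" rule: linorder_cases)
      case less
      then show ?thesis using diff[of "- m" l] l by simp
    qed (use l pos in \<open>auto simp: zero C_add_zero S\<close>)
  qed
  then show ?thesis by (simp add: S_def)
qed

lemma C_scale_add:
  assumes "frame_hom f" "frame_hom g"
  shows "C_scale l (C_add f g) = C_add (C_scale l f) (C_scale l g)"
  using assms by (simp add: C_scale_def C_scale_pos_add C_add_zero C_uminus_add C_closed)

lemma C_scale_nonneg:
  assumes f: "frame_hom f" and l: "0 \<le> l" and le: "C_le C_zero f"
  shows "C_le C_zero (C_scale l f)"
proof (cases "l = 0")
  case False
  then have l: "l > 0" using l by simp
  have "\<top> \<le> C_scale_pos l f (rgt p)" if "p < 0" for p
  proof -
    have "of_rat p / l < 0" using that l by (simp add: field_simps)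
    then obtain r where r: "of_rat p / l < of_rat r" "of_rat r < (0::real)" using of_rat_dense by blast
    have "\<top> \<le> f (rgt r)" using le r by (auto simp: C_le_def C_zero_rgt split: if_splits)
    also have "\<dots> \<le> C_scale_pos l f (rgt p)"
      unfolding C_scale_pos_rgt[OF f l] using r l by (intro SUP_upper) (simp add: field_simps)
    finally show ?thesis .
  qed
  then show ?thesis
    using l by (intro C_leI) (simp_all add: C_scale_def C_closed f C_zero_rgt)
qed (simp add: C_scale_zero C_le_def)

section \<open>The Riesz space structure and its functoriality in the frame\<close>

lemma C_riesz_simps [simp]:
  "carrier (C_riesz L) = {f. frame_hom f}" "rzero (C_riesz L) = C_zero" "radd (C_riesz L) = C_add"
  "rscale (C_riesz L) = C_scale" "rle (C_riesz L) = C_le"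
  by (simp_all add: C_riesz_def)

lemma C_le_refl: "C_le f f"
  by (simp add: C_le_def)

text \<open>A \<open>riesz\<close> record carries only an order; \<open>C_sup\<close> and
  \<open>C_inf\<close> are explicit witnesses for its binary bounds.\<close>

definition C_sup :: "(frame_of_reals \<Rightarrow> 'a::frame) \<Rightarrow> (frame_of_reals \<Rightarrow> 'a) \<Rightarrow> frame_of_reals \<Rightarrow> 'a" where
  "C_sup f g = real_hom (\<lambda>p. f (rgt p) \<squnion> g (rgt p)) (\<lambda>q. f (rlt q) \<sqinter> g (rlt q))"

definition C_inf :: "(frame_of_reals \<Rightarrow> 'a::frame) \<Rightarrow> (frame_of_reals \<Rightarrow> 'a) \<Rightarrow> frame_of_reals \<Rightarrow> 'a" where
  "C_inf f g = real_hom (\<lambda>p. f (rgt p) \<sqinter> g (rgt p)) (\<lambda>q. f (rlt q) \<squnion> g (rlt q))"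

lemma riesz_lub_C_sup:
  assumes f: "frame_hom f" and g: "frame_hom g"
  shows "riesz_lub (C_riesz L) {f, g} (C_sup f g)"
  using real_hom[OF C_sup_relations[OF f g]]
  unfolding riesz_lub_def C_sup_def by (auto simp: C_le_iff f g)

lemma riesz_glb_C_inf:
  assumes f: "frame_hom f" and g: "frame_hom g"
  shows "riesz_glb (C_riesz L) {f, g} (C_inf f g)"
  using real_hom[OF C_inf_relations[OF f g]]
  unfolding riesz_glb_def C_inf_def by (auto simp: C_le_iff f g)

lemma riesz_space_C_riesz: "riesz_space (C_riesz L)"
proof (unfold_locales, goal_cases)
  case (7 f)
  then show ?case by (auto intro!: exI[of _ "C_uminus f"] simp: C_add_uminus C_closed)
next
  case (14 f g)
  then show ?case using C_eqI[of f g] by (auto simp: C_le_def intro: antisym)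
next
  case (17 f g)
  then show ?case using riesz_lub_C_sup by auto
next
  case (18 f g)
  then show ?case using riesz_glb_C_inf by auto
next
  case (5 f g)
  then show ?case by (simp add: C_add_commute)
next
  case (13 f g h)
  then show ?case by (auto simp: C_le_def intro: order_trans)
next
  case (11 f)
  then show ?case by (simp add: C_scale_def C_scale_pos_one)
qed (simp_all add: C_closed frame_hom_C_scale C_add_assoc C_add_zero C_scale_add C_scale_plus
    C_scale_scale C_add_mono C_scale_nonneg C_le_refl)

text \<open>On upper generators every operation is built from joins and finite meets, or from a
  generator of the other kind for negation, and a frame homomorphism preserves all of these. It
  serves both for \<beta> and for isomorphisms of frames.\<close>

lemma riesz_hom_pointwise:
  fixes k :: "'a::frame \<Rightarrow> 'b::frame" and L :: "'a itself" and M :: "'b itself"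
  assumes k: "frame_hom k"
  shows "riesz_hom (C_riesz L) (C_riesz M) (\<lambda>f x. k (f x))"
proof -
  note kc = frame_hom_comp[OF k] and ks = frame_hom_Sup[OF k] frame_hom_inf[OF k] image_image
  have uminus: "(\<lambda>x. k (C_uminus f x)) = C_uminus (\<lambda>x. k (f x))" if f: "frame_hom f" for f
    by (rule C_eqI) (simp_all add: kc C_closed f C_uminus_rgt)
  have zero: "(\<lambda>x. k (C_zero x)) = C_zero"
    by (rule C_eqI) (simp_all add: kc C_closed C_zero_rgt frame_hom_top[OF k] frame_hom_bot[OF k])
  have pos: "(\<lambda>x. k (C_scale_pos l f x)) = C_scale_pos l (\<lambda>x. k (f x))"
    if f: "frame_hom f" and l: "l > 0" for f l
    by (rule C_eqI) (simp_all add: kc C_closed f l C_scale_pos_rgt ks)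
  interpret L: riesz_space "C_riesz L" by (rule riesz_space_C_riesz)
  show ?thesis
    unfolding riesz_hom_def
  proof (intro conjI ballI allI impI)
    fix f assume "f \<in> carrier (C_riesz L)"
    then have f: "frame_hom f" by simp
    show "(\<lambda>x. k (f x)) \<in> carrier (C_riesz M)" by (simp add: kc f)
    show "(\<lambda>x. k (rscale (C_riesz L) l f x)) = rscale (C_riesz M) l (\<lambda>x. k (f x))" for l
      by (auto simp: C_scale_def uminus zero pos f frame_hom_C_scale_pos)
    fix g assume "g \<in> carrier (C_riesz L)"
    then have g: "frame_hom g" by simp
    show "(\<lambda>x. k (radd (C_riesz L) f g x)) = radd (C_riesz M) (\<lambda>x. k (f x)) (\<lambda>x. k (g x))"
      by (simp, rule C_eqI) (simp_all add: kc C_closed f g C_add_rgt ks)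
    fix s
    {
      assume "riesz_lub (C_riesz L) {f, g} s"
      \<comment> \<open>\<open>riesz_hom\<close> speaks of every least upper bound, so uniqueness
        first replaces \<open>s\<close> by the explicit one.\<close>
      then have s: "s = C_sup f g" using L.lub_unique riesz_lub_C_sup[OF f g] by blast
      note rel = C_sup_relations[OF f g] C_sup_relations[OF kc[OF f] kc[OF g]]
      have "(\<lambda>x. k (C_sup f g x)) = C_sup (\<lambda>x. k (f x)) (\<lambda>x. k (g x))"
        by (rule C_eqI) (simp_all add: C_sup_def kc real_hom rel frame_hom_sup[OF k])
      then show "riesz_lub (C_riesz M) {\<lambda>x. k (f x), \<lambda>x. k (g x)} (\<lambda>x. k (s x))"
        using riesz_lub_C_sup[OF kc[OF f] kc[OF g]] s by simp
    }
    {
      assume "riesz_glb (C_riesz L) {f, g} s"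
      then have s: "s = C_inf f g" using L.glb_unique riesz_glb_C_inf[OF f g] by blast
      note rel = C_inf_relations[OF f g] C_inf_relations[OF kc[OF f] kc[OF g]]
      have "(\<lambda>x. k (C_inf f g x)) = C_inf (\<lambda>x. k (f x)) (\<lambda>x. k (g x))"
        by (rule C_eqI) (simp_all add: C_inf_def kc real_hom rel frame_hom_inf[OF k])
      then show "riesz_glb (C_riesz M) {\<lambda>x. k (f x), \<lambda>x. k (g x)} (\<lambda>x. k (s x))"
        using riesz_glb_C_inf[OF kc[OF f] kc[OF g]] s by simp
    }
  qed
qed

lemma frame_hom_inv:
  assumes k: "frame_hom k" "bij k" shows "frame_hom (inv k)"
proof (rule frame_homI)
  have inj: "inj k" and kk: "k (inv k x) = x" for x
    using k(2) by (simp_all add: bij_is_inj bij_is_surj surj_f_inv_f)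
  note eq = injD[OF inj]
  show "inv k \<top> = \<top>" by (rule eq) (simp add: kk frame_hom_top[OF k(1)])
  show "inv k (a \<sqinter> b) = inv k a \<sqinter> inv k b" for a b
    by (rule eq) (simp add: kk frame_hom_inf[OF k(1)])
  show "inv k (\<Squnion>A) = \<Squnion>(inv k ` A)" for A
    by (rule eq) (simp add: kk frame_hom_Sup[OF k(1)] image_image)
qed

lemma riesz_isomorphic_C_riesz:
  fixes L :: "'a::frame itself" and M :: "'b::frame itself"
  assumes "frame_isomorphic L M"
  shows "riesz_isomorphic (C_riesz L) (C_riesz M)"
proof -
  obtain k :: "'a \<Rightarrow> 'b" where k: "frame_hom k" "bij k"
    using assms by (auto simp: frame_isomorphic_def)
  have inv: "inv k (k x) = x" "k (inv k y) = y" for x y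
    using k(2) by (simp_all add: bij_is_inj bij_is_surj surj_f_inv_f)
  have "bij_betw (\<lambda>f x. k (f x)) (carrier (C_riesz L)) (carrier (C_riesz M))"
    by (rule bij_betw_byWitness[where f' = "\<lambda>f x. inv k (f x)"])
       (auto simp: inv frame_hom_comp[OF k(1)] frame_hom_comp[OF frame_hom_inv[OF k]])
  then show ?thesis unfolding riesz_isomorphic_def using riesz_hom_pointwise[OF k(1)] by blast
qed

lemma C_nonneg_iff: "frame_hom f \<Longrightarrow> C_le C_zero f \<longleftrightarrow> (\<forall>p<0. f (rgt p) = \<top>)"
  by (simp add: C_le_iff frame_hom_C_zero C_zero_rgt top_unique)

section \<open>Universal completeness over Boolean frames\<close>

text \<open>The inner join is \<open>pcompl a\<close> written out, so the axiom is excluded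
  middle.\<close>

class boolean_frame = frame +
  assumes sup_Sup_disjoint: "a \<squnion> \<Squnion>{b. a \<sqinter> b = \<bottom>} = \<top>"

lemma sup_pcompl: "a \<squnion> pcompl a = (\<top>::'a::boolean_frame)"
  unfolding pcompl_def by (rule sup_Sup_disjoint)

instance booleanization :: (frame) boolean_frame
proof
  fix a :: "'a booleanization"
  let ?c = "booleanize (pcompl (of_bool_frame a))"
  have "a \<sqinter> ?c = \<bottom>" by transfer (simp add: inf_pcompl)
  then have "a \<squnion> ?c \<le> a \<squnion> \<Squnion>{b. a \<sqinter> b = \<bottom>}"
    by (intro sup_mono order_refl Sup_upper) simp
  \<comment> \<open>In the underlying frame the join of an element with its pseudocomplement is only
    dense; the join of the Booleanization closes it up to \<top>.\<close>
  moreover have "a \<squnion> ?c = \<top>"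
  proof transfer
    fix a :: 'a
    have "pcompl (a \<squnion> pcompl a) \<le> pcompl a \<sqinter> pcompl (pcompl a)"
      by (simp add: pcompl_antimono)
    then have "pcompl (a \<squnion> pcompl a) = \<bottom>" by (simp add: inf_pcompl bot_unique)
    then show "pcompl (pcompl (a \<squnion> pcompl (pcompl (pcompl a)))) = \<top>" by simp
  qed
  ultimately show "a \<squnion> \<Squnion>{b. a \<sqinter> b = \<bottom>} = \<top>" by (simp add: top_unique)
qed

text \<open>The double pseudocomplement of \<open>b\<close> misses \<open>pcompl b\<close>, and
  \<open>pcompl b\<close> together with \<open>a\<close> covers; so it lies inside
  \<open>a\<close>.\<close>

lemma rather_below_pcompl_pcompl_le: "rather_below b a \<Longrightarrow> pcompl (pcompl b) \<le> (a::'a::frame)"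
  unfolding rather_below_def
  by (erule sup_eq_top_le) (simp_all add: inf_pcompl inf.commute[of _ "pcompl b"])

lemma rather_below_le: "rather_below b a \<Longrightarrow> b \<le> (a::'a::frame)"
  using rather_below_pcompl_pcompl_le le_pcompl_pcompl order_trans by blast

lemma rather_below_rgt:
  assumes f: "frame_hom f" and pq: "p < q" shows "rather_below (f (rgt q)) (f (rgt p))"
proof -
  have "f (rlt q) \<le> pcompl (f (rgt q))"
    by (simp add: le_pcompl_iff hom_rgt_inf_rlt[OF f])
  then have "f (rgt p) \<squnion> f (rlt q) \<le> pcompl (f (rgt q)) \<squnion> f (rgt p)"
    by (simp add: le_supI1)
  then show ?thesis by (simp add: rather_below_def hom_rgt_sup_rlt[OF f pq] top_unique)
qed

text \<open>The point-free form of Urysohn's construction: \<open>D\<close> is a scale, with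
  \<open>D r\<close> approximating the region where the function exceeds r. Joins over strictly
  larger or smaller indices make (r3) and (r4) automatic, \<open>rather_below\<close> between levels
  gives (r2), and the two \<open>top\<close> conditions express finiteness.\<close>

lemma rather_below_relations:
  fixes D :: "rat \<Rightarrow> 'a::frame"
  assumes D: "\<And>r s. r < s \<Longrightarrow> rather_below (D s) (D r)"
    and top: "(\<Squnion>r. D r) = \<top>" "(\<Squnion>r. pcompl (D r)) = \<top>"
  shows "real_relations (\<lambda>p. \<Squnion>r\<in>{r. r > p}. D r) (\<lambda>q. \<Squnion>s\<in>{s. s < q}. pcompl (D s))"
    (is "real_relations ?u ?v")
proof (rule real_relationsI, goal_cases)
  have le: "D s \<le> D r" if "r \<le> s" for r s
    using that rather_below_le[OF D, of r s] by (cases "r = s") auto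
  case (1 p q)
  have "D r \<sqinter> pcompl (D s) \<le> \<bottom>" if "p < r" "s < q" for r s
    using le[of s r] inf_mono[of "D r" "D s" "pcompl (D s)" "pcompl (D s)"] that 1
    by (simp add: inf_pcompl)
  then show ?case by (simp add: SUP_inf_le_iff inf_SUP_le_iff)
next
  case (2 p q)
  obtain r where r: "p < r" "r < q" using dense[OF 2] by blast
  obtain s where s: "r < s" "s < q" using dense[OF r(2)] by blast
  have "D r \<le> ?u p" "pcompl (D s) \<le> ?v q" using r s by (auto intro: SUP_upper)
  then have "D r \<squnion> pcompl (D s) \<le> ?u p \<squnion> ?v q" by (rule sup_mono)
  moreover have "D r \<squnion> pcompl (D s) = \<top>"
    using D[OF s(1)] by (simp add: rather_below_def sup.commute)
  ultimately show ?case by (simp only:)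
next
  case (4 p)
  have "D r \<le> (\<Squnion>q\<in>{q. q > p}. ?u q)" if "p < r" for r
  proof -
    obtain q where "p < q" "q < r" using dense \<open>p < r\<close> by blast
    then show ?thesis by (intro SUP_upper2[of q] SUP_upper) auto
  qed
  then show ?case by (simp add: SUP_le_iff)
next
  case (6 p)
  have "pcompl (D r) \<le> (\<Squnion>q\<in>{q. q < p}. ?v q)" if "r < p" for r
  proof -
    obtain q where "r < q" "q < p" using dense \<open>r < p\<close> by blast
    then show ?thesis by (intro SUP_upper2[of q] SUP_upper) auto
  qed
  then show ?case by (simp add: SUP_le_iff)
next
  case 7
  have "D r \<le> (\<Squnion>p. ?u p)" for r by (intro SUP_upper2[of "r - 1"] SUP_upper) auto
  then show ?case unfolding top(1)[symmetric] by (simp add: SUP_le_iff)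
next
  case 8
  have "pcompl (D r) \<le> (\<Squnion>p. ?v p)" for r by (intro SUP_upper2[of "r + 1"] SUP_upper) auto
  then show ?case unfolding top(2)[symmetric] by (simp add: SUP_le_iff)
qed (auto intro!: SUP_subset_mono)

text \<open>Excluded middle turns D s \<le> D r into \<open>rather_below\<close>, so the pointwise
  join is a scale. The hypothesis \<open>top\<close> says that this join is finite from above;
  finiteness from below is inherited from any member of \<open>A\<close>.\<close>

lemma riesz_lub_pointwise:
  fixes A :: "(frame_of_reals \<Rightarrow> 'a::boolean_frame) set"
  assumes A: "A \<subseteq> carrier (C_riesz L)" "A \<noteq> {}"
    and top: "(\<Squnion>s. pcompl (\<Squnion>f\<in>A. f (rgt s))) = \<top>"
  shows "\<exists>s. riesz_lub (C_riesz L) A s"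
proof -
  define D where "D s = (\<Squnion>f\<in>A. f (rgt s))" for s
  have hom: "frame_hom f" if "f \<in> A" for f using A(1) that by auto
  have le: "D s \<le> D r" if "r < s" for r s
    unfolding D_def using that by (intro SUP_subset_mono order_refl hom_rgt_antimono hom) auto
  have rb: "rather_below (D s) (D r)" if "r < s" for r s
  proof -
    have "D s \<squnion> pcompl (D s) \<le> pcompl (D s) \<squnion> D r" using le[OF that] by (simp add: le_supI2)
    then show ?thesis by (simp add: rather_below_def sup_pcompl top_unique)
  qed
  obtain f where f: "f \<in> A" using A(2) by blast
  have "(\<Squnion>r. f (rgt r)) \<le> (\<Squnion>r. D r)"
    unfolding D_def using f by (intro SUP_subset_mono order_refl SUP_upper)
  then have D_top: "(\<Squnion>r. D r) = \<top>" by (simp add: SUP_hom_rgt[OF hom[OF f]] top_unique)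
  note rel = rather_below_relations[OF rb D_top top[folded D_def]]
  define h where "h = real_hom (\<lambda>p. \<Squnion>r\<in>{r. r > p}. D r) (\<lambda>q. \<Squnion>s\<in>{s. s < q}. pcompl (D s))"
  have h: "frame_hom h" unfolding h_def by (rule real_hom[OF rel])
  \<comment> \<open>The regularised join in the scale construction changes nothing: after exchanging
    the joins, (r3) for each member of \<open>A\<close> removes the inner one.\<close>
  have h_rgt: "h (rgt p) = (\<Squnion>f\<in>A. f (rgt p))" for p
  proof -
    have "h (rgt p) = (\<Squnion>r\<in>{r. r > p}. D r)" unfolding h_def by (rule real_hom[OF rel])
    also have "\<dots> = (\<Squnion>f\<in>A. \<Squnion>r\<in>{r. r > p}. f (rgt r))" unfolding D_def by (rule SUP_commute)
    also have "\<dots> = (\<Squnion>f\<in>A. f (rgt p))" by (intro SUP_cong refl) (simp add: hom_rgt_eq[OF hom, of _ p])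
    finally show ?thesis .
  qed
  have "riesz_lub (C_riesz L) A h"
    unfolding riesz_lub_def
    by (auto simp: h hom C_le_iff h_rgt SUP_le_iff intro: SUP_upper)
  then show ?thesis by blast
qed

text \<open>A positive function is \<top> at every negative level and decreases from level 0 on, so
  the infimum is zero as soon as its cozero element vanishes.\<close>

lemma C_riesz_disjoint_iff:
  assumes f: "frame_hom f" and g: "frame_hom g" and pos: "C_le C_zero f" "C_le C_zero g"
  shows "riesz_glb (C_riesz L) {f, g} C_zero \<longleftrightarrow> f (rgt 0) \<sqinter> g (rgt 0) = \<bottom>"
proof -
  interpret riesz_space "C_riesz L" by (rule riesz_space_C_riesz)
  note inf = real_hom[OF C_inf_relations[OF f g], folded C_inf_def]
  have "riesz_glb (C_riesz L) {f, g} C_zero \<longleftrightarrow> C_inf f g = C_zero"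
    using glb_unique riesz_glb_C_inf[OF f g] by metis
  also have "\<dots> \<longleftrightarrow> f (rgt 0) \<sqinter> g (rgt 0) = \<bottom>"
  proof
    assume "C_inf f g = C_zero"
    then have "C_inf f g (rgt 0) = \<bottom>" by (simp add: C_zero_rgt)
    then show "f (rgt 0) \<sqinter> g (rgt 0) = \<bottom>" by (simp add: inf)
  next
    assume *: "f (rgt 0) \<sqinter> g (rgt 0) = \<bottom>"
    show "C_inf f g = C_zero"
    proof (rule C_eqI[OF inf(1) frame_hom_C_zero])
      fix p
      show "C_inf f g (rgt p) = C_zero (rgt p)"
      proof (cases "p < 0")
        case True
        then have "f (rgt p) = \<top>" "g (rgt p) = \<top>"
          using pos by (simp_all add: C_nonneg_iff f g)
        then show ?thesis using True by (simp add: inf C_zero_rgt)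
      next
        case False
        then have "f (rgt p) \<sqinter> g (rgt p) \<le> f (rgt 0) \<sqinter> g (rgt 0)"
          by (intro inf_mono hom_rgt_antimono f g) auto
        then show ?thesis using False * by (simp add: inf C_zero_rgt bot_unique)
      qed
    qed
  qed
  finally show ?thesis .
qed

lemma universally_complete_C_riesz:
  fixes L :: "'a::boolean_frame itself"
  shows "universally_complete (C_riesz L)"
  unfolding universally_complete_def
proof (intro conjI riesz_space_C_riesz)
  show "dedekind_complete (C_riesz L)"
    unfolding dedekind_complete_def
  proof (intro allI impI, elim conjE bexE)
    fix A b assume A: "A \<subseteq> carrier (C_riesz L)" "A \<noteq> {}"
      and b: "b \<in> carrier (C_riesz L)" "\<forall>a\<in>A. rle (C_riesz L) a b"
    \<comment> \<open>The upper bound \<open>b\<close> supplies finiteness: where \<open>b\<close>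
      is below s, no member of \<open>A\<close> exceeds s, and the elements b(-,s) already join to
      \<top>.\<close>
    have "b (rlt s) \<le> pcompl (\<Squnion>f\<in>A. f (rgt s))" for s
    proof -
      have "(\<Squnion>f\<in>A. f (rgt s)) \<le> b (rgt s)" using b(2) by (auto simp: C_le_def intro: SUP_least)
      then have "pcompl (b (rgt s)) \<le> pcompl (\<Squnion>f\<in>A. f (rgt s))" by (rule pcompl_antimono)
      moreover have "b (rlt s) \<le> pcompl (b (rgt s))"
        using b(1) by (simp add: le_pcompl_iff hom_rgt_inf_rlt)
      ultimately show ?thesis by simp
    qed
    then have "(\<Squnion>s. b (rlt s)) \<le> (\<Squnion>s. pcompl (\<Squnion>f\<in>A. f (rgt s)))"
      by (intro SUP_subset_mono order_refl)
    then have "(\<Squnion>s. pcompl (\<Squnion>f\<in>A. f (rgt s))) = \<top>"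
      using b(1) by (simp add: SUP_hom_rlt top_unique)
    then show "\<exists>s. riesz_lub (C_riesz L) A s" by (rule riesz_lub_pointwise[OF A])
  qed
  show "laterally_complete (C_riesz L)"
    unfolding laterally_complete_def
  proof (intro allI impI, elim conjE)
    fix A assume A: "A \<subseteq> carrier (C_riesz L)" "A \<noteq> {}"
      and pos: "\<forall>a\<in>A. rle (C_riesz L) (rzero (C_riesz L)) a"
      and disj: "\<forall>a\<in>A. \<forall>b\<in>A. a \<noteq> b \<longrightarrow> riesz_glb (C_riesz L) {a, b} (rzero (C_riesz L))"
    define D where "D s = (\<Squnion>f\<in>A. f (rgt s))" for s
    \<comment> \<open>\<open>w\<close> is the part on which the pointwise join would be infinite,
      since it lies below every \<open>D s\<close>. Inside f(0,-) the other members vanish, so there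
      \<open>D s\<close> agrees with the finite function \<open>f\<close>. Hence \<open>w\<close>
      misses every f(0,-), and so it misses \<open>D 0\<close>, which contains it.\<close>
    define w where "w = pcompl (\<Squnion>s. pcompl (D s))"
    have hom: "frame_hom f" if "f \<in> A" for f using A(1) that by auto
    have w_le: "w \<le> D s" for s
    proof (rule sup_eq_top_le[OF sup_pcompl[of "D s"]])
      have "w \<sqinter> pcompl (D s) \<le> w \<sqinter> (\<Squnion>s. pcompl (D s))"
        by (intro inf_mono order_refl SUP_upper) simp
      then show "w \<sqinter> pcompl (D s) \<le> D s"
        by (simp add: w_def inf.commute inf_pcompl bot_unique)
    qed simp
    have "w \<sqinter> f (rgt 0) \<le> \<bottom>" if f: "f \<in> A" for f
    proof -
      have le: "w \<sqinter> f (rgt 0) \<le> f (rgt s)" if s: "0 \<le> s" for s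
      proof -
        have "g (rgt s) \<sqinter> f (rgt 0) \<le> f (rgt s)" if g: "g \<in> A" for g
        proof (cases "g = f")
          case False
          then have "g (rgt 0) \<sqinter> f (rgt 0) = \<bottom>"
            using C_riesz_disjoint_iff[of g f L] disj pos f g hom by auto
          moreover have "g (rgt s) \<sqinter> f (rgt 0) \<le> g (rgt 0) \<sqinter> f (rgt 0)"
            using s by (intro inf_mono hom_rgt_antimono hom f g) auto
          ultimately show ?thesis by (simp add: bot_unique)
        qed simp
        then have "D s \<sqinter> f (rgt 0) \<le> f (rgt s)" by (simp add: D_def SUP_inf_le_iff)
        then show ?thesis using inf_mono[OF w_le[of s] order_refl[of "f (rgt 0)"]] order_trans by blast
      qed
      show ?thesis
      proof (rule SUP_eq_top_le[OF SUP_hom_rlt[OF hom[OF f]]])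
        fix s :: rat
        \<comment> \<open>The comparison \<open>le\<close> holds only at nonnegative levels, so
          level s is replaced by \<open>max 0 s\<close>, which still clashes with f(-,s).\<close>
        have "(w \<sqinter> f (rgt 0)) \<sqinter> f (rlt s) \<le> f (rgt (max 0 s)) \<sqinter> f (rlt s)"
          by (rule inf_mono[OF le]) simp_all
        then show "(w \<sqinter> f (rgt 0)) \<sqinter> f (rlt s) \<le> \<bottom>"
          by (simp add: hom_rgt_inf_rlt[OF hom[OF f]])
      qed
    qed
    then have "w \<sqinter> D 0 \<le> \<bottom>" by (simp add: D_def inf_SUP_le_iff)
    then have "w = \<bottom>" using w_le[of 0] by (simp add: inf.absorb1 bot_unique)
    then have "(\<Squnion>s. pcompl (D s)) = \<top>"
      using sup_pcompl[of "\<Squnion>s. pcompl (D s)"] by (simp add: w_def)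
    then show "\<exists>s. riesz_lub (C_riesz L) A s" unfolding D_def by (rule riesz_lub_pointwise[OF A])
  qed
qed

section \<open>Density of the continuous functions\<close>

text \<open>A bump function of height \<open>q\<close>: it reaches \<open>q\<close> on
  \<open>a\<close> and vanishes outside \<open>b\<close>. The free height allows it to be fitted
  under a given function.\<close>

lemma completely_below_function:
  fixes a b :: "'a::frame"
  assumes "completely_below a b" and q: "0 < q"
  shows "\<exists>g. frame_hom g \<and> C_le C_zero g \<and> (\<forall>p<q. a \<le> g (rgt p)) \<and>
    (\<forall>p\<ge>q. g (rgt p) = \<bottom>) \<and> (\<forall>p\<ge>0. g (rgt p) \<le> b)"
proof -
  obtain c :: "rat \<Rightarrow> 'a" where c: "a \<le> c 0" "c 1 \<le> b"
      "\<And>r s. 0 \<le> r \<Longrightarrow> r < s \<Longrightarrow> s \<le> 1 \<Longrightarrow> rather_below (c r) (c s)"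
    using assms(1) unfolding completely_below_def by blast
  \<comment> \<open>The interpolating family increases over [0,1] while a scale must decrease over
    [0,q]; \<open>1 - t / q\<close> reverses and rescales the index. The values \<top> below 0 and
    \<bottom> above \<open>q\<close> bound the function by 0 and \<open>q\<close>.\<close>
  define D where "D t = (if t < 0 then \<top> else if t \<le> q then c (1 - t / q) else \<bottom>)" for t
  have rb: "rather_below (D s) (D r)" if "r < s" for r s
  proof -
    consider "r < 0" | "q < s" | "0 \<le> r" "s \<le> q" by fastforce
    then show ?thesis
    proof cases
      case 3
      then show ?thesis using that q c(3)[of "1 - s / q" "1 - r / q"]
        by (simp add: D_def divide_strict_right_mono)
    qed (use that q in \<open>simp_all add: D_def rather_below_def\<close>)
  qed
  have c_le: "c r \<le> c s" if "0 \<le> r" "r \<le> s" "s \<le> 1" for r s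
    using c(3)[of r s] that rather_below_le by (cases "r = s") auto
  have "D (-1) = \<top>" "D (q + 1) = \<bottom>" using q by (simp_all add: D_def)
  then have top: "(\<Squnion>r. D r) = \<top>" "(\<Squnion>r. pcompl (D r)) = \<top>"
    using SUP_upper[of "-1" UNIV D] SUP_upper[of "q + 1" UNIV "\<lambda>r. pcompl (D r)"]
    by (simp_all add: top_unique)
  note rel = rather_below_relations[OF rb top]
  define g where "g = real_hom (\<lambda>p. \<Squnion>r\<in>{r. r > p}. D r) (\<lambda>q. \<Squnion>s\<in>{s. s < q}. pcompl (D s))"
  have g: "frame_hom g" and g_rgt: "g (rgt p) = (\<Squnion>r\<in>{r. r > p}. D r)" for p
    unfolding g_def by (simp_all only: real_hom[OF rel])
  have ge: "a \<le> g (rgt p)" if p: "p < q" for p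
  proof -
    obtain r where r: "max p 0 < r" "r < q" using dense[of "max p 0" q] p q by auto
    have "c 0 \<le> D r" using c_le[of 0 "1 - r / q"] r q by (simp add: D_def)
    then have "a \<le> D r" by (rule order_trans[OF c(1)])
    also have "\<dots> \<le> g (rgt p)" unfolding g_rgt using r by (intro SUP_upper) simp
    finally show ?thesis .
  qed
  have zero: "g (rgt p) = \<bottom>" if "p \<ge> q" for p
    unfolding g_rgt bot_unique[symmetric] using that q by (auto simp: D_def intro!: SUP_least)
  have le: "g (rgt p) \<le> b" if "p \<ge> 0" for p
    unfolding g_rgt
  proof (rule SUP_least)
    fix r assume "r \<in> {r. p < r}"
    then have "D r \<le> c 1" using that q c_le[of "1 - r / q" 1] by (simp add: D_def)
    then show "D r \<le> b" using c(2) by (rule order_trans)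
  qed
  have "\<top> \<le> g (rgt p)" if p: "p < 0" for p
  proof -
    obtain r where r: "p < r" "r < 0" using dense[OF p] by blast
    then show ?thesis unfolding g_rgt by (intro SUP_upper2[of r]) (auto simp: D_def)
  qed
  then have "C_le C_zero g"
    by (intro C_leI[OF frame_hom_C_zero g]) (simp add: C_zero_rgt)
  then show ?thesis using g ge zero le by blast
qed

text \<open>For p < q the comparison in the Booleanization bounds f(q,-) by the double
  pseudocomplement of g(q,-), which lies below g(p,-) because g(q,-) is rather below g(p,-). This is
  the injectivity of \<beta> on functions.\<close>

lemma C_le_of_booleanize_le:
  assumes f: "frame_hom f" and g: "frame_hom g"
    and le: "\<And>p. booleanize (f (rgt p)) \<le> booleanize (g (rgt p))"
  shows "C_le f g"
proof (rule C_leI[OF f g])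
  fix p
  have "f (rgt q) \<le> g (rgt p)" if "p < q" for q
  proof -
    have "f (rgt q) \<le> pcompl (pcompl (f (rgt q)))" by (rule le_pcompl_pcompl)
    also have "\<dots> \<le> pcompl (pcompl (g (rgt q)))"
      using le[of q] by (simp add: less_eq_booleanization.rep_eq booleanize.rep_eq)
    also have "\<dots> \<le> g (rgt p)"
      by (rule rather_below_pcompl_pcompl_le[OF rather_below_rgt[OF g that]])
    finally show ?thesis .
  qed
  then show "f (rgt p) \<le> g (rgt p)" by (simp add: hom_rgt_eq[OF f, of p] SUP_le_iff)
qed

lemma booleanize_of_bool_frame: "booleanize (of_bool_frame b) = b"
  using of_bool_frame[of b] by transfer simp

text \<open>The substance is density. For 0 \<le> p < q, bumps of height q supported in f(q,-) stay
  below f: at levels between 0 and q they are bounded by f(q,-), hence by f there. Their values at p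
  join to at least f(q,-), so every upper bound h satisfies f(q,-) \<le> h(p,-).\<close>

lemma universal_completion_booleanization:
  fixes L :: "'a::frame itself"
  assumes cr: "completely_regular L"
  shows "universal_completion (C_riesz L) (C_riesz TYPE('a booleanization)) (\<lambda>f x. booleanize (f x))"
    (is "universal_completion ?R ?U ?\<mu>")
  unfolding universal_completion_def riesz_embedding_def
proof (intro conjI ballI impI)
  note \<beta> = frame_hom_booleanize
  show "universally_complete ?U" by (rule universally_complete_C_riesz)
  show "riesz_hom ?R ?U ?\<mu>" by (rule riesz_hom_pointwise[OF \<beta>])
  show "inj_on ?\<mu> (carrier ?R)"
  proof (rule inj_onI)
    fix f g assume "f \<in> carrier ?R" "g \<in> carrier ?R" and eq: "?\<mu> f = ?\<mu> g"
    then have fg: "frame_hom f" "frame_hom g" by simp_all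
    have "C_le f g" "C_le g f"
      using fg fun_cong[OF eq] by (auto intro!: C_le_of_booleanize_le)
    then show "f = g" using C_eqI[OF fg] by (auto simp: C_le_def intro: antisym)
  qed
  fix f assume "f \<in> carrier ?U" and pos: "rle ?U (rzero ?U) f"
  then have f: "frame_hom f" by simp
  let ?A = "{?\<mu> g |g. g \<in> carrier ?R \<and> rle ?U (rzero ?U) (?\<mu> g) \<and> rle ?U (?\<mu> g) f}"
  show "riesz_lub ?U ?A f"
    unfolding riesz_lub_def
  proof (intro conjI ballI impI)
    show "f \<in> carrier ?U" by (simp add: f)
    show "rle ?U a f" if "a \<in> ?A" for a using that by auto
    fix h assume "h \<in> carrier ?U" and ub: "\<forall>a\<in>?A. rle ?U a h"
    then have h: "frame_hom h" by simp
    have ub: "booleanize (g (rgt p)) \<le> h (rgt p)"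
      if "frame_hom g" "C_le C_zero g" "C_le (?\<mu> g) f" for g p
    proof -
      have "C_le C_zero (?\<mu> g)"
        using that(2)
        by (simp add: C_nonneg_iff that(1) frame_hom_comp[OF \<beta>] frame_hom_top[OF \<beta>])
      then have "?\<mu> g \<in> ?A" using that by auto
      then show ?thesis using ub by (auto simp: C_le_def)
    qed
    have f_top: "f (rgt t) = \<top>" if "t < 0" for t
      using pos that by (simp add: C_nonneg_iff[OF f])
    have "f (rgt p) \<le> h (rgt p)" for p
    proof (cases "p < 0")
      case True
      \<comment> \<open>At negative levels the zero function alone forces the upper bound
        \<open>h\<close> to be \<top>.\<close>
      have "C_le (\<lambda>x. booleanize (C_zero x :: 'a)) f"
        using f_top by (intro C_leI[OF frame_hom_comp[OF \<beta> frame_hom_C_zero] f])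
          (simp add: C_zero_rgt frame_hom_bot[OF \<beta>])
      then have "booleanize (C_zero (rgt p) :: 'a) \<le> h (rgt p)"
        by (intro ub frame_hom_C_zero C_le_refl)
      then show ?thesis using True by (simp add: C_zero_rgt frame_hom_top[OF \<beta>] top_unique)
    next
      case False
      have "f (rgt q) \<le> h (rgt p)" if q: "p < q" for q
      proof -
        \<comment> \<open>Complete regularity is a property of \<open>L\<close>, so the level set is
          read there as a regular element and written as the join of the elements completely below
          it; applying \<beta> returns to the Booleanization.\<close>
        define b where "b = of_bool_frame (f (rgt q))"
        have "booleanize a \<le> h (rgt p)" if a: "completely_below a b" for a
        proof -
          obtain g where g: "frame_hom g" "C_le C_zero g" "\<forall>p<q. a \<le> g (rgt p)"
              "\<forall>p\<ge>q. g (rgt p) = \<bottom>" "\<forall>p\<ge>0. g (rgt p) \<le> b"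
            using completely_below_function[OF a, of q] q False by auto
          have "booleanize (g (rgt t)) \<le> f (rgt t)" for t
          proof -
            consider "t < 0" | "q \<le> t" | "0 \<le> t" "t \<le> q" by fastforce
            then show ?thesis
            proof cases
              case 3
              then have "booleanize (g (rgt t)) \<le> booleanize b"
                using g(5) by (intro frame_hom_mono[OF \<beta>]) simp
              also have "\<dots> \<le> f (rgt t)"
                using hom_rgt_antimono[OF f 3(2)] by (simp add: b_def booleanize_of_bool_frame)
              finally show ?thesis .
            qed (use g(4) f_top in \<open>auto simp: frame_hom_bot[OF \<beta>]\<close>)
          qed
          then have "C_le (?\<mu> g) f" by (intro C_leI[OF frame_hom_comp[OF \<beta> g(1)] f])
          then have "booleanize (g (rgt p)) \<le> h (rgt p)" by (rule ub[OF g(1,2)])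
          moreover have "booleanize a \<le> booleanize (g (rgt p))"
            using g(3) q by (intro frame_hom_mono[OF \<beta>]) simp
          ultimately show ?thesis by simp
        qed
        then have "(\<Squnion>a\<in>{a. completely_below a b}. booleanize a) \<le> h (rgt p)"
          by (auto intro: SUP_least)
        then have "booleanize (\<Squnion>{a. completely_below a b}) \<le> h (rgt p)"
          by (simp add: frame_hom_Sup[OF \<beta>])
        moreover have "\<Squnion>{a. completely_below a b} = b"
          using cr by (simp add: completely_regular_def)
        ultimately show ?thesis by (simp add: b_def booleanize_of_bool_frame)
      qed
      then show ?thesis by (simp add: hom_rgt_eq[OF f, of p] SUP_le_iff)
    qed
    then show "rle ?U f h" by (simp add: C_leI[OF f h])
  qed
qed

section \<open>Hausdorff continuous functions\<close>

lemma booleanize_SUP_of_bool_frame: "booleanize (\<Squnion>i\<in>I. of_bool_frame (F i)) = (\<Squnion>i\<in>I. F i)"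
  by (simp add: frame_hom_Sup[OF frame_hom_booleanize] image_image booleanize_of_bool_frame)

lemma of_bool_frame_booleanize: "of_bool_frame (booleanize a) = pcompl (pcompl a)"
  by (rule booleanize.rep_eq)

lemma pcompl_sup: "pcompl (a \<squnion> b) = pcompl a \<sqinter> pcompl (b::'a::frame)"
proof (rule antisym)
  have "a \<sqinter> (pcompl a \<sqinter> pcompl b) \<le> a \<sqinter> pcompl a" "b \<sqinter> (pcompl a \<sqinter> pcompl b) \<le> b \<sqinter> pcompl b"
    by (simp_all add: le_infI2)
  then show "pcompl a \<sqinter> pcompl b \<le> pcompl (a \<squnion> b)"
    unfolding le_pcompl_iff bot_unique[symmetric] by (simp add: sup_inf_le_iff inf_pcompl)
qed (simp add: pcompl_antimono)

text \<open>A cover in the Booleanization is merely a dense join in the frame: the two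
  pseudocomplements are disjoint. Regularity of \<open>b\<close> turns this into the stated
  inequality.\<close>

lemma pcompl_of_bool_frame_le:
  assumes "a \<squnion> b = \<top>" shows "pcompl (of_bool_frame a) \<le> of_bool_frame b"
proof -
  have "pcompl (pcompl (of_bool_frame a \<squnion> of_bool_frame b)) = \<top>"
    using arg_cong[OF assms, of of_bool_frame]
    by (simp add: sup_booleanization.rep_eq top_booleanization.rep_eq)
  then have "pcompl (of_bool_frame a) \<sqinter> pcompl (of_bool_frame b) = \<bottom>"
    by (metis pcompl3 pcompl_sup pcompl_top)
  then have "pcompl (of_bool_frame a) \<le> pcompl (pcompl (of_bool_frame b))"
    by (simp add: le_pcompl_iff inf.commute)
  also have "\<dots> = of_bool_frame b" using of_bool_frame[of b] by simp
  finally show ?thesis .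
qed

context
  fixes g :: "frame_of_reals \<Rightarrow> 'a::frame booleanization"
  assumes g: "frame_hom g"
begin

text \<open>Joins in \<open>L\<close> and in the Booleanization differ, so (r3) and (r4) for
  \<open>g\<close> do not transfer directly. Joining over strictly larger or smaller rationals
  restores them by density.\<close>

lemma H_Delta_relations:
  "ireal_relations (\<lambda>p. \<Squnion>r\<in>{r. r > p}. of_bool_frame (g (rgt r)))
     (\<lambda>q. \<Squnion>s\<in>{s. s < q}. of_bool_frame (g (rlt s)))"
  (is "ireal_relations ?u ?v")
  unfolding ireal_relations_def
proof (intro conjI allI impI)
  fix p q :: rat assume pq: "p \<ge> q"
  have "of_bool_frame (g (rgt r)) \<sqinter> of_bool_frame (g (rlt s)) \<le> \<bottom>" if "p < r" "s < q" for r s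
    using that pq hom_rgt_inf_rlt[OF g, of s r]
    by (simp add: inf_booleanization.rep_eq[symmetric] bot_booleanization.rep_eq)
  then show "?u p \<sqinter> ?v q = \<bottom>"
    by (simp add: bot_unique[symmetric] SUP_inf_le_iff inf_SUP_le_iff)
next
  fix p
  show "?u p = (\<Squnion>q\<in>{q. q > p}. ?u q)"
  proof (rule antisym)
    have "of_bool_frame (g (rgt r)) \<le> (\<Squnion>q\<in>{q. q > p}. ?u q)" if r: "p < r" for r
    proof -
      obtain q where "p < q" "q < r" using dense[OF r] by blast
      then show ?thesis by (intro SUP_upper2[of q] SUP_upper) auto
    qed
    then show "?u p \<le> (\<Squnion>q\<in>{q. q > p}. ?u q)" by (simp add: SUP_le_iff)
  qed (auto intro!: SUP_least intro: SUP_upper)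
  show "?v p = (\<Squnion>q\<in>{q. q < p}. ?v q)"
  proof (rule antisym)
    have "of_bool_frame (g (rlt r)) \<le> (\<Squnion>q\<in>{q. q < p}. ?v q)" if r: "r < p" for r
    proof -
      obtain q where "r < q" "q < p" using dense[OF r] by blast
      then show ?thesis by (intro SUP_upper2[of q] SUP_upper) auto
    qed
    then show "?v p \<le> (\<Squnion>q\<in>{q. q < p}. ?v q)" by (simp add: SUP_le_iff)
  qed (auto intro!: SUP_least intro: SUP_upper)
qed

lemma frame_hom_H_Delta: "frame_hom (H_Delta g)"
  and H_Delta_igt: "H_Delta g (igt p) = (\<Squnion>r\<in>{r. r > p}. of_bool_frame (g (rgt r)))"
  and H_Delta_ilt: "H_Delta g (ilt q) = (\<Squnion>s\<in>{s. s < q}. of_bool_frame (g (rlt s)))"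
  unfolding H_Delta_def by (rule ireal_hom[OF H_Delta_relations])+

text \<open>\<beta> takes the joins of \<open>L\<close> to joins of the Booleanization, where (r3)
  and (r4) for \<open>g\<close> collapse them.\<close>

lemma booleanize_H_Delta:
  "booleanize (H_Delta g (igt p)) = g (rgt p)" "booleanize (H_Delta g (ilt p)) = g (rlt p)"
  unfolding H_Delta_igt H_Delta_ilt booleanize_SUP_of_bool_frame
  by (simp_all add: hom_rgt_eq[OF g, of p] hom_rlt_eq[OF g, of p])

lemma hausdorff_continuous_H_Delta: "hausdorff_continuous (H_Delta g)"
  unfolding hausdorff_continuous_def
proof (intro conjI allI impI frame_hom_H_Delta)
  fix p q :: rat assume "p < q"
  then obtain r where r: "p < r" "r < q" using dense by blast
  then obtain s where s: "r < s" "s < q" using dense by blast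
  have le: "of_bool_frame (g (rgt r)) \<le> H_Delta g (igt p)" "of_bool_frame (g (rlt s)) \<le> H_Delta g (ilt q)"
    unfolding H_Delta_igt H_Delta_ilt using r s by (auto intro: SUP_upper)
  have cover: "g (rgt r) \<squnion> g (rlt s) = \<top>" by (rule hom_rgt_sup_rlt[OF g s(1)])
  show "pcompl (H_Delta g (igt p)) \<le> H_Delta g (ilt q)"
    using pcompl_antimono[OF le(1)] pcompl_of_bool_frame_le[OF cover] le(2) by (meson order_trans)
  show "pcompl (H_Delta g (ilt q)) \<le> H_Delta g (igt p)"
    using pcompl_antimono[OF le(2)] pcompl_of_bool_frame_le[OF cover[unfolded sup.commute[of "g (rgt r)"]]] le(1)
    by (meson order_trans)
qed

lemma nearly_finite_H_Delta: "nearly_finite (H_Delta g)"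
  unfolding nearly_finite_def booleanize_top_iff[symmetric]
  by (simp add: frame_hom_Sup[OF frame_hom_booleanize] image_image booleanize_H_Delta
      SUP_hom_rgt[OF g] SUP_hom_rlt[OF g])

end

section \<open>\<open>H_Gamma\<close> and \<open>H_Delta\<close> as inverse isomorphisms\<close>

definition Hnf :: "(frame_of_ereals \<Rightarrow> 'a::frame) set" where
  "Hnf = {f. hausdorff_continuous f \<and> nearly_finite f}"

lemma Hnf_frame_hom: "f \<in> Hnf \<Longrightarrow> frame_hom f"
  by (simp add: Hnf_def hausdorff_continuous_def)

lemma H_Delta_in_Hnf: "frame_hom g \<Longrightarrow> H_Delta g \<in> Hnf"
  by (simp add: Hnf_def hausdorff_continuous_H_Delta nearly_finite_H_Delta)

lemma frame_hom_H_Gamma: "f \<in> Hnf \<Longrightarrow> frame_hom (H_Gamma f)"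
  by (simp add: Hnf_def H_Gamma(1))

lemma H_Gamma_gen:
  assumes f: "f \<in> Hnf"
  shows "H_Gamma f (rgt p) = booleanize (f (igt p))" "H_Gamma f (rlt p) = booleanize (f (ilt p))"
proof -
  have rel: "ireal_relations rgt rlt"
    using real_relations_gen unfolding real_relations_def ireal_relations_def by blast
  have "H_Gamma f (ireal_hom rgt rlt x) = booleanize (f x)" for x
    using H_Gamma(2)[of f] f by (simp add: Hnf_def fun_eq_iff)
  from this[of "igt p"] this[of "ilt p"]
  show "H_Gamma f (rgt p) = booleanize (f (igt p))" "H_Gamma f (rlt p) = booleanize (f (ilt p))"
    by (simp_all add: ireal_hom[OF rel])
qed

lemma H_Gamma_H_Delta:
  assumes g: "frame_hom g" shows "H_Gamma (H_Delta g) = g"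
  by (rule C_eqI)
    (simp_all add: g frame_hom_H_Gamma H_Delta_in_Hnf H_Gamma_gen booleanize_H_Delta)

text \<open>For p < r the double pseudocomplement of f(r,-) lies below the pseudocomplement of
  f(-,r) by (r1), and this below f(p,-) by Hausdorff continuity. The join over r > p therefore adds
  nothing; lower generators are treated symmetrically.\<close>

lemma H_Delta_H_Gamma:
  assumes f: "f \<in> Hnf" shows "H_Delta (H_Gamma f) = f"
proof (rule frame_hom_ireal_eqI)
  note hom = Hnf_frame_hom[OF f] and gh = frame_hom_H_Gamma[OF f]
  show "frame_hom (H_Delta (H_Gamma f))" "frame_hom f"
    by (rule frame_hom_H_Delta[OF gh], rule hom)
  have rel: "ireal_relations (\<lambda>p. f (igt p)) (\<lambda>q. f (ilt q))"
    by (rule frame_hom_ireal_relations[OF hom])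
  have disj: "f (igt p) \<sqinter> f (ilt q) = \<bottom>" if "q \<le> p" for p q
    using rel that unfolding ireal_relations_def by blast
  have igt: "f (igt p) = (\<Squnion>q\<in>{q. q > p}. f (igt q))" and ilt: "f (ilt p) = (\<Squnion>q\<in>{q. q < p}. f (ilt q))"
    for p using rel unfolding ireal_relations_def by blast+
  have H: "pcompl (f (igt p)) \<le> f (ilt q)" "pcompl (f (ilt q)) \<le> f (igt p)" if "p < q" for p q
    using f that by (simp_all add: Hnf_def hausdorff_continuous_def)
  show "H_Delta (H_Gamma f) (igt p) = f (igt p)" for p
    unfolding H_Delta_igt[OF gh] H_Gamma_gen[OF f] of_bool_frame_booleanize
  proof (rule antisym; (rule SUP_least)?)
    fix r assume r: "r \<in> {r. p < r}"
    have "pcompl (pcompl (f (igt r))) \<le> pcompl (f (ilt r))"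
      by (intro pcompl_antimono) (simp add: le_pcompl_iff disj)
    also have "\<dots> \<le> f (igt p)" using r H by simp
    finally show "pcompl (pcompl (f (igt r))) \<le> f (igt p)" .
  next
    show "f (igt p) \<le> (\<Squnion>r\<in>{r. p < r}. pcompl (pcompl (f (igt r))))"
      by (subst igt) (intro SUP_subset_mono order_refl le_pcompl_pcompl)
  qed
  show "H_Delta (H_Gamma f) (ilt p) = f (ilt p)" for p
    unfolding H_Delta_ilt[OF gh] H_Gamma_gen[OF f] of_bool_frame_booleanize
  proof (rule antisym; (rule SUP_least)?)
    fix r assume r: "r \<in> {r. r < p}"
    have "pcompl (pcompl (f (ilt r))) \<le> pcompl (f (igt r))"
      by (intro pcompl_antimono) (simp add: le_pcompl_iff disj inf.commute)
    also have "\<dots> \<le> f (ilt p)" using r H by simp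
    finally show "pcompl (pcompl (f (ilt r))) \<le> f (ilt p)" .
  next
    show "f (ilt p) \<le> (\<Squnion>r\<in>{r. r < p}. pcompl (pcompl (f (ilt r))))"
      by (subst ilt) (intro SUP_subset_mono order_refl le_pcompl_pcompl)
  qed
qed

lemma H_Gamma_le_iff:
  assumes f: "f \<in> Hnf" and g: "g \<in> Hnf"
  shows "C_le (H_Gamma f) (H_Gamma g) \<longleftrightarrow> IC_le f g"
proof
  show "C_le (H_Gamma f) (H_Gamma g)" if "IC_le f g"
    using that
    by (simp add: IC_le_def C_le_def H_Gamma_gen f g frame_hom_mono[OF frame_hom_booleanize])
  assume le: "C_le (H_Gamma f) (H_Gamma g)"
  have "IC_le (H_Delta (H_Gamma f)) (H_Delta (H_Gamma g))"
    using le
    by (auto simp: IC_le_def C_le_def H_Delta_igt H_Delta_ilt frame_hom_H_Gamma f g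
        less_eq_booleanization.rep_eq intro!: SUP_subset_mono)
  then show "IC_le f g" by (simp add: H_Delta_H_Gamma f g)
qed

text \<open>The lattice part is automatic, since least upper and greatest lower bounds are
  determined by the order.\<close>

lemma riesz_homI:
  assumes bij: "bij_betw e (carrier V) (carrier W)"
    and add: "\<And>x y. x \<in> carrier V \<Longrightarrow> y \<in> carrier V \<Longrightarrow> e (radd V x y) = radd W (e x) (e y)"
    and scale: "\<And>r x. x \<in> carrier V \<Longrightarrow> e (rscale V r x) = rscale W r (e x)"
    and le: "\<And>x y. x \<in> carrier V \<Longrightarrow> y \<in> carrier V \<Longrightarrow> rle W (e x) (e y) \<longleftrightarrow> rle V x y"
  shows "riesz_hom V W e"
proof -
  have W: "carrier W = e ` carrier V" using bij by (simp add: bij_betw_def)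
  show ?thesis
    unfolding riesz_hom_def riesz_lub_def riesz_glb_def W
    by (auto simp: add scale le)
qed

lemma Hnf_riesz_simps [simp]:
  "carrier (Hnf_riesz L) = Hnf" "rzero (Hnf_riesz L) = H_Delta C_zero"
  "radd (Hnf_riesz L) f g = H_Delta (C_add (H_Gamma f) (H_Gamma g))"
  "rscale (Hnf_riesz L) l f = H_Delta (C_scale l (H_Gamma f))"
  "rle (Hnf_riesz L) = IC_le"
  by (simp_all add: Hnf_riesz_def Hnf_def)

lemma riesz_isomorphic_Hnf_C:
  fixes L :: "'a::frame itself"
  shows "riesz_isomorphic (Hnf_riesz L) (C_riesz TYPE('a booleanization))"
    and "riesz_isomorphic (C_riesz TYPE('a booleanization)) (Hnf_riesz L)"
proof -
  note simps = H_Delta_H_Gamma H_Gamma_H_Delta frame_hom_H_Gamma H_Delta_in_Hnf frame_hom_C_add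
    frame_hom_C_scale H_Gamma_le_iff
  have "bij_betw H_Gamma (carrier (Hnf_riesz L)) (carrier (C_riesz TYPE('a booleanization)))"
    by (rule bij_betw_byWitness[where f' = H_Delta]) (auto simp: simps)
  moreover from this have "riesz_hom (Hnf_riesz L) (C_riesz TYPE('a booleanization)) H_Gamma"
    by (rule riesz_homI) (simp_all add: simps)
  ultimately show "riesz_isomorphic (Hnf_riesz L) (C_riesz TYPE('a booleanization))"
    unfolding riesz_isomorphic_def by blast
  have "bij_betw H_Delta (carrier (C_riesz TYPE('a booleanization))) (carrier (Hnf_riesz L))"
    by (rule bij_betw_byWitness[where f' = H_Gamma]) (auto simp: simps)
  moreover from this have "riesz_hom (C_riesz TYPE('a booleanization)) (Hnf_riesz L) H_Delta"
    by (rule riesz_homI) (auto simp: simps H_Gamma_le_iff[symmetric])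
  ultimately show "riesz_isomorphic (C_riesz TYPE('a booleanization)) (Hnf_riesz L)"
    unfolding riesz_isomorphic_def by blast
qed

section \<open>Recovering the Booleanization from the polars\<close>

definition positive_cone :: "'v riesz \<Rightarrow> 'v set" where
  "positive_cone V = {x \<in> carrier V. rle V (rzero V) x}"

text \<open>For positive elements this is the vanishing of the binary infimum, phrased through the
  order and zero alone.\<close>

definition disjoint_in :: "'v riesz \<Rightarrow> 'v \<Rightarrow> 'v \<Rightarrow> bool" where
  "disjoint_in V x y \<longleftrightarrow> (\<forall>z\<in>positive_cone V. rle V z x \<longrightarrow> rle V z y \<longrightarrow> z = rzero V)"

text \<open>The positive part of the usual disjoint complement, which avoids absolute
  values.\<close>

definition polar :: "'v riesz \<Rightarrow> 'v set \<Rightarrow> 'v set" where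
  "polar V A = {x \<in> positive_cone V. \<forall>a\<in>A. disjoint_in V a x}"

definition polars :: "'v riesz \<Rightarrow> 'v set set" where
  "polars V = polar V ` Pow (positive_cone V)"

text \<open>The order is recovered from suprema: x \<le> y iff \<open>y\<close> is the supremum of
  both, and this is preserved by the homomorphism and reflected by injectivity.\<close>

lemma riesz_embedding_le_iff:
  assumes V: "riesz_space V" and W: "riesz_space W" and e: "riesz_embedding V W e"
    and x: "x \<in> carrier V" and y: "y \<in> carrier V"
  shows "rle W (e x) (e y) \<longleftrightarrow> rle V x y"
proof -
  interpret V: riesz_space V by fact
  interpret W: riesz_space W by fact
  have e_closed: "e z \<in> carrier W" if "z \<in> carrier V" for z
    using e that by (simp add: riesz_embedding_def riesz_hom_def)
  obtain s where s: "riesz_lub V {x, y} s" using V.ex_lub[OF x y] by blast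
  then have sc: "s \<in> carrier V" by (simp add: riesz_lub_def)
  have es: "riesz_lub W {e x, e y} (e s)"
    using e s x y by (simp add: riesz_embedding_def riesz_hom_def)
  have "rle V x y \<longleftrightarrow> riesz_lub V {x, y} y" using x y V.le_refl by (auto simp: riesz_lub_def)
  also have "\<dots> \<longleftrightarrow> s = y" using s V.lub_unique by blast
  also have "\<dots> \<longleftrightarrow> e s = e y" using e sc y by (auto simp: riesz_embedding_def inj_on_eq_iff)
  also have "\<dots> \<longleftrightarrow> riesz_lub W {e x, e y} (e y)" using es W.lub_unique by metis
  also have "\<dots> \<longleftrightarrow> rle W (e x) (e y)" using x y e_closed W.le_refl by (auto simp: riesz_lub_def)
  finally show ?thesis ..
qed

lemma riesz_hom_zero:
  assumes V: "riesz_space V" and W: "riesz_space W" and e: "riesz_hom V W e"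
  shows "e (rzero V) = rzero W"
proof -
  interpret V: riesz_space V by fact
  interpret W: riesz_space W by fact
  have ec: "e (rzero V) \<in> carrier W" using e V.zero_closed by (simp add: riesz_hom_def)
  have "radd W (e (rzero V)) (e (rzero V)) = e (radd V (rzero V) (rzero V))"
    using e V.zero_closed by (simp add: riesz_hom_def)
  also have "\<dots> = radd W (rzero W) (e (rzero V))"
    using V.add_zero V.zero_closed W.add_zero[OF ec] W.add_commute[OF ec W.zero_closed] by simp
  finally show ?thesis by (rule W.add_right_cancel[OF ec W.zero_closed ec])
qed

lemma polar_image:
  assumes V: "riesz_space V" and W: "riesz_space W" and e: "riesz_hom V W e"
    and bij: "bij_betw e (carrier V) (carrier W)" and A: "A \<subseteq> carrier V"
  shows "polar W (e ` A) = e ` polar V A"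
proof -
  have emb: "riesz_embedding V W e" using e bij by (simp add: riesz_embedding_def bij_betw_def)
  interpret V: riesz_space V by fact
  note le = riesz_embedding_le_iff[OF V W emb] and zero = riesz_hom_zero[OF V W e, symmetric]
  have Wc: "carrier W = e ` carrier V" using bij by (simp add: bij_betw_def)
  have cone: "positive_cone W = e ` positive_cone V"
    unfolding positive_cone_def Wc zero by (auto simp: le V.zero_closed)
  have eq: "e z = e (rzero V) \<longleftrightarrow> z = rzero V" if "z \<in> carrier V" for z
    using bij that V.zero_closed by (auto simp: bij_betw_def inj_on_eq_iff)
  have disj: "disjoint_in W (e x) (e y) \<longleftrightarrow> disjoint_in V x y" if "x \<in> carrier V" "y \<in> carrier V" for x y
    unfolding disjoint_in_def cone zero using that by (auto simp: le positive_cone_def eq)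
  show ?thesis
    unfolding polar_def cone using A by (auto simp: disj positive_cone_def subset_eq)
qed

lemma positive_cone_image:
  assumes V: "riesz_space V" and W: "riesz_space W" and e: "riesz_hom V W e"
    and bij: "bij_betw e (carrier V) (carrier W)"
  shows "positive_cone W = e ` positive_cone V"
  \<comment> \<open>The polar of the empty set is the whole positive cone.\<close>
  using polar_image[OF assms, of "{}"] by (simp add: polar_def)

lemma polars_image:
  assumes "riesz_space V" "riesz_space W" "riesz_hom V W e" "bij_betw e (carrier V) (carrier W)"
  shows "polars W = image e ` polars V"
proof -
  have "Pow (positive_cone W) = image e ` Pow (positive_cone V)"
    unfolding positive_cone_image[OF assms] by (rule image_Pow_surj[OF refl, symmetric])
  then have "polars W = (\<lambda>A. polar W (e ` A)) ` Pow (positive_cone V)"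
    by (simp add: polars_def image_image)
  also have "\<dots> = (\<lambda>A. e ` polar V A) ` Pow (positive_cone V)"
    by (intro image_cong refl polar_image[OF assms]) (auto simp: positive_cone_def)
  finally show ?thesis by (simp add: polars_def image_image)
qed

section \<open>Order density and polars in an arbitrary universal completion of
  \<open>C(L)\<close>\<close>

lemma positive_cone_C_riesz: "f \<in> positive_cone (C_riesz L) \<longleftrightarrow> frame_hom f \<and> C_le C_zero f"
  by (simp add: positive_cone_def)

lemma C_nonneg_eq_zero_iff:
  assumes "f \<in> positive_cone (C_riesz L)" shows "f = C_zero \<longleftrightarrow> f (rgt 0) = \<bottom>"
proof
  assume *: "f (rgt 0) = \<bottom>"
  have f: "frame_hom f" "C_le C_zero f" using assms by (simp_all add: positive_cone_C_riesz)
  show "f = C_zero"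
  proof (rule C_eqI[OF f(1) frame_hom_C_zero])
    show "f (rgt p) = C_zero (rgt p)" for p
      using f(2) hom_rgt_antimono[OF f(1), of 0 p] *
      by (auto simp: C_nonneg_iff[OF f(1)] C_zero_rgt bot_unique)
  qed
qed (simp add: C_zero_rgt)

text \<open>By complete regularity a nonzero \<open>c\<close> has a nonzero element completely below
  it, and a bump of height 1 between the two is the required test function.\<close>

lemma ex_function_below:
  assumes cr: "completely_regular L" and c: "c \<noteq> (\<bottom>::'a::frame)"
  shows "\<exists>h\<in>positive_cone (C_riesz L). h \<noteq> C_zero \<and> h (rgt 0) \<le> c"
proof -
  have "\<Squnion>{a. completely_below a c} = c" using cr by (simp add: completely_regular_def)
  then have "\<exists>a. completely_below a c \<and> a \<noteq> \<bottom>" 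
    using c Sup_bot_conv(1)[of "{a. completely_below a c}"] by auto
  then obtain a where a: "completely_below a c" "a \<noteq> \<bottom>" by blast
  obtain h where h: "frame_hom h" "C_le C_zero h" "\<forall>p<1. a \<le> h (rgt p)" "\<forall>p\<ge>0. h (rgt p) \<le> c"
    using completely_below_function[OF a(1), of 1] by auto
  have "h (rgt 0) \<noteq> \<bottom>" using h(3) a(2) by (metis bot_unique zero_less_one)
  then have "h \<noteq> C_zero" by (auto simp: C_zero_rgt)
  then show ?thesis using h by (auto simp: positive_cone_C_riesz)
qed

context
  fixes L :: "'a::frame itself" and U :: "'u riesz" and \<mu> :: "(frame_of_reals \<Rightarrow> 'a) \<Rightarrow> 'u"
  assumes cr: "completely_regular L" and uc: "universal_completion (C_riesz L) U \<mu>"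
begin

interpretation U: riesz_space U
  using uc by (simp add: universal_completion_def universally_complete_def)

interpretation R: riesz_space "C_riesz L"
  by (rule riesz_space_C_riesz)

lemma completion_embedding: "riesz_embedding (C_riesz L) U \<mu>" "riesz_hom (C_riesz L) U \<mu>"
  using uc by (simp_all add: universal_completion_def riesz_embedding_def)

lemma completion_zero: "\<mu> C_zero = rzero U"
  using riesz_hom_zero[OF R.riesz_space_axioms U.riesz_space_axioms completion_embedding(2)] by simp

lemma completion_le_iff: "frame_hom f \<Longrightarrow> frame_hom g \<Longrightarrow> rle U (\<mu> f) (\<mu> g) \<longleftrightarrow> C_le f g"
  using riesz_embedding_le_iff[OF R.riesz_space_axioms U.riesz_space_axioms completion_embedding(1), of f g]
  by simp

lemma completion_closed: "frame_hom f \<Longrightarrow> \<mu> f \<in> carrier U"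
  using completion_embedding(2) by (simp add: riesz_hom_def)

lemma completion_positive: "f \<in> positive_cone (C_riesz L) \<Longrightarrow> \<mu> f \<in> positive_cone U"
  using completion_le_iff[OF frame_hom_C_zero, of f]
  by (simp add: positive_cone_def completion_closed completion_zero)

lemma completion_eq_zero_iff: "frame_hom f \<Longrightarrow> \<mu> f = rzero U \<longleftrightarrow> f = C_zero"
  using completion_embedding(1) inj_on_eq_iff[of \<mu> "{f. frame_hom f}" f C_zero]
  by (simp add: riesz_embedding_def completion_zero[symmetric] frame_hom_C_zero)

text \<open>The embedding preserves the binary infimum and reflects zero, so disjointness in
  \<open>U\<close> is decided in \<open>C(L)\<close> by cozero elements.\<close>

lemma completion_disjoint_iff:
  assumes f: "f \<in> positive_cone (C_riesz L)" and g: "g \<in> positive_cone (C_riesz L)"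
  shows "disjoint_in U (\<mu> f) (\<mu> g) \<longleftrightarrow> f (rgt 0) \<sqinter> g (rgt 0) = \<bottom>"
proof -
  have fg: "frame_hom f" "frame_hom g" "C_le C_zero f" "C_le C_zero g"
    using f g by (simp_all add: positive_cone_C_riesz)
  have glb: "riesz_glb U {\<mu> f, \<mu> g} (\<mu> s)" if "riesz_glb (C_riesz L) {f, g} s" for s
    using completion_embedding(2) that fg unfolding riesz_hom_def by simp
  let ?m = "C_inf f g"
  have m: "riesz_glb (C_riesz L) {f, g} ?m" by (rule riesz_glb_C_inf[OF fg(1,2)])
  then have m_hom: "frame_hom ?m" by (simp add: riesz_glb_def)
  have "C_le C_zero ?m" using m fg by (simp add: riesz_glb_def frame_hom_C_zero)
  then have m_pos: "\<mu> ?m \<in> positive_cone U"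
    using m_hom by (intro completion_positive) (simp add: positive_cone_C_riesz)
  have "disjoint_in U (\<mu> f) (\<mu> g) \<longleftrightarrow> \<mu> ?m = rzero U"
  proof
    show "\<mu> ?m = rzero U" if "disjoint_in U (\<mu> f) (\<mu> g)"
      using that m_pos glb[OF m] by (simp add: disjoint_in_def riesz_glb_def)
    assume *: "\<mu> ?m = rzero U"
    have "z = rzero U" if "z \<in> positive_cone U" "rle U z (\<mu> f)" "rle U z (\<mu> g)" for z
      using glb[OF m] that * U.le_antisym[of z "rzero U"] U.zero_closed
      by (simp add: positive_cone_def riesz_glb_def)
    then show "disjoint_in U (\<mu> f) (\<mu> g)" by (auto simp: disjoint_in_def)
  qed
  also have "\<dots> \<longleftrightarrow> ?m = C_zero" by (rule completion_eq_zero_iff[OF m_hom])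
  also have "\<dots> \<longleftrightarrow> riesz_glb (C_riesz L) {f, g} C_zero" using m R.glb_unique by metis
  also have "\<dots> \<longleftrightarrow> f (rgt 0) \<sqinter> g (rgt 0) = \<bottom>" by (rule C_riesz_disjoint_iff[OF fg])
  finally show ?thesis .
qed

text \<open>\<open>z\<close> is the supremum of the embedded functions between zero and
  \<open>z\<close>; if these were all zero, \<open>z\<close> would be zero too.\<close>

lemma ex_completion_below:
  assumes z: "z \<in> positive_cone U" "z \<noteq> rzero U"
  shows "\<exists>h\<in> positive_cone (C_riesz L). h \<noteq> C_zero \<and> rle U (\<mu> h) z"
proof (rule ccontr)
  assume none: "\<not> ?thesis"
  have "riesz_lub U {\<mu> g |g. g \<in> carrier (C_riesz L) \<and> rle U (rzero U) (\<mu> g) \<and> rle U (\<mu> g) z} z" (is "riesz_lub U ?A z")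
    using uc z by (simp add: universal_completion_def positive_cone_def)
  moreover have "\<forall>a\<in>?A. rle U a (rzero U)"
  proof
    fix a assume "a \<in> ?A"
    then obtain g where g: "a = \<mu> g" "frame_hom g" "rle U (rzero U) (\<mu> g)" "rle U (\<mu> g) z" by auto
    have "g \<in> positive_cone (C_riesz L)"
      using g completion_le_iff[OF frame_hom_C_zero g(2)]
      by (simp add: positive_cone_C_riesz completion_zero)
    then have "g = C_zero" using none g by blast
    then show "rle U a (rzero U)" using g U.le_refl U.zero_closed completion_zero by simp
  qed
  ultimately have "rle U z (rzero U)" using U.zero_closed by (simp add: riesz_lub_def)
  then show False using z U.le_antisym U.zero_closed by (auto simp: positive_cone_def)
qed

lemma disjoint_in_self: "x \<in> positive_cone U \<Longrightarrow> disjoint_in U x x \<Longrightarrow> x = rzero U"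
  using U.le_refl by (auto simp: disjoint_in_def positive_cone_def)

lemma disjoint_in_mono:
  assumes "disjoint_in U x y" "rle U x' x" "rle U y' y"
    and "x \<in> carrier U" "x' \<in> carrier U" "y \<in> carrier U" "y' \<in> carrier U"
  shows "disjoint_in U x' y'"
  unfolding disjoint_in_def
proof (intro ballI impI)
  fix z assume z: "z \<in> positive_cone U" "rle U z x'" "rle U z y'"
  then have "z \<in> carrier U" by (simp add: positive_cone_def)
  then have "rle U z x" "rle U z y" using z assms U.le_trans by blast+
  then show "z = rzero U" using assms(1) z(1) by (simp add: disjoint_in_def)
qed

text \<open>By order density the overlap of two elements is witnessed by an embedded function, for
  which cozero elements are available.\<close>

lemma not_disjoint_in:
  assumes "\<not> disjoint_in U x y" and "x \<in> carrier U" "y \<in> carrier U"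
  shows "\<exists>h\<in> positive_cone (C_riesz L). h \<noteq> C_zero \<and> rle U (\<mu> h) x \<and> rle U (\<mu> h) y"
proof -
  obtain z where z: "z \<in> positive_cone U" "rle U z x" "rle U z y" "z \<noteq> rzero U"
    using assms(1) by (auto simp: disjoint_in_def)
  obtain h where h: "h \<in> positive_cone (C_riesz L)" "h \<noteq> C_zero" "rle U (\<mu> h) z" using ex_completion_below z by blast
  have "\<mu> h \<in> carrier U" "z \<in> carrier U"
    using h(1) z(1) completion_closed by (auto simp: positive_cone_def)
  then have "rle U (\<mu> h) x" "rle U (\<mu> h) y" using h(3) z(2,3) assms(2,3) U.le_trans by blast+
  then show ?thesis using h by blast
qed

lemma disjoint_in_commute: "disjoint_in U x y \<longleftrightarrow> disjoint_in U y x"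
  by (auto simp: disjoint_in_def)

text \<open>An element of \<open>U\<close> has no cozero element, so lying within \<open>b\<close>
  is expressed as disjointness from all functions that live off \<open>b\<close>.\<close>

definition support_polar :: "'a booleanization \<Rightarrow> 'u set" where
  "support_polar b = polar U (\<mu> ` {g \<in> positive_cone (C_riesz L). g (rgt 0) \<sqinter> of_bool_frame b = \<bottom>})"

lemma support_polar_subset_iff: "support_polar b \<subseteq> support_polar c \<longleftrightarrow> b \<le> c"
proof
  assume "b \<le> c"
  then have "g (rgt 0) \<sqinter> of_bool_frame b \<le> g (rgt 0) \<sqinter> of_bool_frame c" for g :: "frame_of_reals \<Rightarrow> 'a"
    by (intro inf_mono) (simp_all add: less_eq_booleanization.rep_eq)
  then have "{g \<in> positive_cone (C_riesz L). g (rgt 0) \<sqinter> of_bool_frame c = \<bottom>} \<subseteq> {g \<in> positive_cone (C_riesz L). g (rgt 0) \<sqinter> of_bool_frame b = \<bottom>}"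
    using bot_unique by (metis (mono_tags, lifting) Collect_mono)
  then show "support_polar b \<subseteq> support_polar c"
    by (auto simp: support_polar_def polar_def)
next
  assume sub: "support_polar b \<subseteq> support_polar c"
  let ?b = "of_bool_frame b" and ?c = "of_bool_frame c"
  \<comment> \<open>A test function h living inside \<open>b\<close> and off \<open>c\<close> would
    belong to \<open>support_polar b\<close>, hence to \<open>support_polar c\<close>; but it is
    also one of the functions defining the latter, so it would be disjoint from itself.\<close>
  have "?b \<sqinter> pcompl ?c = \<bottom>"
  proof (rule ccontr)
    assume "?b \<sqinter> pcompl ?c \<noteq> \<bottom>"
    then obtain h where h: "h \<in> positive_cone (C_riesz L)" "h \<noteq> C_zero" "h (rgt 0) \<le> ?b \<sqinter> pcompl ?c"
      using ex_function_below[OF cr] by blast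
    have "disjoint_in U (\<mu> g) (\<mu> h)" if g: "g \<in> positive_cone (C_riesz L)" "g (rgt 0) \<sqinter> ?b = \<bottom>" for g
    proof -
      have "g (rgt 0) \<sqinter> h (rgt 0) \<le> g (rgt 0) \<sqinter> ?b" using h(3) by (intro inf_mono) auto
      then show ?thesis using g h(1) by (simp add: completion_disjoint_iff bot_unique)
    qed
    then have "\<mu> h \<in> support_polar b" using h(1) by (auto simp: support_polar_def polar_def completion_positive)
    then have "\<mu> h \<in> support_polar c" using sub by blast
    moreover have "h (rgt 0) \<sqinter> ?c \<le> \<bottom>"
      using h(3) inf_mono[of "h (rgt 0)" "pcompl ?c" ?c ?c] by (simp add: inf_pcompl inf.commute)
    ultimately have "disjoint_in U (\<mu> h) (\<mu> h)"
      using h(1) by (simp add: support_polar_def polar_def bot_unique)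
    then show False
      using h disjoint_in_self completion_positive completion_eq_zero_iff
      by (auto simp: positive_cone_C_riesz)
  qed
  then have "?b \<le> pcompl (pcompl ?c)" by (simp add: le_pcompl_iff inf.commute)
  then show "b \<le> c" using of_bool_frame[of c] by (simp add: less_eq_booleanization.rep_eq)
qed

lemma range_support_polar: "range support_polar = polars U"
proof
  show "range support_polar \<subseteq> polars U"
    by (auto simp: support_polar_def polars_def intro!: imageI completion_positive)
  show "polars U \<subseteq> range support_polar"
  proof
    fix Q assume "Q \<in> polars U"
    then obtain A where A: "A \<subseteq> positive_cone U" "Q = polar U A" by (auto simp: polars_def)
    \<comment> \<open>As \<open>Q\<close> is the polar of \<open>A\<close>, \<open>polar U Q\<close>
      is the double polar of \<open>A\<close>. The join \<open>s\<close> is the region occupied by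
      its functions, so \<open>Q\<close> should be the part of \<open>U\<close> living on
      \<open>pcompl s\<close>.\<close>
    define G where "G = {g \<in> positive_cone (C_riesz L). \<mu> g \<in> polar U Q}"
    define s where "s = (\<Squnion>g\<in>G. g (rgt 0))"
    have carr: "x \<in> carrier U" if "x \<in> A \<or> x \<in> Q \<or> x \<in> polar U B" for x B
      using that A by (auto simp: positive_cone_def polar_def)
    have \<mu>c: "\<mu> g \<in> carrier U" if "g \<in> positive_cone (C_riesz L)" for g
      using that by (simp add: positive_cone_C_riesz completion_closed)
    define b where "b = booleanize (pcompl s)"
    have b: "of_bool_frame b = pcompl s" by (simp add: b_def of_bool_frame_booleanize)
    have "support_polar b \<subseteq> Q"
    proof
      fix y assume y: "y \<in> support_polar b"
      have yc: "y \<in> carrier U" using y by (simp add: support_polar_def polar_def positive_cone_def)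
      have "disjoint_in U a y" if a: "a \<in> A" for a
      proof (rule ccontr)
        assume "\<not> disjoint_in U a y"
        then obtain h where h: "h \<in> positive_cone (C_riesz L)" "h \<noteq> C_zero" "rle U (\<mu> h) a" "rle U (\<mu> h) y"
          using not_disjoint_in[of a y] carr a yc by blast
        \<comment> \<open>Lying below \<open>a\<close>, the overlap h is disjoint from all of
          \<open>Q\<close>, so it belongs to \<open>G\<close> and lives off \<open>b\<close>. Then
          \<open>y\<close> is disjoint from h although it dominates h.\<close>
        have "disjoint_in U x (\<mu> h)" if x: "x \<in> Q" for x
        proof -
          have "disjoint_in U x a"
            using x a A(2) disjoint_in_commute by (auto simp: polar_def)
          then show ?thesis
            using disjoint_in_mono[of x a x "\<mu> h"] h(1,3) carr[of x] carr[of a] x a \<mu>c U.le_refl by blast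
        qed
        then have "h \<in> G" using h(1) by (simp add: G_def polar_def completion_positive)
        then have "h (rgt 0) \<le> s" unfolding s_def by (rule SUP_upper)
        then have "h (rgt 0) \<sqinter> pcompl s \<le> s \<sqinter> pcompl s" by (rule inf_mono) simp
        then have "disjoint_in U (\<mu> h) y"
          using y h(1) by (simp add: support_polar_def polar_def b inf_pcompl bot_unique)
        then have "\<mu> h = rzero U"
          using h U.le_refl[OF \<mu>c[OF h(1)]] completion_positive by (auto simp: disjoint_in_def)
        then show False using h(1,2) completion_eq_zero_iff by (simp add: positive_cone_C_riesz)
      qed
      then show "y \<in> Q" using y by (simp add: A(2) support_polar_def polar_def)
    qed
    moreover have "Q \<subseteq> support_polar b"
    proof
      fix y assume y: "y \<in> Q"
      have "disjoint_in U (\<mu> g) y" if g: "g \<in> positive_cone (C_riesz L)" "g (rgt 0) \<sqinter> pcompl s = \<bottom>" for g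
      proof (rule ccontr)
        assume "\<not> disjoint_in U (\<mu> g) y"
        then obtain h where h: "h \<in> positive_cone (C_riesz L)" "h \<noteq> C_zero" "rle U (\<mu> h) (\<mu> g)" "rle U (\<mu> h) y"
          using not_disjoint_in[of "\<mu> g" y] carr y g \<mu>c by blast
        have "C_le h g" using h(1,3) g(1) completion_le_iff by (simp add: positive_cone_C_riesz)
        then have "h (rgt 0) \<sqinter> pcompl s \<le> g (rgt 0) \<sqinter> pcompl s"
          by (intro inf_mono) (auto simp: C_le_def)
        then have hs: "h (rgt 0) \<sqinter> pcompl s = \<bottom>" using g(2) by (simp add: bot_unique)
        \<comment> \<open>Lying below y \<in> Q, the overlap h is disjoint from every member of
          \<open>G\<close>, so its cozero element lies in \<open>pcompl s\<close>; by
          \<open>hs\<close> it also misses \<open>pcompl s\<close>.\<close>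
        have "h (rgt 0) \<sqinter> g' (rgt 0) \<le> \<bottom>" if g': "g' \<in> G" for g'
        proof -
          have "g' \<in> positive_cone (C_riesz L)" "disjoint_in U y (\<mu> g')" using g' y by (auto simp: G_def polar_def)
          then have "disjoint_in U (\<mu> h) (\<mu> g')"
            using disjoint_in_mono[of y "\<mu> g'" "\<mu> h" "\<mu> g'"] h(1,4) carr[of y] y \<mu>c U.le_refl by blast
          then show ?thesis using h(1) \<open>g' \<in> positive_cone (C_riesz L)\<close> by (simp add: completion_disjoint_iff)
        qed
        then have "h (rgt 0) \<sqinter> s \<le> \<bottom>" unfolding s_def by (simp add: inf_SUP_le_iff)
        then have "h (rgt 0) \<le> pcompl s" by (simp add: le_pcompl_iff inf.commute bot_unique)
        then have "h (rgt 0) = \<bottom>" using hs by (simp add: inf.absorb1)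
        then show False using h(1,2) C_nonneg_eq_zero_iff by blast
      qed
      then show "y \<in> support_polar b"
        using y by (auto simp: A(2) support_polar_def polar_def b)
    qed
    ultimately show "Q \<in> range support_polar" by blast
  qed
qed

lemma ex_order_iso_polars:
  "\<exists>\<Phi> :: 'a booleanization \<Rightarrow> 'u set. range \<Phi> = polars U \<and> (\<forall>b c. \<Phi> b \<subseteq> \<Phi> c \<longleftrightarrow> b \<le> c)"
  using range_support_polar support_polar_subset_iff by blast

end

section \<open>From polars back to frames\<close>

lemma frame_isomorphicI_order:
  fixes h :: "'a::frame \<Rightarrow> 'b::frame"
  assumes le: "\<And>a b. h a \<le> h b \<longleftrightarrow> a \<le> b" and surj: "surj h"
  shows "frame_isomorphic (L :: 'a itself) (M :: 'b itself)"
proof -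
  have inj: "inj h" by (rule injI) (metis le order_antisym order_refl)
  have pre: "\<exists>a. h a = b" for b using surj by (metis surjD)
  have "frame_hom h"
  proof (rule frame_homI)
    obtain t where t: "h t = \<top>" using pre by blast
    then have "t = \<top>" using le[of \<top> t] by (simp add: top_unique)
    then show "h \<top> = \<top>" using t by simp
    show "h (a \<sqinter> b) = h a \<sqinter> h b" for a b
    proof (rule antisym)
      obtain c where c: "h c = h a \<sqinter> h b" using pre by blast
      then have "c \<le> a \<sqinter> b" using le[of c a] le[of c b] by simp
      then show "h a \<sqinter> h b \<le> h (a \<sqinter> b)" using c le by metis
    qed (simp add: le)
    show "h (\<Squnion>A) = \<Squnion>(h ` A)" for A
    proof (rule antisym)
      obtain c where c: "h c = \<Squnion>(h ` A)" using pre by blast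
      then have "h a \<le> h c" if "a \<in> A" for a using that by (simp add: SUP_upper)
      then have "\<Squnion>A \<le> c" by (auto simp: le intro: Sup_least)
      then show "h (\<Squnion>A) \<le> \<Squnion>(h ` A)" using c le by metis
    qed (auto simp: le intro!: SUP_least Sup_upper)
  qed
  then show ?thesis using inj surj by (auto simp: frame_isomorphic_def bij_def)
qed

lemma booleanizations_isomorphicI:
  fixes L :: "'a::frame itself" and M :: "'b::frame itself"
  assumes cr: "completely_regular L" "completely_regular M"
    and iso: "isomorphic_universal_completions (C_riesz L) (C_riesz M)"
  shows "frame_isomorphic TYPE('a booleanization) TYPE('b booleanization)"
proof -
  obtain U :: "((frame_of_reals \<Rightarrow> 'a) set \<times> (frame_of_reals \<Rightarrow> 'a) set) riesz" and \<mu>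
    and V :: "((frame_of_reals \<Rightarrow> 'b) set \<times> (frame_of_reals \<Rightarrow> 'b) set) riesz" and \<nu>
    where U: "universal_completion (C_riesz L) U \<mu>" and V: "universal_completion (C_riesz M) V \<nu>"
      and UV: "riesz_isomorphic U V"
    using iso unfolding isomorphic_universal_completions_def by blast
  have rs: "riesz_space U" "riesz_space V"
    using U V by (simp_all add: universal_completion_def universally_complete_def)
  obtain e where e: "riesz_hom U V e" "bij_betw e (carrier U) (carrier V)"
    using UV by (auto simp: riesz_isomorphic_def)
  from ex_order_iso_polars[OF cr(1) U] obtain \<Phi> :: "'a booleanization \<Rightarrow> ((frame_of_reals \<Rightarrow> 'a) set \<times> (frame_of_reals \<Rightarrow> 'a) set) set"
    where "range \<Phi> = polars U \<and> (\<forall>b c. \<Phi> b \<subseteq> \<Phi> c \<longleftrightarrow> b \<le> c)" by (rule exE)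
  then have \<Phi>: "range \<Phi> = polars U" "\<And>b c. \<Phi> b \<subseteq> \<Phi> c \<longleftrightarrow> b \<le> c" by simp_all
  from ex_order_iso_polars[OF cr(2) V] obtain \<Psi> :: "'b booleanization \<Rightarrow> ((frame_of_reals \<Rightarrow> 'b) set \<times> (frame_of_reals \<Rightarrow> 'b) set) set"
    where "range \<Psi> = polars V \<and> (\<forall>b c. \<Psi> b \<subseteq> \<Psi> c \<longleftrightarrow> b \<le> c)" by (rule exE)
  then have \<Psi>: "range \<Psi> = polars V" "\<And>b c. \<Psi> b \<subseteq> \<Psi> c \<longleftrightarrow> b \<le> c" by simp_all
  \<comment> \<open>Taking images under \<open>e\<close> matches the polars of \<open>U\<close> with
    those of \<open>V\<close>, so both Booleanizations parametrise the same family of sets and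
    \<open>h\<close> can be read off as the change of parameter.\<close>
  have pol: "range \<Psi> = range (\<lambda>b. e ` \<Phi> b)"
    using polars_image[OF rs e] by (simp add: \<Psi>(1) \<Phi>(1)[symmetric] image_image)
  have "\<exists>c. \<Psi> c = e ` \<Phi> b" for b
  proof -
    have "e ` \<Phi> b \<in> range \<Psi>" unfolding pol by (rule rangeI)
    then obtain c where "e ` \<Phi> b = \<Psi> c" by (rule rangeE)
    then show ?thesis by (intro exI[of _ c]) (rule sym)
  qed
  then obtain h where h: "\<And>b. \<Psi> (h b) = e ` \<Phi> b" by metis
  have sub: "\<Phi> b \<subseteq> carrier U" for b
  proof -
    have "\<Phi> b \<in> polars U" using \<Phi>(1) by blast
    then show ?thesis by (auto simp: polars_def polar_def positive_cone_def)
  qed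
  have inj: "inj_on e (carrier U)" using e(2) by (simp add: bij_betw_def)
  show ?thesis
  proof (rule frame_isomorphicI_order)
    show "h b \<le> h c \<longleftrightarrow> b \<le> c" for b c
      unfolding \<Psi>(2)[symmetric] h \<Phi>(2)[symmetric]
      using sub[of b] inj_on_image_mem_iff[OF inj _ sub[of c]] by (auto simp: image_subset_iff subset_eq)
    show "surj h"
      unfolding surj_def
    proof
      fix c
      have "\<Psi> c \<in> range (\<lambda>b. e ` \<Phi> b)" using pol by blast
      then obtain b where "\<Psi> c = e ` \<Phi> b" by (rule rangeE)
      then have "\<Psi> (h b) = \<Psi> c" by (simp add: h)
      then have "h b = c" using \<Psi>(2)[of "h b" c] \<Psi>(2)[of c "h b"] by simp
      then show "\<exists>b. c = h b" by blast
    qed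
  qed
qed

theorem proposition5p4:
  fixes L :: "'a::frame itself" and M :: "'b::frame itself"
  assumes "completely_regular L" and "completely_regular M"
  shows "(frame_isomorphic TYPE('a booleanization) TYPE('b booleanization)
            \<longleftrightarrow> riesz_isomorphic (Hnf_riesz L) (Hnf_riesz M)) \<and>
         (riesz_isomorphic (Hnf_riesz L) (Hnf_riesz M)
            \<longleftrightarrow> isomorphic_universal_completions (C_riesz L) (C_riesz M))"
proof -
  have "riesz_isomorphic (Hnf_riesz L) (Hnf_riesz M)"
    if "frame_isomorphic TYPE('a booleanization) TYPE('b booleanization)"
    using riesz_isomorphic_trans[OF riesz_isomorphic_trans[OF riesz_isomorphic_Hnf_C(1)
          riesz_isomorphic_C_riesz[OF that]] riesz_isomorphic_Hnf_C(2)] .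
  moreover have "isomorphic_universal_completions (C_riesz L) (C_riesz M)"
    if "riesz_isomorphic (Hnf_riesz L) (Hnf_riesz M)"
    using riesz_isomorphic_trans[OF riesz_isomorphic_trans[OF riesz_isomorphic_Hnf_C(2) that]
        riesz_isomorphic_Hnf_C(1)]
    by (rule isomorphic_universal_completionsI[OF universal_completion_booleanization[OF assms(1)]
          universal_completion_booleanization[OF assms(2)]])
  moreover note booleanizations_isomorphicI[OF assms]
  ultimately show ?thesis by blast
qed

end
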